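(* Let $n$ be a positive integer and let $f_0,\dots,f_n$ be linearly independent functions in $H^1_n$. Then there is a singular inner function $S$ with the following property: whenever $\lambda_0,\dots,\lambda_n$ are complex numbers with $\sum_{j=0}^n|\lambda_j|>0$, the singular factor of $\sum_{j=0}^n\lambda_jf_j$ divides $S$.
   Context: $\mathbb{D}$ is the open unit disk and $H^1$ is the usual holomorphic Hardy space on $\mathbb{D}$. $H^1_n$ is the set of holomorphic functions $f$ on $\mathbb{D}$ with $f^{(n)}\in H^1$ (one then has $f\in H^1$). A singular inner function is a function of the form $S_\mu(z)=\exp\left\{-\int_{\mathbb{T}}\frac{\zeta+z}{\zeta-z}\,d\mu(\zeta)\right\}$ with $\mu$ a nonnegative finite singular measure on the circle $\mathbb{T}$ (the constant $1$, $\mu=0$, is allowed). Every non-null $f\in H^1$ factors canonically (up to a unimodular constant) as $f=BS\mathcal{O}$ with $B$ a Blaschke product, $S$ a singular inner function (the singular factor of $f$) and $\mathcal{O}$ outer. An inner function $I_1$ divides an inner function $I_2$ if $I_2/I_1$ is an inner function. *)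

theory Defs
  imports "HOL-Analysis.Analysis"
begin

text \<open>
  Functions on the open unit disk \<open>\<D>\<close> are total functions \<^typ>\<open>complex \<Rightarrow> complex\<close> of which only the
  values on \<^term>\<open>ball (0::complex) 1\<close> matter; every notion below depends on these values alone.
  Measures on the circle \<open>\<T>\<close> are Borel measures on \<^typ>\<open>complex\<close> concentrated on
  \<^term>\<open>sphere (0::complex) 1\<close>.
\<close>

text \<open>Normalized arc length measure on \<open>\<T>\<close> (total mass 1).\<close>

definition circle_measure :: "complex measure" where
  "circle_measure = distr (uniform_measure lborel {0..<2 * pi}) borel cis"

definition hardy1 :: "(complex \<Rightarrow> complex) \<Rightarrow> bool" where
  "hardy1 f \<longleftrightarrow> f holomorphic_on ball 0 1 \<and>
     (SUP r\<in>{0..<1::real}. \<integral>\<^sup>+ \<zeta>. ennreal (norm (f (of_real r * \<zeta>))) \<partial>circle_measure) < \<infinity>"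

definition hardy1_deriv :: "nat \<Rightarrow> (complex \<Rightarrow> complex) \<Rightarrow> bool" where
  "hardy1_deriv n f \<longleftrightarrow> f holomorphic_on ball 0 1 \<and> hardy1 ((deriv ^^ n) f)"

definition lin_indep_on_disk :: "nat \<Rightarrow> (nat \<Rightarrow> complex \<Rightarrow> complex) \<Rightarrow> bool" where
  "lin_indep_on_disk n f \<longleftrightarrow>
     (\<forall>c :: nat \<Rightarrow> complex. (\<forall>z\<in>ball 0 1. (\<Sum>j=0..n. c j * f j z) = 0) \<longrightarrow> (\<forall>j\<le>n. c j = 0))"

text \<open>Bounded by 1, with radial limits that exist and are unimodular almost everywhere on \<open>\<T>\<close>.\<close>

definition inner_function :: "(complex \<Rightarrow> complex) \<Rightarrow> bool" where
  "inner_function I \<longleftrightarrow> I holomorphic_on ball 0 1 \<and> (\<forall>z\<in>ball 0 1. norm (I z) \<le> 1) \<and>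
     (AE \<zeta> in circle_measure. \<exists>w. norm w = 1 \<and> ((\<lambda>r::real. I (of_real r * \<zeta>)) \<longlongrightarrow> w) (at_left 1))"

text \<open>
  The quotient \<open>J = I\<^sub>2 / I\<^sub>1\<close> is meant as a holomorphic function, i.e. with removable singularities
  removed, hence the product form instead of HOL's pointwise division with \<open>x / 0 = 0\<close>.
\<close>

definition inner_dvd :: "(complex \<Rightarrow> complex) \<Rightarrow> (complex \<Rightarrow> complex) \<Rightarrow> bool" where
  "inner_dvd I\<^sub>1 I\<^sub>2 \<longleftrightarrow> (\<exists>J. inner_function J \<and> (\<forall>z\<in>ball 0 1. I\<^sub>2 z = I\<^sub>1 z * J z))"

definition singular_circle_measure :: "complex measure \<Rightarrow> bool" where
  "singular_circle_measure \<mu> \<longleftrightarrow>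
     sets \<mu> = sets borel \<and> finite_measure \<mu> \<and> emeasure \<mu> (- sphere 0 1) = 0 \<and>
     (\<exists>N\<in>sets borel. emeasure circle_measure N = 0 \<and> emeasure \<mu> (- N) = 0)"

definition singular_inner :: "(complex \<Rightarrow> complex) \<Rightarrow> bool" where
  "singular_inner S \<longleftrightarrow> (\<exists>\<mu>. singular_circle_measure \<mu> \<and>
     (\<forall>z\<in>ball 0 1. S z = exp (- (\<integral>\<zeta>. (\<zeta> + z) / (\<zeta> - z) \<partial>\<mu>))))"

definition blaschke_factor :: "complex \<Rightarrow> complex \<Rightarrow> complex" where
  "blaschke_factor a z =
     (if a = 0 then z else of_real (norm a) / a * ((a - z) / (1 - cnj a * z)))"

text \<open>
  The zeros, with multiplicity, are the \<open>a k\<close> with \<open>k \<in> K\<close>; the index set \<open>K\<close> may be empty, finite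
  or infinite. \<^const>\<open>has_prod\<close> admits the finitely many factors that may vanish at a given point.
\<close>

definition blaschke_product :: "(complex \<Rightarrow> complex) \<Rightarrow> bool" where
  "blaschke_product B \<longleftrightarrow> (\<exists>(K :: nat set) a.
     (\<forall>k\<in>K. norm (a k) < 1) \<and> summable (\<lambda>k. if k \<in> K then 1 - norm (a k) else 0) \<and>
     (\<forall>z\<in>ball 0 1. (\<lambda>k. if k \<in> K then blaschke_factor (a k) z else 1) has_prod B z))"

definition outer_function :: "(complex \<Rightarrow> complex) \<Rightarrow> bool" where
  "outer_function F \<longleftrightarrow> (\<exists>k :: complex \<Rightarrow> real.
     (\<forall>\<zeta>. k \<zeta> > 0) \<and> integrable circle_measure (\<lambda>\<zeta>. ln (k \<zeta>)) \<and>
     (\<forall>z\<in>ball 0 1. F z = exp (\<integral>\<zeta>. (\<zeta> + z) / (\<zeta> - z) * of_real (ln (k \<zeta>)) \<partial>circle_measure)))"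

text \<open>
  \<open>S\<close> is the singular factor of \<open>f\<close>: it occurs in a canonical factorization \<open>f = c B S F\<close> with
  \<open>\<bar>c\<bar> = 1\<close>. Blaschke, singular and outer factors are all normalized here, so \<open>S\<close> is uniquely
  determined on the disk by \<open>f\<close>.
\<close>

definition is_singular_factor :: "(complex \<Rightarrow> complex) \<Rightarrow> (complex \<Rightarrow> complex) \<Rightarrow> bool" where
  "is_singular_factor S f \<longleftrightarrow> singular_inner S \<and>
     (\<exists>c B F. norm c = 1 \<and> blaschke_product B \<and> outer_function F \<and>
        (\<forall>z\<in>ball 0 1. f z = c * B z * S z * F z))"

end

theory Submission
  imports Defs "HOL-Complex_Analysis.Complex_Analysis" "HOL-Probability.Probability"
    "Jordan_Normal_Form.Determinant"
begin

text \<open>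
  Let \<open>W\<close> be the Wronskian determinant of \<open>f\<^sub>0, \<dots>, f\<^sub>n\<close>. Its rows of order below \<open>n\<close> are bounded and its
  last row is in \<open>H\<^sup>1\<close>, so \<open>W\<close> is in \<open>H\<^sup>1\<close>, and linear independence gives \<open>W \<noteq> 0\<close>
  (\<open>wronskian_nonzero\<close>). For \<open>g = \<Sum> \<lambda>\<^sub>j f\<^sub>j\<close> with \<open>\<lambda>\<^sub>k \<noteq> 0\<close>, Cramer's rule writes \<open>\<lambda>\<^sub>k W\<close> as a combination
  of \<open>g, g', \<dots>, g\<^sup>(\<^sup>n\<^sup>)\<close> with cofactors as coefficients. If the singular factor of \<open>g\<close> also divides
  the derivatives of \<open>g\<close>, then it divides \<open>W\<close>, and the singular factor of \<open>W\<close> serves for all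
  \<open>\<lambda>\<close> at once. The proof makes this precise with measures instead of a factorization of \<open>W\<close>.

  Let \<open>\<mu>\<close> be the singular measure of \<open>g\<close> and write \<open>P\<^sub>r \<mu>\<close> for the Poisson integral of \<open>\<mu>\<close> on the circle of
  radius \<open>r\<close>. Jensen's inequality bounds the integrals of \<open>log\<^sup>-|W|\<close> over these circles
  (\<open>log_integral_bounded_near_boundary\<close>), so along some radii tending to \<open>1\<close> the densities
  converge weakly to a finite measure \<open>\<sigma>\<close>, which depends on \<open>W\<close> only. Suppose that
  \<open>P\<^sub>r \<mu> \<le> log\<^sup>-|W| + q\<^sub>r\<close> with uniformly integrable \<open>q\<^sub>r\<close>. In the limit \<open>q\<^sub>r\<close> contributes nothing on a set of
  arc length \<open>0\<close> (\<open>emeasure_null_compact_le\<close>), so \<open>\<mu>\<close> lies below the singular part of \<open>\<sigma>\<close>, whose inner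
  function is the desired \<open>S\<close>. The quotient is the inner function of the difference of two measures;
  that such a function has unimodular radial limits is \<open>inner_function_singular_measure\<close>.

  It remains to find \<open>q\<^sub>r\<close>. The factorization of \<open>g\<close> yields \<open>|g| \<le> exp (P h - P \<mu>)\<close> with integrable \<open>h\<close>. On the
  disk of radius \<open>(1 - r)\<^sup>2 / 4\<close> about a point of modulus \<open>r\<close> all Poisson kernels are constant up to \<open>1\<close>, hence
  Cauchy's estimate carries the bound over to the derivatives of \<open>g\<close>, and then to \<open>W\<close>, at the cost
  of a power of \<open>1 / (1 - r)\<close>. Its logarithm \<open>m log (1 / (1 - r))\<close> is the only term of the resulting bound for
  \<open>P\<^sub>r \<mu>\<close> that is not uniformly integrable. Let \<open>d\<close> be the distance to the support of \<open>\<mu>\<close>. Where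
  \<open>1 - r \<le> d\<^sup>2\<close>, the Poisson integral of \<open>\<mu>\<close> is bounded anyway; elsewhere \<open>log (1 / (1 - r)) < 2 log (1 / d)\<close>. So it
  suffices that \<open>log (1 / d)\<close> is integrable, i.e. that the support is a Carleson set
  (\<open>log_distance_to_support_integrable\<close>). This is where \<open>g' \<in> H\<^sup>1\<close> enters: \<open>g\<close> is nearly \<open>0\<close> close to each
  point of the support, so \<open>|g|\<close> is at most about \<open>d\<close> times the maximal function of \<open>|g'|\<close>. Here
  \<open>log\<^sup>-|g|\<close> is integrable by Jensen's inequality and the logarithm of the maximal function by its
  weak-type estimate.
\<close>

section \<open>Arc length and the Poisson kernel\<close>

lemma integral_norm_bound_integral_AE:
  fixes f :: "'a \<Rightarrow> 'b::{banach, second_countable_topology}"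
  assumes "integrable M f" "integrable M g" "AE x in M. norm (f x) \<le> g x"
  shows "norm (\<integral>x. f x \<partial>M) \<le> (\<integral>x. g x \<partial>M)"
  using assms by (intro order_trans[OF integral_norm_bound] integral_mono_AE) auto

lemma ennreal_add_le: "ennreal (a + b) \<le> ennreal a + ennreal b"
  by (cases "0 \<le> a"; cases "0 \<le> b") (auto simp: ennreal_neg ennreal_leI simp flip: ennreal_plus)

lemma sets_circle_measure [simp, measurable_cong]: "sets circle_measure = sets borel"
  by (simp add: circle_measure_def)

lemma space_circle_measure [simp]: "space circle_measure = UNIV"
  by (simp add: circle_measure_def)

lemma cis_borel_measurable [measurable]: "cis \<in> borel_measurable borel"
  by (intro borel_measurable_continuous_onI continuous_intros)

lemma prob_space_circle_measure: "prob_space circle_measure"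
  unfolding circle_measure_def
  by (intro prob_space.prob_space_distr prob_space_uniform_measure) auto

interpretation circle: prob_space circle_measure
  by (rule prob_space_circle_measure)

lemma emeasure_circle_UNIV [simp]: "emeasure circle_measure UNIV = 1"
  using circle.emeasure_space_1 by simp

lemma AE_circle_measure: "AE \<zeta> in circle_measure. norm \<zeta> = 1"
proof -
  have "AE \<zeta> in distr (uniform_measure lborel {0..<2 * pi}) borel cis. norm \<zeta> = 1"
    by (subst AE_distr_iff) auto
  then show ?thesis unfolding circle_measure_def .
qed

lemma nn_integral_circle_measure:
  assumes [measurable]: "f \<in> borel_measurable borel"
  shows "(\<integral>\<^sup>+\<zeta>. f \<zeta> \<partial>circle_measure) =
    (\<integral>\<^sup>+t. f (cis t) * indicator {0..<2 * pi} t \<partial>lborel) / ennreal (2 * pi)"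
  unfolding circle_measure_def
  by (subst nn_integral_distr) (auto simp: nn_integral_uniform_measure)

lemma integral_circle_measure:
  fixes f :: "complex \<Rightarrow> complex"
  assumes [measurable]: "f \<in> borel_measurable borel"
  shows "(\<integral>\<zeta>. f \<zeta> \<partial>circle_measure) = (\<integral>t. indicator {0..2 * pi} t *\<^sub>R f (cis t) \<partial>lborel) / (2 * pi)"
proof -
  have "uniform_measure lborel {0..<2 * pi}
      = density lborel (\<lambda>t. ennreal (indicator {0..<2 * pi} t / (2 * pi)))"
    unfolding uniform_measure_def
    by (intro density_cong) (auto split: split_indicator simp: divide_ennreal[symmetric])
  then have "(\<integral>\<zeta>. f \<zeta> \<partial>circle_measure) = (\<integral>t. (indicator {0..<2 * pi} t / (2 * pi)) *\<^sub>R f (cis t) \<partial>lborel)"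
    unfolding circle_measure_def
    by (subst integral_distr) (auto simp: integral_density)
  also have "\<dots> = (\<integral>t. (1 / (2 * pi)) *\<^sub>R (indicator {0..2 * pi} t *\<^sub>R f (cis t)) \<partial>lborel)"
  proof (rule integral_cong_AE)
    have "AE t in lborel. t \<noteq> 2 * pi"
      by (rule AE_lborel_singleton)
    then show "AE t in lborel. (indicator {0..<2 * pi} t / (2 * pi)) *\<^sub>R f (cis t) =
        (1 / (2 * pi)) *\<^sub>R (indicator {0..2 * pi} t *\<^sub>R f (cis t))"
      by eventually_elim (auto split: split_indicator)
  qed auto
  also have "\<dots> = (\<integral>t. indicator {0..2 * pi} t *\<^sub>R f (cis t) \<partial>lborel) / (2 * pi)"
    by (subst integral_scaleR_right) (simp add: scaleR_conv_of_real)
  finally show ?thesis .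
qed

lemma integral_circle_inverse_power:
  assumes "k > 0"
  shows "(\<integral>\<zeta>. inverse \<zeta> ^ k \<partial>circle_measure) = 0"
proof -
  have "((\<lambda>t::real. \<i> / k * cis (- (k * t))) has_vector_derivative inverse (cis t) ^ k) (at t within A)" for t A
  proof -
    have eq: "(\<lambda>t::real. \<i> / k * cis (- (k * t))) = (\<lambda>t. \<i> / k * exp (- (of_real k * of_real t * \<i>)))"
      by (rule ext) (simp add: cis_conv_exp mult_ac)
    have "((\<lambda>t. \<i> / k * exp (- (of_real k * t * \<i>))) has_field_derivative
        exp (- (of_real k * of_real t * \<i>))) (at (of_real t))"
      using assms by (auto intro!: derivative_eq_intros)
    then have "((\<lambda>t. \<i> / k * exp (- (of_real k * of_real t * \<i>))) has_vector_derivative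
        exp (- (of_real k * of_real t * \<i>))) (at t within A)"
      by (rule has_vector_derivative_real_field)
    moreover have "inverse (cis t) ^ k = exp (- (of_real k * of_real t * \<i>))"
      by (simp add: Complex.DeMoivre) (simp add: cis_conv_exp mult_ac)
    ultimately show ?thesis
      by (simp only: eq)
  qed
  then have "(\<integral>t. indicator {0..2 * pi} t *\<^sub>R inverse (cis t) ^ k \<partial>lborel) =
      \<i> / k * cis (- (k * (2 * pi))) - \<i> / k * cis (- (k * (0::real)))"
    by (intro integral_FTC_Icc continuous_intros) auto
  also have "cis (- (k * (2 * pi))) = 1"
    by (simp add: cis_inverse[symmetric] del: cis_inverse) (metis mult.commute cis_multiple_2pi Ints_of_nat inverse_1)
  finally show ?thesis
    by (subst integral_circle_measure) auto
qed


text \<open>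
  Concentration on the circle is an almost-everywhere statement, since the kernel estimates below hold
  for unimodular arguments only and are always used under an integral.
\<close>

definition circle_borel :: "complex measure \<Rightarrow> bool" where
  "circle_borel \<mu> \<longleftrightarrow> sets \<mu> = sets borel \<and> finite_measure \<mu> \<and> (AE \<zeta> in \<mu>. norm \<zeta> = 1)"

lemma circle_borelD:
  assumes "circle_borel \<mu>"
  shows circle_borel_sets: "sets \<mu> = sets borel" and circle_borel_space: "space \<mu> = UNIV"
    and circle_borel_finite: "finite_measure \<mu>" and circle_borel_AE: "AE \<zeta> in \<mu>. norm \<zeta> = 1"
  using assms sets_eq_imp_space_eq[of \<mu> borel] by (auto simp: circle_borel_def)

lemma circle_borel_circle_measure: "circle_borel circle_measure"
  by (simp add: circle_borel_def AE_circle_measure circle.finite_measure_axioms)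

definition herglotz_kernel :: "complex \<Rightarrow> complex \<Rightarrow> complex" where
  "herglotz_kernel z \<zeta> = (\<zeta> + z) / (\<zeta> - z)"

text \<open>
  The real part of the Herglotz kernel when \<open>\<zeta>\<close> is unimodular. Unlike that real part, this quotient is
  nonnegative for all \<open>\<zeta>\<close>.
\<close>

definition poisson_kernel :: "complex \<Rightarrow> complex \<Rightarrow> real" where
  "poisson_kernel z \<zeta> = (1 - (norm z)\<^sup>2) / (norm (\<zeta> - z))\<^sup>2"

lemma herglotz_kernel_measurable [measurable]: "herglotz_kernel z \<in> borel_measurable borel"
  unfolding herglotz_kernel_def by measurable

lemma poisson_kernel_measurable [measurable]: "poisson_kernel z \<in> borel_measurable borel"
  unfolding poisson_kernel_def by measurable

lemma poisson_kernel_pair_measurable [measurable]: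
  "(\<lambda>x. poisson_kernel (of_real r * fst x) (snd x)) \<in> borel_measurable (borel \<Otimes>\<^sub>M borel)"
  unfolding poisson_kernel_def by measurable

lemma norm_diff_circle_ge:
  assumes "norm \<zeta> = 1"
  shows "1 - norm z \<le> norm (\<zeta> - (z::complex))"
  using norm_triangle_ineq2[of \<zeta> z] assms by simp

lemma norm_diff_circle_pos:
  assumes "norm \<zeta> = 1" "norm z < 1"
  shows "0 < norm (\<zeta> - (z::complex))"
  by (rule less_le_trans[OF _ norm_diff_circle_ge[OF assms(1)]]) (use assms(2) in simp)

lemma norm_radial_diff:
  assumes "norm (\<zeta>::complex) = 1" "r \<le> 1"
  shows "norm (of_real r * \<zeta> - \<zeta>) = 1 - r"
proof -
  have "of_real r * \<zeta> - \<zeta> = of_real (r - 1) * \<zeta>" by (simp add: algebra_simps)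
  then show ?thesis using assms by (simp add: norm_mult del: of_real_diff)
qed

lemma Re_herglotz_kernel:
  assumes "norm \<zeta> = 1"
  shows "Re (herglotz_kernel z \<zeta>) = poisson_kernel z \<zeta>"
proof -
  have "Re ((\<zeta> + z) * cnj (\<zeta> - z)) = (norm \<zeta>)\<^sup>2 - (norm z)\<^sup>2"
    unfolding cmod_power2 by (simp add: algebra_simps power2_eq_square)
  then show ?thesis
    using assms unfolding herglotz_kernel_def poisson_kernel_def
    by (subst complex_div_cnj) (simp flip: of_real_power add: Re_divide_of_real)
qed

lemma poisson_kernel_nonneg: "norm z < 1 \<Longrightarrow> 0 \<le> poisson_kernel z \<zeta>"
  unfolding poisson_kernel_def by (simp add: power_le_one)

lemma norm_herglotz_kernel_le:
  assumes "norm \<zeta> = 1" "norm z < 1"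
  shows "norm (herglotz_kernel z \<zeta>) \<le> 2 / (1 - norm z)"
proof -
  have "norm (\<zeta> + z) \<le> 2" using norm_triangle_ineq[of \<zeta> z] assms by simp
  then show ?thesis
    unfolding herglotz_kernel_def norm_divide
    using norm_diff_circle_ge[OF assms(1), of z] assms
    by (intro frac_le) auto
qed

lemma poisson_kernel_le:
  assumes "norm \<zeta> = 1" "norm z < 1"
  shows "poisson_kernel z \<zeta> \<le> 2 / (1 - norm z)"
  using norm_herglotz_kernel_le[OF assms] complex_Re_le_cmod[of "herglotz_kernel z \<zeta>"]
  by (simp add: Re_herglotz_kernel assms)

lemma poisson_kernel_ge:
  assumes "norm \<zeta> = 1" "norm z < 1"
  shows "(1 - norm z) / 4 \<le> poisson_kernel z \<zeta>"
proof -
  have 1: "norm (\<zeta> - z) \<le> 2" using norm_triangle_ineq4[of \<zeta> z] assms by simp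
  have 2: "norm (\<zeta> - z) > 0" by (rule norm_diff_circle_pos[OF assms])
  have "(norm (\<zeta> - z))\<^sup>2 \<le> 2\<^sup>2" using 1 by (intro power_mono) auto
  moreover have "(norm z)\<^sup>2 \<le> norm z" using assms by (simp add: power2_eq_square mult_left_le)
  ultimately show ?thesis
    unfolding poisson_kernel_def using assms 2 by (intro frac_le) auto
qed

lemma herglotz_kernel_diff:
  assumes "norm \<zeta> = 1" "norm z < 1" "norm w < 1"
  shows "herglotz_kernel z \<zeta> - herglotz_kernel w \<zeta> = 2 * \<zeta> * (z - w) / ((\<zeta> - z) * (\<zeta> - w))"
proof -
  have "\<zeta> - z \<noteq> 0" "\<zeta> - w \<noteq> 0" using assms by auto
  then show ?thesis unfolding herglotz_kernel_def by (simp add: field_simps)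
qed

text \<open>
  Consequently the kernel varies by at most a constant, uniformly in \<open>\<zeta>\<close>, on a disk about \<open>z\<close> whose radius is a small
  multiple of \<open>(1 - |z|)\<^sup>2\<close>. No such bound holds on disks of radius comparable to \<open>1 - |z|\<close>.
\<close>

lemma poisson_kernel_diff_le:
  assumes "norm \<zeta> = 1" "norm z < 1" "norm w < 1"
  shows "\<bar>poisson_kernel z \<zeta> - poisson_kernel w \<zeta>\<bar> \<le> 2 * norm (z - w) / ((1 - norm z) * (1 - norm w))"
proof -
  have "\<bar>poisson_kernel z \<zeta> - poisson_kernel w \<zeta>\<bar> = \<bar>Re (herglotz_kernel z \<zeta> - herglotz_kernel w \<zeta>)\<bar>"
    by (simp add: Re_herglotz_kernel assms)
  also have "\<dots> \<le> norm (herglotz_kernel z \<zeta> - herglotz_kernel w \<zeta>)"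
    by (rule abs_Re_le_cmod)
  also have "\<dots> = 2 * norm (z - w) / (norm (\<zeta> - z) * norm (\<zeta> - w))"
    by (simp add: herglotz_kernel_diff assms norm_mult norm_divide)
  also have "\<dots> \<le> 2 * norm (z - w) / ((1 - norm z) * (1 - norm w))"
    using assms norm_diff_circle_ge[OF assms(1)] norm_diff_circle_pos[OF assms(1)]
    by (intro divide_left_mono mult_mono mult_pos_pos) auto
  finally show ?thesis .
qed

text \<open>
  Fubini's theorem moves a Poisson kernel from one measure to another; this symmetry lets the dilation
  follow the variable of integration.
\<close>

lemma poisson_kernel_commute:
  assumes "norm \<zeta> = 1" "norm \<xi> = 1"
  shows "poisson_kernel (of_real r * \<zeta>) \<xi> = poisson_kernel (of_real r * \<xi>) \<zeta>"
proof -
  have "norm (\<xi> - of_real r * \<zeta>) = norm (\<zeta> - of_real r * \<xi>)"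
  proof -
    have "(norm (\<xi> - of_real r * \<zeta>))\<^sup>2 = (norm \<xi>)\<^sup>2 + r\<^sup>2 * (norm \<zeta>)\<^sup>2 - 2 * r * Re (\<xi> * cnj \<zeta>)"
      unfolding cmod_power2 by (simp add: algebra_simps power2_eq_square)
    moreover have "(norm (\<zeta> - of_real r * \<xi>))\<^sup>2 = (norm \<zeta>)\<^sup>2 + r\<^sup>2 * (norm \<xi>)\<^sup>2 - 2 * r * Re (\<xi> * cnj \<zeta>)"
      unfolding cmod_power2 by (simp add: algebra_simps power2_eq_square)
    ultimately have "(norm (\<xi> - of_real r * \<zeta>))\<^sup>2 = (norm (\<zeta> - of_real r * \<xi>))\<^sup>2"
      using assms by simp
    then show ?thesis by simp
  qed
  then show ?thesis using assms by (simp add: poisson_kernel_def norm_mult)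
qed

lemma integrable_herglotz:
  fixes w :: "complex \<Rightarrow> complex"
  assumes "circle_borel \<mu>" "integrable \<mu> w" "norm z < 1"
  shows "integrable \<mu> (\<lambda>\<zeta>. herglotz_kernel z \<zeta> * w \<zeta>)"
proof (rule Bochner_Integration.integrable_bound)
  note [measurable_cong] = circle_borel_sets[OF assms(1)]
  show "integrable \<mu> (\<lambda>\<zeta>. 2 / (1 - norm z) * norm (w \<zeta>))"
    using assms by (intro integrable_mult_right integrable_norm)
  show "(\<lambda>\<zeta>. herglotz_kernel z \<zeta> * w \<zeta>) \<in> borel_measurable \<mu>"
    using borel_measurable_integrable[OF assms(2)] by measurable
  show "AE \<zeta> in \<mu>. norm (herglotz_kernel z \<zeta> * w \<zeta>) \<le> norm (2 / (1 - norm z) * norm (w \<zeta>))"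
    using circle_borel_AE[OF assms(1)]
  proof eventually_elim
    case (elim \<zeta>)
    then have "norm (herglotz_kernel z \<zeta>) * norm (w \<zeta>) \<le> 2 / (1 - norm z) * norm (w \<zeta>)"
      using assms(3) by (intro mult_right_mono norm_herglotz_kernel_le) auto
    then show ?case by (simp add: norm_mult del: times_divide_eq_left)
  qed
qed

lemma integrable_poisson:
  fixes w :: "complex \<Rightarrow> real"
  assumes "circle_borel \<mu>" "integrable \<mu> w" "norm z < 1"
  shows "integrable \<mu> (\<lambda>\<zeta>. poisson_kernel z \<zeta> * w \<zeta>)"
proof (rule Bochner_Integration.integrable_bound)
  note [measurable_cong] = circle_borel_sets[OF assms(1)]
  show "integrable \<mu> (\<lambda>\<zeta>. 2 / (1 - norm z) * norm (w \<zeta>))"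
    using assms by (intro integrable_mult_right integrable_norm)
  show "(\<lambda>\<zeta>. poisson_kernel z \<zeta> * w \<zeta>) \<in> borel_measurable \<mu>"
    using borel_measurable_integrable[OF assms(2)] by measurable
  show "AE \<zeta> in \<mu>. norm (poisson_kernel z \<zeta> * w \<zeta>) \<le> norm (2 / (1 - norm z) * norm (w \<zeta>))"
    using circle_borel_AE[OF assms(1)]
  proof eventually_elim
    case (elim \<zeta>)
    then have "poisson_kernel z \<zeta> * \<bar>w \<zeta>\<bar> \<le> 2 / (1 - norm z) * \<bar>w \<zeta>\<bar>"
      using assms(3) by (intro mult_right_mono poisson_kernel_le) auto
    then show ?case using poisson_kernel_nonneg[OF assms(3)] assms(3)
      by (simp add: abs_mult del: times_divide_eq_left)
  qed
qed

definition poisson_integral :: "complex measure \<Rightarrow> (complex \<Rightarrow> real) \<Rightarrow> complex \<Rightarrow> real" where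
  "poisson_integral \<mu> w z = (\<integral>\<zeta>. poisson_kernel z \<zeta> * w \<zeta> \<partial>\<mu>)"

definition herglotz_integral :: "complex measure \<Rightarrow> (complex \<Rightarrow> real) \<Rightarrow> complex \<Rightarrow> complex" where
  "herglotz_integral \<mu> w z = (\<integral>\<zeta>. herglotz_kernel z \<zeta> * of_real (w \<zeta>) \<partial>\<mu>)"

lemma Re_herglotz_integral:
  assumes "circle_borel \<mu>" "integrable \<mu> w" "norm z < 1"
  shows "Re (herglotz_integral \<mu> w z) = poisson_integral \<mu> w z"
proof -
  note [measurable_cong] = circle_borel_sets[OF assms(1)]
  have [measurable]: "w \<in> borel_measurable \<mu>" using assms(2) by auto
  have "Re (herglotz_integral \<mu> w z) = (\<integral>\<zeta>. Re (herglotz_kernel z \<zeta> * of_real (w \<zeta>)) \<partial>\<mu>)"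
    unfolding herglotz_integral_def using assms
    by (intro integral_Re[symmetric] integrable_herglotz) (auto intro: integrable_of_real)
  also have "\<dots> = poisson_integral \<mu> w z"
    unfolding poisson_integral_def
  proof (rule integral_cong_AE)
    show "AE \<zeta> in \<mu>. Re (herglotz_kernel z \<zeta> * of_real (w \<zeta>)) = poisson_kernel z \<zeta> * w \<zeta>"
      using circle_borel_AE[OF assms(1)] by eventually_elim (simp add: Re_herglotz_kernel)
  qed auto
  finally show ?thesis .
qed

text \<open>
  The difference quotient of the kernel differs from its derivative by \<open>O(|y - z|)\<close>, uniformly on the
  circle, so differentiation under the integral needs no limit theorem.
\<close>

lemma herglotz_integral_holomorphic:
  assumes "circle_borel \<mu>" "integrable \<mu> w"
  shows "herglotz_integral \<mu> w holomorphic_on ball 0 1"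
proof -
  note [measurable_cong] = circle_borel_sets[OF assms(1)]
  have [measurable]: "w \<in> borel_measurable \<mu>" using assms(2) by auto
  have "\<exists>D. (herglotz_integral \<mu> w has_field_derivative D) (at z)" if z: "z \<in> ball 0 1" for z
  proof -
    define \<delta> where "\<delta> = 1 - norm z"
    have \<delta>: "\<delta> > 0" using z by (simp add: \<delta>_def)
    define D where "D = (\<integral>\<zeta>. 2 * \<zeta> / (\<zeta> - z)\<^sup>2 * of_real (w \<zeta>) \<partial>\<mu>)"
    define C where "C = 4 / \<delta> ^ 3 * (\<integral>\<zeta>. \<bar>w \<zeta>\<bar> \<partial>\<mu>)"
    have intD: "integrable \<mu> (\<lambda>\<zeta>. 2 * \<zeta> / (\<zeta> - z)\<^sup>2 * of_real (w \<zeta>))"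
    proof (rule Bochner_Integration.integrable_bound)
      show "integrable \<mu> (\<lambda>\<zeta>. 2 / \<delta>\<^sup>2 * \<bar>w \<zeta>\<bar>)" using assms by auto
      show "AE \<zeta> in \<mu>. norm (2 * \<zeta> / (\<zeta> - z)\<^sup>2 * of_real (w \<zeta>)) \<le> norm (2 / \<delta>\<^sup>2 * \<bar>w \<zeta>\<bar>)"
        using circle_borel_AE[OF assms(1)]
      proof eventually_elim
        case (elim \<zeta>)
        have "2 / (norm (\<zeta> - z))\<^sup>2 \<le> 2 / \<delta>\<^sup>2"
          using norm_diff_circle_ge[OF elim, of z] \<delta> unfolding \<delta>_def
          by (intro divide_left_mono power_mono mult_pos_pos zero_less_power) auto
        from mult_right_mono[OF this, of "\<bar>w \<zeta>\<bar>"] show ?case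
          using elim \<delta> by (simp add: norm_mult norm_divide norm_power abs_mult)
      qed
    qed measurable
    have bound: "norm ((herglotz_integral \<mu> w y - herglotz_integral \<mu> w z) / (y - z) - D) \<le> C * norm (y - z)"
      if y: "norm (y - z) < \<delta> / 2" "y \<noteq> z" for y
    proof -
      have y1: "norm y \<le> 1 - \<delta> / 2"
        using norm_triangle_ineq2[of y z] y(1) unfolding \<delta>_def by argo
      then have y1': "norm y < 1" using \<delta> by simp
      have z1: "norm z < 1" using z by simp
      have iy: "integrable \<mu> (\<lambda>\<zeta>. herglotz_kernel x \<zeta> * of_real (w \<zeta>))" if "norm x < 1" for x
        using assms that by (intro integrable_herglotz integrable_of_real) auto
      have "(herglotz_integral \<mu> w y - herglotz_integral \<mu> w z) / (y - z) - D =
          (\<integral>\<zeta>. (herglotz_kernel y \<zeta> * of_real (w \<zeta>) - herglotz_kernel z \<zeta> * of_real (w \<zeta>)) / (y - z)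
              - 2 * \<zeta> / (\<zeta> - z)\<^sup>2 * of_real (w \<zeta>) \<partial>\<mu>)"
        unfolding herglotz_integral_def D_def using iy[OF y1'] iy[OF z1] intD
        by simp
      also have "norm \<dots> \<le> (\<integral>\<zeta>. 4 * norm (y - z) / \<delta> ^ 3 * \<bar>w \<zeta>\<bar> \<partial>\<mu>)"
      proof (rule integral_norm_bound_integral_AE)
        show "integrable \<mu> (\<lambda>\<zeta>. 4 * norm (y - z) / \<delta> ^ 3 * \<bar>w \<zeta>\<bar>)" using assms by auto
        show "integrable \<mu> (\<lambda>\<zeta>. (herglotz_kernel y \<zeta> * of_real (w \<zeta>) - herglotz_kernel z \<zeta> * of_real (w \<zeta>)) / (y - z)
              - 2 * \<zeta> / (\<zeta> - z)\<^sup>2 * of_real (w \<zeta>))"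
          using iy[OF y1'] iy[OF z1] intD by simp
        show "AE \<zeta> in \<mu>. norm ((herglotz_kernel y \<zeta> * of_real (w \<zeta>) - herglotz_kernel z \<zeta> * of_real (w \<zeta>)) / (y - z)
              - 2 * \<zeta> / (\<zeta> - z)\<^sup>2 * of_real (w \<zeta>)) \<le> 4 * norm (y - z) / \<delta> ^ 3 * \<bar>w \<zeta>\<bar>"
          using circle_borel_AE[OF assms(1)]
        proof eventually_elim
          case (elim \<zeta>)
          have nz: "\<zeta> - y \<noteq> 0" "\<zeta> - z \<noteq> 0" "y - z \<noteq> 0" using elim y1' z1 y by auto
          have "(herglotz_kernel y \<zeta> - herglotz_kernel z \<zeta>) / (y - z) - 2 * \<zeta> / (\<zeta> - z)\<^sup>2
              = 2 * \<zeta> / ((\<zeta> - y) * (\<zeta> - z)) - 2 * \<zeta> / (\<zeta> - z)\<^sup>2"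
            using nz by (simp add: herglotz_kernel_diff elim y1' z1)
          also have "\<dots> = 2 * \<zeta> * (y - z) / ((\<zeta> - y) * (\<zeta> - z)\<^sup>2)"
            using nz by (simp add: divide_simps power2_eq_square) (simp add: algebra_simps)
          also have "norm \<dots> = 2 * norm (y - z) / (norm (\<zeta> - y) * norm (\<zeta> - z) ^ 2)"
            by (simp add: norm_mult norm_divide norm_power elim)
          also have "\<dots> \<le> 2 * norm (y - z) / ((\<delta> / 2) * \<delta> ^ 2)"
            using norm_diff_circle_ge[OF elim, of z] norm_diff_circle_ge[OF elim, of y] \<delta> y1 nz
            unfolding \<delta>_def[symmetric]
            by (intro divide_left_mono mult_mono power_mono mult_pos_pos zero_less_power) auto
          also have "\<dots> = 4 * norm (y - z) / \<delta> ^ 3"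
            by (simp add: power2_eq_square power3_eq_cube)
          finally have *: "norm ((herglotz_kernel y \<zeta> - herglotz_kernel z \<zeta>) / (y - z) - 2 * \<zeta> / (\<zeta> - z)\<^sup>2)
              \<le> 4 * norm (y - z) / \<delta> ^ 3" .
          have "(herglotz_kernel y \<zeta> * of_real (w \<zeta>) - herglotz_kernel z \<zeta> * of_real (w \<zeta>)) / (y - z)
              - 2 * \<zeta> / (\<zeta> - z)\<^sup>2 * of_real (w \<zeta>)
              = ((herglotz_kernel y \<zeta> - herglotz_kernel z \<zeta>) / (y - z) - 2 * \<zeta> / (\<zeta> - z)\<^sup>2) * of_real (w \<zeta>)"
            by (simp add: algebra_simps diff_divide_distrib)
          then show ?case
            using mult_right_mono[OF *, of "\<bar>w \<zeta>\<bar>"] by (simp add: norm_mult)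
        qed
      qed
      also have "\<dots> = C * norm (y - z)" by (simp add: C_def)
      finally show ?thesis .
    qed
    have "((\<lambda>y. (herglotz_integral \<mu> w y - herglotz_integral \<mu> w z) / (y - z) - D) \<longlongrightarrow> 0) (at z)"
    proof (rule Lim_null_comparison)
      show "\<forall>\<^sub>F y in at z. norm ((herglotz_integral \<mu> w y - herglotz_integral \<mu> w z) / (y - z) - D) \<le> C * norm (y - z)"
        unfolding eventually_at using bound \<delta> by (intro exI[of _ "\<delta> / 2"]) (auto simp: dist_norm)
      have "((\<lambda>y. C * norm (y - z)) \<longlongrightarrow> C * norm (z - z)) (at z)"
        by (intro tendsto_intros)
      then show "((\<lambda>y. C * norm (y - z)) \<longlongrightarrow> 0) (at z)" by simp
    qed
    then have "(herglotz_integral \<mu> w has_field_derivative D) (at z)"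
      unfolding has_field_derivative_iff using LIM_zero_iff by blast
    then show ?thesis by blast
  qed
  then show ?thesis
    by (simp add: holomorphic_on_open)
qed

section \<open>Poisson integrals of continuous functions\<close>

lemma measure_circle_UNIV [simp]: "measure circle_measure UNIV = 1"
  using circle.prob_space by simp

lemma integrable_circle_continuous:
  fixes \<phi> :: "complex \<Rightarrow> real"
  assumes [measurable]: "\<phi> \<in> borel_measurable borel" and "continuous_on (sphere 0 1) \<phi>"
  shows "integrable circle_measure \<phi>"
proof -
  have "compact (\<phi> ` sphere 0 1)"
    using assms(2) by (intro compact_continuous_image) auto
  then obtain A where A: "\<And>\<zeta>. \<zeta> \<in> sphere 0 1 \<Longrightarrow> norm (\<phi> \<zeta>) \<le> A"
    using compact_imp_bounded bounded_iff by (metis image_eqI)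
  show ?thesis
  proof (rule circle.integrable_const_bound)
    show "AE \<zeta> in circle_measure. norm (\<phi> \<zeta>) \<le> A"
      using AE_circle_measure by eventually_elim (use A in simp)
  qed simp
qed

text \<open>
  In the expansion of the kernel in powers of \<open>z / \<zeta>\<close> only the constant term survives integration; the
  remainder after \<open>N\<close> terms is \<open>O(|z|\<^sup>N)\<close>.
\<close>

lemma integral_herglotz_circle:
  assumes z: "norm z < 1"
  shows "(\<integral>\<zeta>. herglotz_kernel z \<zeta> \<partial>circle_measure) = 1"
proof -
  define R where "R N \<zeta> = 2 * (z * inverse \<zeta>) ^ N / (1 - z * inverse \<zeta>)" for N :: nat and \<zeta>
  have intp: "integrable circle_measure (\<lambda>\<zeta>. inverse \<zeta> ^ k)" for k
    by (rule circle.integrable_const_bound[where B = 1], use AE_circle_measure in eventually_elim)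
      (auto simp: norm_power norm_inverse)
  have Rle: "norm (R N \<zeta>) \<le> 2 * norm z ^ N / (1 - norm z)" if "norm \<zeta> = 1" for N \<zeta>
  proof -
    have "norm (1 - z * inverse \<zeta>) \<ge> 1 - norm z"
      using norm_triangle_ineq2[of 1 "z * inverse \<zeta>"] that by (simp add: norm_mult norm_inverse)
    then show ?thesis
      using z that unfolding R_def
      by (auto simp: norm_mult norm_divide norm_power norm_inverse intro!: divide_left_mono mult_pos_pos)
  qed
  have [measurable]: "R N \<in> borel_measurable borel" for N
    unfolding R_def by measurable
  have intR: "integrable circle_measure (R N)" for N
    by (rule circle.integrable_const_bound[where B = "2 * norm z ^ N / (1 - norm z)"],
        use AE_circle_measure in eventually_elim)
      (use Rle in auto)
  have eq: "(\<integral>\<zeta>. herglotz_kernel z \<zeta> \<partial>circle_measure) - 1 = (\<integral>\<zeta>. R N \<zeta> \<partial>circle_measure)"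
    if "N > 0" for N
  proof -
    have "(\<integral>\<zeta>. herglotz_kernel z \<zeta> \<partial>circle_measure) =
        (\<integral>\<zeta>. (2 * (\<Sum>k<N. z ^ k * inverse \<zeta> ^ k) - 1) + R N \<zeta> \<partial>circle_measure)"
    proof (rule integral_cong_AE)
      show "AE \<zeta> in circle_measure. herglotz_kernel z \<zeta> =
          (2 * (\<Sum>k<N. z ^ k * inverse \<zeta> ^ k) - 1) + R N \<zeta>"
        using AE_circle_measure
      proof eventually_elim
        case (elim \<zeta>)
        define x where "x = z * inverse \<zeta>"
        have nz: "\<zeta> \<noteq> 0" "\<zeta> \<noteq> z" using elim z by auto
        then have x1: "x \<noteq> 1" by (auto simp: x_def field_simps)
        have "(\<Sum>k<N. z ^ k * inverse \<zeta> ^ k) = (1 - x ^ N) / (1 - x)"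
          using x1 sum_gp_strict[of x N] by (simp add: x_def power_mult_distrib)
        moreover have "herglotz_kernel z \<zeta> = 2 / (1 - x) - 1"
          using nz x1 by (simp add: herglotz_kernel_def x_def field_simps)
        ultimately show ?case
          unfolding R_def x_def[symmetric] by (simp add: diff_divide_distrib right_diff_distrib)
      qed
    qed (auto simp: R_def)
    also have "\<dots> = 2 * (\<Sum>k<N. z ^ k * (\<integral>\<zeta>. inverse \<zeta> ^ k \<partial>circle_measure)) - 1
        + (\<integral>\<zeta>. R N \<zeta> \<partial>circle_measure)"
      using intp intR by (simp add: circle.prob_space)
    also have "(\<Sum>k<N. z ^ k * (\<integral>\<zeta>. inverse \<zeta> ^ k \<partial>circle_measure)) = (\<Sum>k<N. if k = 0 then 1 else 0)"
      by (intro sum.cong) (auto simp: integral_circle_inverse_power circle.prob_space simp del: power_inverse)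
    also have "\<dots> = 1" using that by (simp add: sum.delta)
    finally show ?thesis by simp
  qed
  have "norm ((\<integral>\<zeta>. herglotz_kernel z \<zeta> \<partial>circle_measure) - 1) \<le> 2 * norm z ^ N / (1 - norm z)"
    if "N > 0" for N
  proof -
    have "norm (\<integral>\<zeta>. R N \<zeta> \<partial>circle_measure) \<le> (\<integral>\<zeta>. 2 * norm z ^ N / (1 - norm z) \<partial>circle_measure)"
      by (rule integral_norm_bound_integral_AE[OF intR], simp, use AE_circle_measure in eventually_elim)
        (use Rle in auto)
    then show ?thesis by (simp add: eq[OF that] circle.prob_space)
  qed
  then have "\<forall>\<^sub>F N in sequentially. norm ((\<integral>\<zeta>. herglotz_kernel z \<zeta> \<partial>circle_measure) - 1)
      \<le> 2 * norm z ^ N / (1 - norm z)"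
    by (intro eventually_sequentiallyI[of 1]) auto
  moreover have "(\<lambda>N. 2 * norm z ^ N / (1 - norm z)) \<longlonglongrightarrow> 2 * 0 / (1 - norm z)"
    using z by (intro tendsto_intros LIMSEQ_realpow_zero) auto
  ultimately have "norm ((\<integral>\<zeta>. herglotz_kernel z \<zeta> \<partial>circle_measure) - 1) \<le> 0"
    by (intro tendsto_lowerbound) auto
  then show ?thesis by simp
qed

lemma integral_poisson_circle:
  assumes z: "norm z < 1"
  shows "(\<integral>\<zeta>. poisson_kernel z \<zeta> \<partial>circle_measure) = 1"
proof -
  have "poisson_integral circle_measure (\<lambda>_. 1) z = Re (herglotz_integral circle_measure (\<lambda>_. 1) z)"
    by (intro Re_herglotz_integral[symmetric] circle_borel_circle_measure z) auto
  also have "\<dots> = 1" by (simp add: herglotz_integral_def integral_herglotz_circle z)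
  finally show ?thesis by (simp add: poisson_integral_def)
qed

lemma nn_integral_poisson_circle:
  assumes z: "norm z < 1"
  shows "(\<integral>\<^sup>+\<zeta>. ennreal (poisson_kernel z \<zeta>) \<partial>circle_measure) = 1"
  using integrable_poisson[OF circle_borel_circle_measure, of "\<lambda>_. 1"] z
  by (subst nn_integral_eq_integral) (auto simp: poisson_kernel_nonneg integral_poisson_circle)

text \<open>
  The kernels form an approximate identity: near \<open>\<xi>\<close> the oscillation of \<open>\<phi>\<close> is small, and at distance
  \<open>\<delta>\<close> from \<open>\<xi>\<close> the kernel is \<open>O((1 - r) / \<delta>\<^sup>2)\<close>.
\<close>

lemma poisson_integral_uniform_limit:
  fixes \<phi> :: "complex \<Rightarrow> real"
  assumes \<phi>: "\<phi> \<in> borel_measurable borel" "continuous_on (sphere 0 1) \<phi>" and \<epsilon>: "\<epsilon> > 0"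
  obtains r\<^sub>0 where "0 \<le> r\<^sub>0" "r\<^sub>0 < 1"
    "\<And>r \<xi>. r\<^sub>0 \<le> r \<Longrightarrow> r < 1 \<Longrightarrow> norm \<xi> = 1 \<Longrightarrow>
       \<bar>poisson_integral circle_measure \<phi> (of_real r * \<xi>) - \<phi> \<xi>\<bar> < \<epsilon>"
proof -
  note [measurable] = \<phi>(1)
  have "compact (\<phi> ` sphere 0 1)"
    using \<phi>(2) by (intro compact_continuous_image) auto
  then have "bounded (\<phi> ` sphere 0 1)" by (rule compact_imp_bounded)
  then obtain A where A: "A > 0" "\<And>\<zeta>. \<zeta> \<in> sphere 0 1 \<Longrightarrow> \<bar>\<phi> \<zeta>\<bar> \<le> A"
    unfolding bounded_pos by auto
  have "uniformly_continuous_on (sphere 0 1) \<phi>"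
    using \<phi>(2) by (intro compact_uniformly_continuous) auto
  then obtain \<delta> where \<delta>: "\<delta> > 0"
    "\<And>\<zeta> \<xi>. norm \<zeta> = 1 \<Longrightarrow> norm \<xi> = 1 \<Longrightarrow> norm (\<zeta> - \<xi>) < \<delta> \<Longrightarrow> \<bar>\<phi> \<zeta> - \<phi> \<xi>\<bar> < \<epsilon> / 3"
    using \<epsilon> unfolding uniformly_continuous_on_def
    by (metis dist_norm dist_real_def divide_pos_pos mem_sphere_0 zero_less_numeral)
  \<comment> \<open>Close enough that \<open>16 A \<eta> / \<delta>\<^sup>2 \<le> \<epsilon> / 3\<close>, and that \<open>r \<xi>\<close> stays at distance \<open>\<delta> / 2\<close> from points far from \<open>\<xi>\<close>.\<close>
  define \<eta> where "\<eta> = Min {1, \<delta> / 2, \<delta>\<^sup>2 * \<epsilon> / (48 * A)}"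
  have \<eta>: "\<eta> > 0" "\<eta> \<le> 1" "\<eta> \<le> \<delta> / 2" "\<eta> \<le> \<delta>\<^sup>2 * \<epsilon> / (48 * A)"
    using A(1) \<delta>(1) \<epsilon> by (auto simp: \<eta>_def)
  show ?thesis
  proof
    show "0 \<le> 1 - \<eta>" "1 - \<eta> < 1" using \<eta> by auto
    fix r :: real and \<xi> :: complex
    assume r: "1 - \<eta> \<le> r" "r < 1" and \<xi>: "norm \<xi> = 1"
    have r0: "0 \<le> r" using r \<eta> by simp
    define z where "z = of_real r * \<xi>"
    have z: "norm z = r" "norm z < 1" using r r0 \<xi> by (auto simp: z_def norm_mult)
    have z\<xi>: "norm (z - \<xi>) \<le> \<eta>"
      using norm_radial_diff[OF \<xi>, of r] r by (simp add: z_def)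
    have int\<phi>: "integrable circle_measure \<phi>" by (rule integrable_circle_continuous[OF \<phi>])
    have int1: "integrable circle_measure (\<lambda>\<zeta>. poisson_kernel z \<zeta> * \<phi> \<zeta>)"
      by (rule integrable_poisson[OF circle_borel_circle_measure int\<phi> z(2)])
    have int0: "integrable circle_measure (\<lambda>\<zeta>. poisson_kernel z \<zeta>)"
      using integrable_poisson[OF circle_borel_circle_measure _ z(2), of "\<lambda>_. 1"] by simp
    have "poisson_integral circle_measure \<phi> z - \<phi> \<xi>
        = (\<integral>\<zeta>. poisson_kernel z \<zeta> * \<phi> \<zeta> - poisson_kernel z \<zeta> * \<phi> \<xi> \<partial>circle_measure)"
      using int1 int0 by (simp add: poisson_integral_def integral_poisson_circle[OF z(2)])
    also have "norm \<dots> \<le> (\<integral>\<zeta>. poisson_kernel z \<zeta> * (\<epsilon> / 3) + 16 * A * \<eta> / \<delta>\<^sup>2 \<partial>circle_measure)"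
    proof (rule integral_norm_bound_integral_AE)
      show "AE \<zeta> in circle_measure. norm (poisson_kernel z \<zeta> * \<phi> \<zeta> - poisson_kernel z \<zeta> * \<phi> \<xi>)
          \<le> poisson_kernel z \<zeta> * (\<epsilon> / 3) + 16 * A * \<eta> / \<delta>\<^sup>2"
        using AE_circle_measure
      proof eventually_elim
        case (elim \<zeta>)
        have P0: "0 \<le> poisson_kernel z \<zeta>" using z by (intro poisson_kernel_nonneg)
        have "poisson_kernel z \<zeta> * \<bar>\<phi> \<zeta> - \<phi> \<xi>\<bar> \<le> poisson_kernel z \<zeta> * (\<epsilon> / 3) + 16 * A * \<eta> / \<delta>\<^sup>2"
        proof (cases "norm (\<zeta> - \<xi>) < \<delta>")
          case True
          then have "poisson_kernel z \<zeta> * \<bar>\<phi> \<zeta> - \<phi> \<xi>\<bar> \<le> poisson_kernel z \<zeta> * (\<epsilon> / 3)"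
            using \<delta>(2)[OF elim \<xi>] P0 by (intro mult_left_mono) auto
          moreover have "0 \<le> 16 * A * \<eta> / \<delta>\<^sup>2" using A \<eta> by simp
          ultimately show ?thesis by linarith
        next
          case False
          have "norm (\<zeta> - z) \<ge> \<delta> / 2"
            using norm_triangle_ineq[of "\<zeta> - z" "z - \<xi>"] False z\<xi> \<eta> by simp
          moreover have "1 - (norm z)\<^sup>2 \<le> 2 * \<eta>"
          proof -
            have "1 - r\<^sup>2 = (1 - r) * (1 + r)" by (simp add: power2_eq_square algebra_simps)
            also have "\<dots> \<le> \<eta> * 2" using r r0 \<eta> by (intro mult_mono) auto
            finally show ?thesis by (simp add: z)
          qed
          ultimately have "poisson_kernel z \<zeta> \<le> 2 * \<eta> / (\<delta> / 2)\<^sup>2"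
            unfolding poisson_kernel_def using \<delta> \<eta> by (intro frac_le power_mono) auto
          also have "\<dots> = 8 * \<eta> / \<delta>\<^sup>2" by (simp add: power2_eq_square)
          finally have "poisson_kernel z \<zeta> \<le> 8 * \<eta> / \<delta>\<^sup>2" .
          moreover have "\<bar>\<phi> \<zeta> - \<phi> \<xi>\<bar> \<le> 2 * A"
            using A(2)[of \<zeta>] A(2)[of \<xi>] elim \<xi> by simp
          ultimately have "poisson_kernel z \<zeta> * \<bar>\<phi> \<zeta> - \<phi> \<xi>\<bar> \<le> 8 * \<eta> / \<delta>\<^sup>2 * (2 * A)"
            using \<eta> by (intro mult_mono) auto
          moreover have "0 \<le> poisson_kernel z \<zeta> * (\<epsilon> / 3)" using P0 \<epsilon> by simp
          ultimately show ?thesis by (simp add: mult_ac)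
        qed
        moreover have "norm (poisson_kernel z \<zeta> * \<phi> \<zeta> - poisson_kernel z \<zeta> * \<phi> \<xi>)
            = poisson_kernel z \<zeta> * \<bar>\<phi> \<zeta> - \<phi> \<xi>\<bar>"
          using P0 by (simp add: abs_mult flip: right_diff_distrib)
        ultimately show ?case by simp
      qed
    qed (use int0 int1 in auto)
    also have "\<dots> = \<epsilon> / 3 + 16 * A * \<eta> / \<delta>\<^sup>2"
      using int0 by (simp add: integral_poisson_circle[OF z(2)] circle.prob_space)
    also have "16 * A * \<eta> / \<delta>\<^sup>2 \<le> 16 * A * (\<delta>\<^sup>2 * \<epsilon> / (48 * A)) / \<delta>\<^sup>2"
      using A \<eta> by (intro divide_right_mono mult_left_mono) auto
    also have "\<dots> = \<epsilon> / 3" using A \<delta>(1) by simp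
    finally show "\<bar>poisson_integral circle_measure \<phi> (of_real r * \<xi>) - \<phi> \<xi>\<bar> < \<epsilon>"
      using \<epsilon> by (simp add: z_def)
  qed
qed

text \<open>
  The quotient of \<open>U\<close> by the exponential of the Herglotz integral of \<open>\<phi>\<close> is bounded by nearly \<open>1\<close> on circles close
  to the unit circle, so the maximum principle applies. With \<open>\<phi> = ln (max |U| \<delta>)\<close> this is Jensen's
  inequality; with \<open>U = exp G\<close> or \<open>U = exp (- G)\<close> it gives the two
  halves of the Poisson formula for \<open>Re G\<close>.
\<close>

lemma norm_le_exp_poisson_integral:
  fixes U :: "complex \<Rightarrow> complex" and \<phi> :: "complex \<Rightarrow> real"
  assumes U: "continuous_on (cball 0 1) U" "U holomorphic_on ball 0 1"
    and \<phi>: "\<phi> \<in> borel_measurable borel" "continuous_on (sphere 0 1) \<phi>"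
    and le: "\<And>\<zeta>. norm \<zeta> = 1 \<Longrightarrow> norm (U \<zeta>) \<le> exp (\<phi> \<zeta>)" and z: "norm z < 1"
  shows "norm (U z) \<le> exp (poisson_integral circle_measure \<phi> z)"
proof -
  have int\<phi>: "integrable circle_measure \<phi>" by (rule integrable_circle_continuous[OF \<phi>])
  define g where "g = herglotz_integral circle_measure \<phi>"
  have g: "g holomorphic_on ball 0 1"
    unfolding g_def by (intro herglotz_integral_holomorphic circle_borel_circle_measure int\<phi>)
  have Reg: "Re (g w) = poisson_integral circle_measure \<phi> w" if "norm w < 1" for w
    unfolding g_def by (intro Re_herglotz_integral circle_borel_circle_measure int\<phi> that)
  define V where "V w = U w * exp (- g w)" for w
  have V: "V holomorphic_on ball 0 1"
    unfolding V_def by (intro holomorphic_intros U g)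
  have "compact (\<phi> ` sphere 0 1)"
    using \<phi>(2) by (intro compact_continuous_image) auto
  then have "bounded (\<phi> ` sphere 0 1)" by (rule compact_imp_bounded)
  then obtain A where A: "A > 0" "\<And>\<zeta>. norm \<zeta> = 1 \<Longrightarrow> \<bar>\<phi> \<zeta>\<bar> \<le> A"
    unfolding bounded_pos by auto
  have uc: "uniformly_continuous_on (cball 0 1) U"
    using U(1) by (intro compact_uniformly_continuous) auto
  have main: "norm (V z) \<le> (1 + \<epsilon> * exp A) * exp \<epsilon>" if \<epsilon>: "\<epsilon> > 0" for \<epsilon>
  proof -
    obtain \<delta> where \<delta>: "\<delta> > 0"
      "\<And>v w. v \<in> cball 0 1 \<Longrightarrow> w \<in> cball 0 1 \<Longrightarrow> dist v w < \<delta> \<Longrightarrow> dist (U v) (U w) < \<epsilon>"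
      using uc \<epsilon> unfolding uniformly_continuous_on_def by blast
    obtain r\<^sub>0 where r0: "0 \<le> r\<^sub>0" "r\<^sub>0 < 1"
      "\<And>r \<xi>. r\<^sub>0 \<le> r \<Longrightarrow> r < 1 \<Longrightarrow> norm \<xi> = 1 \<Longrightarrow>
         \<bar>poisson_integral circle_measure \<phi> (of_real r * \<xi>) - \<phi> \<xi>\<bar> < \<epsilon>"
      using poisson_integral_uniform_limit[OF \<phi> \<epsilon>] by metis
    define r where "r = Max {r\<^sub>0, 1 - \<delta> / 2, (1 + norm z) / 2}"
    have r: "r\<^sub>0 \<le> r" "1 - \<delta> / 2 \<le> r" "norm z < r" "r < 1" "0 < r"
      using r0 z \<delta>(1) add_pos_nonneg[of 1 "norm z"] by (auto simp: r_def less_max_iff_disj)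
    have fr: "norm (V w) \<le> (1 + \<epsilon> * exp A) * exp \<epsilon>" if w: "norm w = r" for w
    proof -
      define \<xi> where "\<xi> = w / of_real r"
      have \<xi>: "norm \<xi> = 1" "w = of_real r * \<xi>" using w r by (auto simp: \<xi>_def norm_divide)
      have "norm (w - \<xi>) = 1 - r"
        unfolding \<xi>(2) using norm_radial_diff[OF \<xi>(1), of r] r by simp
      then have "dist w \<xi> < \<delta>" using r \<delta> by (simp add: dist_norm)
      then have "dist (U w) (U \<xi>) < \<epsilon>" using \<xi> w r by (intro \<delta>) auto
      then have "norm (U w) \<le> norm (U \<xi>) + \<epsilon>"
        using norm_triangle_ineq2[of "U w" "U \<xi>"] by (simp add: dist_norm)
      also have "\<dots> \<le> exp (\<phi> \<xi>) + \<epsilon>" using le[OF \<xi>(1)] by simp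
      finally have 1: "norm (U w) \<le> exp (\<phi> \<xi>) + \<epsilon>" .
      have 2: "Re (g w) \<ge> \<phi> \<xi> - \<epsilon>"
        using r0(3)[OF r(1,4) \<xi>(1)] Reg[of w] w r by (simp add: \<xi>(2))
      have "norm (V w) \<le> (exp (\<phi> \<xi>) + \<epsilon>) * exp (\<epsilon> - \<phi> \<xi>)"
        unfolding V_def norm_mult using 1 2 \<epsilon> by (intro mult_mono) (auto intro: add_nonneg_nonneg)
      also have "\<dots> = (1 + \<epsilon> * exp (- \<phi> \<xi>)) * exp \<epsilon>"
        by (simp add: exp_diff exp_minus field_simps)
      also have "\<dots> \<le> (1 + \<epsilon> * exp A) * exp \<epsilon>"
        using A(2)[OF \<xi>(1)] \<epsilon> by (intro mult_right_mono add_left_mono mult_left_mono) auto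
      finally show ?thesis .
    qed
    have sub: "cball 0 r \<subseteq> ball (0::complex) 1" using r by auto
    show ?thesis
    proof (rule maximum_modulus_frontier[of V "cball 0 r"])
      show "V holomorphic_on interior (cball 0 r)"
        using V sub by (metis holomorphic_on_subset interior_subset subset_trans)
      show "continuous_on (closure (cball 0 r)) V"
        using continuous_on_subset[OF holomorphic_on_imp_continuous_on[OF V] sub] by simp
    qed (use fr r in auto)
  qed
  have "((\<lambda>\<epsilon>. (1 + \<epsilon> * exp A) * exp \<epsilon>) \<longlongrightarrow> (1 + 0 * exp A) * exp 0) (at_right (0::real))"
    by (intro tendsto_intros)
  then have "norm (V z) \<le> (1 + 0 * exp A) * exp 0"
    by (rule tendsto_lowerbound) (auto simp: eventually_at_filter main)
  then have "norm (U z) * exp (- Re (g z)) \<le> 1" by (simp add: V_def norm_mult)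
  then show ?thesis using Reg[OF z] by (simp add: exp_minus field_simps)
qed

section \<open>The maximal function on the circle\<close>

lemma two_div_pi_times_le_sin:
  assumes "0 \<le> x" "x \<le> pi / 2"
  shows "2 / pi * x \<le> sin x"
proof -
  have "concave_on {0..pi} sin"
    by (rule f''_le0_imp_concave[where f' = cos and f'' = "\<lambda>x. - sin x"])
      (auto intro!: derivative_eq_intros sin_ge_zero)
  from concave_onD[OF this, of "2 / pi * x" 0 "pi / 2"] show ?thesis
    using assms by (simp add: field_simps)
qed

lemma norm_cis_diff: "norm (cis s - cis t) = 2 * \<bar>sin ((s - t) / 2)\<bar>"
proof -
  have "(norm (cis s - cis t))\<^sup>2 = 2 - 2 * cos (s - t)"
    using sin_cos_squared_add[of s] sin_cos_squared_add[of t]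
    unfolding cmod_power2 by (simp add: power2_eq_square algebra_simps cos_diff)
  also have "2 - 2 * cos (s - t) = (2 * \<bar>sin ((s - t) / 2)\<bar>)\<^sup>2"
    using cos_double_sin[of "(s - t) / 2"] by (simp add: power_mult_distrib diff_divide_distrib)
  finally show ?thesis by (rule power2_eq_imp_eq) auto
qed

lemma norm_cis_diff_ge:
  assumes "\<bar>s - t\<bar> \<le> pi"
  shows "2 / pi * \<bar>s - t\<bar> \<le> norm (cis s - cis t)"
proof -
  have "2 / pi * (\<bar>s - t\<bar> / 2) \<le> sin (\<bar>s - t\<bar> / 2)"
    using assms by (intro two_div_pi_times_le_sin) auto
  also have "\<dots> \<le> \<bar>sin ((s - t) / 2)\<bar>"
  proof (cases "s \<ge> t")
    case False
    then have "\<bar>s - t\<bar> / 2 = - ((s - t) / 2)" by argo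
    then show ?thesis by (simp only: sin_minus abs_ge_minus_self)
  qed simp
  finally show ?thesis by (simp add: norm_cis_diff)
qed

text \<open>
  A chord is at least \<open>2 / \<pi>\<close> times its arc. Three translates of one interval are needed because the
  parametrization by \<open>[0, 2\<pi>)\<close> cuts the circle at \<open>1\<close>.
\<close>

lemma emeasure_circle_ball_le:
  assumes \<zeta>: "norm \<zeta> = 1" and t: "t > 0"
  shows "emeasure circle_measure (ball \<zeta> t) \<le> ennreal (2 * t)"
proof -
  obtain a where a: "0 \<le> a" "a < 2 * pi" "\<zeta> = cis a"
    using \<zeta> by (metis Arg2pi_ge_0 Arg2pi_lt_2pi complex_norm_eq_1_exp cis_conv_exp)
  define I where "I c = {a + c - pi * t / 2 .. a + c + pi * t / 2}" for c
  have sub: "indicator (ball \<zeta> t) (cis s) * indicator {0..<2 * pi} s \<le>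
      indicator (I 0) s + indicator (I (2 * pi)) s + (indicator (I (- 2 * pi)) s :: ennreal)" for s
  proof (cases "cis s \<in> ball \<zeta> t \<and> s \<in> {0..<2 * pi}")
    case True
    then have d: "norm (cis a - cis s) < t" and s: "0 \<le> s" "s < 2 * pi"
      by (auto simp: a(3) dist_norm)
    have *: "s \<in> I c" if "\<bar>a + c - s\<bar> \<le> pi" "cis (a + c) = cis a" for c
    proof -
      have "2 / pi * \<bar>a + c - s\<bar> < t"
        using norm_cis_diff_ge[of "a + c" s] that d by simp
      then have "\<bar>a + c - s\<bar> < pi * t / 2" by (simp add: field_simps)
      then show ?thesis unfolding I_def atLeastAtMost_iff by argo
    qed
    have "s \<in> I 0 \<or> s \<in> I (2 * pi) \<or> s \<in> I (- 2 * pi)"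
    proof -
      have cc: "cis (a + 2 * pi) = cis a" "cis (a + - 2 * pi) = cis a"
        using cos_periodic[of "a - 2 * pi"] sin_periodic[of "a - 2 * pi"] by (simp_all add: complex_eq_iff)
      consider "\<bar>a - s\<bar> \<le> pi" | "\<bar>a + 2 * pi - s\<bar> \<le> pi" | "\<bar>a + - 2 * pi - s\<bar> \<le> pi"
        using s a by (simp add: abs_le_iff) argo
      then show ?thesis using *[of 0] *[of "2 * pi"] *[of "- 2 * pi"] cc by cases auto
    qed
    then show ?thesis using True by (auto split: split_indicator)
  qed (auto split: split_indicator)
  have [measurable]: "I c \<in> sets borel" for c by (simp add: I_def)
  have len: "emeasure lborel (I c) = ennreal (pi * t)" for c
    using t by (simp add: I_def)
  have "emeasure circle_measure (ball \<zeta> t) = (\<integral>\<^sup>+\<zeta>'. indicator (ball \<zeta> t) \<zeta>' \<partial>circle_measure)"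
    by simp
  also have "\<dots> = (\<integral>\<^sup>+s. indicator (ball \<zeta> t) (cis s) * indicator {0..<2 * pi} s \<partial>lborel) / ennreal (2 * pi)"
    by (rule nn_integral_circle_measure) (intro borel_measurable_indicator, simp)
  also have "\<dots> \<le> (\<integral>\<^sup>+s. indicator (I 0) s + indicator (I (2 * pi)) s + indicator (I (- 2 * pi)) s \<partial>lborel) / ennreal (2 * pi)"
    by (intro divide_right_mono_ennreal nn_integral_mono sub)
  also have "\<dots> = ennreal (3 * (pi * t)) / ennreal (2 * pi)"
    using t by (simp add: nn_integral_add len flip: ennreal_plus)
  also have "\<dots> = ennreal (3 / 2 * t)"
    using t by (simp add: divide_ennreal)
  also have "\<dots> \<le> ennreal (2 * t)" using t by (intro ennreal_leI) simp
  finally show ?thesis .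
qed

text \<open>
  The Hardy--Littlewood maximal function of a measure on the circle, with disks centred on the circle in place of
  arcs; the radius is comparable to the arc length.
\<close>

definition maximal_function :: "complex measure \<Rightarrow> complex \<Rightarrow> ennreal" where
  "maximal_function \<tau> \<zeta> = (SUP t\<in>{0<..}. emeasure \<tau> (ball \<zeta> t) / ennreal t)"

lemma emeasure_ball_le_maximal:
  assumes "t > 0"
  shows "emeasure \<tau> (ball \<zeta> t) \<le> ennreal t * maximal_function \<tau> \<zeta>"
proof -
  have "emeasure \<tau> (ball \<zeta> t) / ennreal t \<le> maximal_function \<tau> \<zeta>"
    unfolding maximal_function_def using assms by (intro SUP_upper) auto
  then have "ennreal t * (emeasure \<tau> (ball \<zeta> t) / ennreal t) \<le> ennreal t * maximal_function \<tau> \<zeta>"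
    by (rule mult_left_mono) simp
  then show ?thesis
    using assms by (simp add: ennreal_times_divide mult.commute[of "ennreal t"] mult_divide_eq_ennreal)
qed

text \<open>
  If a disk about \<open>\<zeta>\<close> carries mass more than \<open>s t\<close>, so does a slightly smaller one, and that one is contained in
  the disk of radius \<open>t\<close> about every point close to \<open>\<zeta>\<close>.
\<close>

lemma open_maximal_function_greater:
  assumes "sets \<tau> = sets borel"
  shows "open {\<zeta>. s < maximal_function \<tau> \<zeta>}"
proof (subst open_contains_ball, intro ballI)
  fix \<zeta> assume "\<zeta> \<in> {\<zeta>. s < maximal_function \<tau> \<zeta>}"
  then obtain t where t: "t > 0" "s < emeasure \<tau> (ball \<zeta> t) / ennreal t"
    by (auto simp: maximal_function_def less_SUP_iff)
  define B where "B n = ball \<zeta> (t - t / (real n + 2))" for n :: nat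
  have "(\<lambda>n. emeasure \<tau> (B n)) \<longlonglongrightarrow> emeasure \<tau> (\<Union>n. B n)"
  proof (rule Lim_emeasure_incseq)
    show "incseq B"
      using t by (auto simp: B_def incseq_def frac_le intro!: subset_ball)
  qed (auto simp: B_def assms)
  moreover have "(\<Union>n. B n) = ball \<zeta> t"
  proof (intro equalityI subsetI)
    fix x assume "x \<in> ball \<zeta> t"
    then have "(t - dist \<zeta> x) / t > 0" using t by simp
    then obtain n where "inverse (real (Suc n)) < (t - dist \<zeta> x) / t"
      using reals_Archimedean by blast
    moreover have "1 / (real n + 2) \<le> inverse (real (Suc n))" by (simp add: field_simps)
    ultimately have "t * (1 / (real n + 2)) < t * ((t - dist \<zeta> x) / t)"
      using t by (intro mult_strict_left_mono) auto
    then have "x \<in> B n" using t by (simp add: B_def)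
    then show "x \<in> (\<Union>n. B n)" by auto
  qed (use t in \<open>auto simp: B_def\<close>, smt (verit) divide_nonneg_nonneg of_nat_0_le_iff)
  ultimately have "(\<lambda>n. emeasure \<tau> (B n) / ennreal t) \<longlonglongrightarrow> emeasure \<tau> (ball \<zeta> t) / ennreal t"
    unfolding divide_ennreal_def mult.commute[of _ "inverse (ennreal t)"] using t
    by (intro ennreal_tendsto_cmult) (auto simp: inverse_ennreal)
  then have "\<forall>\<^sub>F n in sequentially. s < emeasure \<tau> (B n) / ennreal t"
    using t(2) by (rule order_tendstoD)
  then obtain n where n: "s < emeasure \<tau> (B n) / ennreal t"
    by (auto simp: eventually_sequentially)
  have "ball \<zeta> (t / (real n + 2)) \<subseteq> {\<zeta>. s < maximal_function \<tau> \<zeta>}"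
  proof
    fix x assume "x \<in> ball \<zeta> (t / (real n + 2))"
    then have "B n \<subseteq> ball x t"
      unfolding B_def by (auto simp: subset_iff) (smt (verit) dist_commute dist_triangle)
    then have "emeasure \<tau> (B n) / ennreal t \<le> emeasure \<tau> (ball x t) / ennreal t"
      by (intro divide_right_mono_ennreal emeasure_mono) (auto simp: assms)
    also have "\<dots> \<le> maximal_function \<tau> x"
      unfolding maximal_function_def using t by (intro SUP_upper) auto
    finally show "x \<in> {\<zeta>. s < maximal_function \<tau> \<zeta>}" using n by auto
  qed
  then show "\<exists>e>0. ball \<zeta> e \<subseteq> {\<zeta>. s < maximal_function \<tau> \<zeta>}"
    using t by (intro exI[of _ "t / (real n + 2)"]) auto
qed

lemma maximal_function_measurable:
  assumes "sets \<tau> = sets borel"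
  shows "maximal_function \<tau> \<in> borel_measurable borel"
  using open_maximal_function_greater[OF assms]
  by (intro borel_measurableI_greater) auto

text \<open>
  By Vitali's covering lemma the set is covered by the fivefold enlargements of countably many disjoint disks, each
  of radius below \<open>1 / s\<close> times its mass.
\<close>

lemma weak_type_maximal_function:
  assumes \<tau>: "sets \<tau> = sets borel" "finite_measure \<tau>" and s: "s > 0"
  shows "emeasure circle_measure {\<zeta>. ennreal s < maximal_function \<tau> \<zeta>} \<le> ennreal (10 / s) * emeasure \<tau> UNIV"
proof -
  interpret \<tau>: finite_measure \<tau> by fact
  have sp: "space \<tau> = UNIV" using sets_eq_imp_space_eq[OF \<tau>(1)] by simp
  define S where "S = {\<zeta>. ennreal s < maximal_function \<tau> \<zeta>} \<inter> sphere 0 1"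
  have Sb: "{\<zeta>. ennreal s < maximal_function \<tau> \<zeta>} \<in> sets borel"
    using open_maximal_function_greater[OF \<tau>(1)] by auto
  have "\<exists>t. t > 0 \<and> ennreal s < emeasure \<tau> (ball \<zeta> t) / ennreal t" if "\<zeta> \<in> S" for \<zeta>
    using that by (auto simp: S_def maximal_function_def less_SUP_iff)
  then obtain t where t: "\<And>\<zeta>. \<zeta> \<in> S \<Longrightarrow> t \<zeta> > 0 \<and> ennreal s < emeasure \<tau> (ball \<zeta> (t \<zeta>)) / ennreal (t \<zeta>)"
    by metis
  have t': "ennreal (t \<zeta>) \<le> ennreal (1 / s) * emeasure \<tau> (ball \<zeta> (t \<zeta>))" if "\<zeta> \<in> S" for \<zeta>
  proof -
    have tp: "t \<zeta> > 0" using t that by auto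
    have "ennreal s < ennreal (measure \<tau> (ball \<zeta> (t \<zeta>)) / t \<zeta>)"
      using t[OF that] tp by (simp add: \<tau>.emeasure_eq_measure divide_ennreal)
    then have "s < measure \<tau> (ball \<zeta> (t \<zeta>)) / t \<zeta>"
      using s by (simp add: ennreal_less_iff)
    then have "t \<zeta> \<le> 1 / s * measure \<tau> (ball \<zeta> (t \<zeta>))"
      using s tp by (simp add: field_simps)
    then show ?thesis
      using s by (simp add: \<tau>.emeasure_eq_measure ennreal_leI flip: ennreal_mult)
  qed
  define R where "R = 1 / s * measure \<tau> UNIV"
  have r: "0 < t \<zeta> \<and> t \<zeta> \<le> R" if "\<zeta> \<in> S" for \<zeta>
  proof -
    have "ennreal (t \<zeta>) \<le> ennreal (1 / s) * emeasure \<tau> (space \<tau>)"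
      using t'[OF that] by (rule order_trans) (intro mult_left_mono emeasure_space; simp)
    then have "ennreal (t \<zeta>) \<le> ennreal R"
      using s by (simp add: sp R_def \<tau>.emeasure_eq_measure flip: ennreal_mult)
    moreover have "R \<ge> 0" using s by (simp add: R_def)
    ultimately show ?thesis using t[OF that] by (simp add: ennreal_le_iff)
  qed
  have "S \<subseteq> (\<Union>\<zeta>\<in>S. ball \<zeta> (t \<zeta>))" using r by auto
  then obtain C where C: "countable C" "C \<subseteq> S"
      "pairwise (\<lambda>i j. disjnt (ball i (t i)) (ball j (t j))) C"
      "S \<subseteq> (\<Union>i\<in>C. ball i (5 * t i))"
    using Vitali_covering_lemma_balls[of S "\<lambda>\<zeta>. \<zeta>" t S R] r by auto
  have "AE \<zeta> in circle_measure. \<zeta> \<in> {\<zeta>. ennreal s < maximal_function \<tau> \<zeta>} \<longleftrightarrow> \<zeta> \<in> S"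
    using AE_circle_measure by eventually_elim (auto simp: S_def)
  then have "emeasure circle_measure {\<zeta>. ennreal s < maximal_function \<tau> \<zeta>} = emeasure circle_measure S"
    using Sb by (intro emeasure_eq_AE) (auto simp: S_def)
  also have "\<dots> \<le> emeasure circle_measure (\<Union>i\<in>C. ball i (5 * t i))"
    using C by (intro emeasure_mono) (auto intro!: sets.countable_UN')
  also have "\<dots> \<le> (\<integral>\<^sup>+i. emeasure circle_measure (ball i (5 * t i)) \<partial>count_space C)"
  proof -
    have "emeasure circle_measure (\<Union>i\<in>C. ball i (5 * t i))
        = (\<integral>\<^sup>+x. indicator (\<Union>i\<in>C. ball i (5 * t i)) x \<partial>circle_measure)"
      using C by (intro nn_integral_indicator[symmetric]) (auto intro!: sets.countable_UN')
    also have "\<dots> \<le> (\<integral>\<^sup>+x. \<integral>\<^sup>+i. indicator (ball i (5 * t i)) x \<partial>count_space C \<partial>circle_measure)"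
    proof (intro nn_integral_mono)
      fix x
      have "indicator (ball i (5 * t i)) x \<le> (\<integral>\<^sup>+i. indicator (ball i (5 * t i)) x \<partial>count_space C)" if "i \<in> C" for i
        using nn_integral_ge_point[OF that, of "\<lambda>i. indicator (ball i (5 * t i)) x"] by simp
      then show "indicator (\<Union>i\<in>C. ball i (5 * t i)) x \<le> (\<integral>\<^sup>+i. indicator (ball i (5 * t i)) x \<partial>count_space C)"
        by (force split: split_indicator)
    qed
    also have "\<dots> = (\<integral>\<^sup>+i. \<integral>\<^sup>+x. indicator (ball i (5 * t i)) x \<partial>circle_measure \<partial>count_space C)"
      using C by (intro nn_integral_count_space_nn_integral) (auto intro!: borel_measurable_indicator)
    finally show ?thesis by simp
  qed
  also have "\<dots> \<le> (\<integral>\<^sup>+i. ennreal (10 / s) * emeasure \<tau> (ball i (t i)) \<partial>count_space C)"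
  proof (rule nn_integral_mono)
    fix i assume "i \<in> space (count_space C)"
    then have i: "i \<in> S" using C by auto
    have "emeasure circle_measure (ball i (5 * t i)) \<le> ennreal (2 * (5 * t i))"
      using i r[OF i] by (intro emeasure_circle_ball_le) (auto simp: S_def)
    also have "\<dots> = ennreal 10 * ennreal (t i)" using r[OF i] by (subst ennreal_mult[symmetric]) auto
    also have "\<dots> \<le> ennreal 10 * (ennreal (1 / s) * emeasure \<tau> (ball i (t i)))"
      by (intro mult_left_mono t' i) auto
    also have "\<dots> = ennreal (10 / s) * emeasure \<tau> (ball i (t i))"
      using s by (subst mult.assoc[symmetric], subst ennreal_mult[symmetric]) auto
    finally show "emeasure circle_measure (ball i (5 * t i)) \<le> ennreal (10 / s) * emeasure \<tau> (ball i (t i))" .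
  qed
  also have "\<dots> = ennreal (10 / s) * (\<integral>\<^sup>+i. emeasure \<tau> (ball i (t i)) \<partial>count_space C)"
    by (rule nn_integral_cmult) auto
  also have "(\<integral>\<^sup>+i. emeasure \<tau> (ball i (t i)) \<partial>count_space C) = emeasure \<tau> (\<Union>i\<in>C. ball i (t i))"
    using C by (intro emeasure_UN_countable[symmetric])
      (auto simp: \<tau>(1) disjoint_family_on_def pairwise_def disjnt_def)
  also have "\<dots> \<le> emeasure \<tau> UNIV"
    using emeasure_space[of \<tau>] by (simp add: sp)
  finally show ?thesis by (simp add: mult_left_mono)
qed

text \<open>
  The kernel at height \<open>\<delta> = 1 - r\<close> is dominated by the sum over \<open>j\<close> of \<open>32 / (4\<^sup>j \<delta>)\<close> times the indicator of the disk of
  radius \<open>2\<^sup>j \<delta>\<close>, and the \<open>j\<close>-th term integrates to at most \<open>32 / 2\<^sup>j\<close> times the maximal function.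
\<close>

lemma poisson_le_maximal_function:
  assumes \<tau>: "sets \<tau> = sets borel" "AE \<xi> in \<tau>. norm \<xi> = 1" and \<zeta>: "norm \<zeta> = 1" and r: "0 \<le> r" "r < 1"
  shows "(\<integral>\<^sup>+\<xi>. ennreal (poisson_kernel (of_real r * \<zeta>) \<xi>) \<partial>\<tau>) \<le> 64 * maximal_function \<tau> \<zeta>"
proof -
  note [measurable_cong] = \<tau>(1)
  define \<delta> where "\<delta> = 1 - r"
  have \<delta>: "0 < \<delta>" "\<delta> \<le> 1" using r by (auto simp: \<delta>_def)
  have nz: "norm (of_real r * \<zeta>) = r" using \<zeta> r by (simp add: norm_mult)
  have ptw: "ennreal (poisson_kernel (of_real r * \<zeta>) \<xi>)
      \<le> (\<Sum>j. ennreal (32 / (4 ^ j * \<delta>)) * indicator (ball \<zeta> (2 ^ j * \<delta>)) \<xi>)" if \<xi>: "norm \<xi> = 1" for \<xi>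
  proof -
    define d where "d = norm (\<xi> - \<zeta>)"
    define x where "x = norm (\<xi> - of_real r * \<zeta>)"
    have x1: "x \<ge> \<delta>" using norm_diff_circle_ge[OF \<xi>, of "of_real r * \<zeta>"] nz by (simp add: x_def \<delta>_def)
    have "norm (of_real r * \<zeta> - \<zeta>) = \<delta>"
      using norm_radial_diff[OF \<zeta>, of r] r by (simp add: \<delta>_def)
    then have x2: "d \<le> x + \<delta>"
      using norm_triangle_ineq[of "\<xi> - of_real r * \<zeta>" "of_real r * \<zeta> - \<zeta>"] by (simp add: d_def x_def)
    have xd: "d \<le> 2 * x" using x1 x2 by simp
    have P: "poisson_kernel (of_real r * \<zeta>) \<xi> \<le> 2 * \<delta> / x\<^sup>2"
    proof -
      have "1 - r\<^sup>2 = (1 - r) * (1 + r)" by (simp add: power2_eq_square algebra_simps)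
      also have "\<dots> \<le> \<delta> * 2" unfolding \<delta>_def using r by (intro mult_left_mono) auto
      finally show ?thesis
        unfolding poisson_kernel_def nz x_def[symmetric] by (intro divide_right_mono) auto
    qed
    obtain n :: nat where "d / \<delta> < 2 ^ n" using real_arch_pow[of 2] by auto
    then have ex: "\<exists>n::nat. d < 2 ^ n * \<delta>" using \<delta> by (auto simp: field_simps)
    define j where "j = (LEAST n::nat. d < 2 ^ n * \<delta>)"
    have j: "d < 2 ^ j * \<delta>" unfolding j_def by (rule LeastI_ex[OF ex])
    have "2 ^ j * \<delta> \<le> 4 * x"
    proof (cases j)
      case 0 then show ?thesis using x1 \<delta> by simp
    next
      case (Suc i)
      then have "\<not> d < 2 ^ i * \<delta>" using not_less_Least[of i "\<lambda>n. d < 2 ^ n * \<delta>"] by (simp add: j_def)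
      then have "\<delta> * 2 ^ i \<le> 2 * x" using xd by (simp add: mult.commute)
      then show ?thesis using Suc by (simp add: mult.commute)
    qed
    then have "(2 ^ j * \<delta>)\<^sup>2 \<le> (4 * x)\<^sup>2" using \<delta> by (intro power_mono) auto
    then have "4 ^ j * \<delta>\<^sup>2 \<le> 16 * x\<^sup>2"
      using power_mult[of "2::real" 2 j] power_mult[of "2::real" j 2]
      by (simp add: power_mult_distrib mult.commute)
    then have "2 * \<delta> / x\<^sup>2 \<le> 32 / (4 ^ j * \<delta>)"
      using \<delta> x1 by (simp add: field_simps power2_eq_square)
    with P have "ennreal (poisson_kernel (of_real r * \<zeta>) \<xi>)
        \<le> ennreal (32 / (4 ^ j * \<delta>)) * indicator (ball \<zeta> (2 ^ j * \<delta>)) \<xi>"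
      using j by (simp add: d_def dist_norm norm_minus_commute ennreal_leI)
    also have "\<dots> \<le> (\<Sum>j. ennreal (32 / (4 ^ j * \<delta>)) * indicator (ball \<zeta> (2 ^ j * \<delta>)) \<xi>)"
      using ennreal_suminf_lessD[of "\<lambda>j. ennreal (32 / (4 ^ j * \<delta>)) * indicator (ball \<zeta> (2 ^ j * \<delta>)) \<xi>" _ j]
      by (meson not_le order_less_irrefl)
    finally show ?thesis .
  qed
  have "(\<integral>\<^sup>+\<xi>. ennreal (poisson_kernel (of_real r * \<zeta>) \<xi>) \<partial>\<tau>)
      \<le> (\<integral>\<^sup>+\<xi>. (\<Sum>j. ennreal (32 / (4 ^ j * \<delta>)) * indicator (ball \<zeta> (2 ^ j * \<delta>)) \<xi>) \<partial>\<tau>)"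
    by (intro nn_integral_mono_AE eventually_mono[OF \<tau>(2)] ptw)
  also have "\<dots> = (\<Sum>j. ennreal (32 / (4 ^ j * \<delta>)) * emeasure \<tau> (ball \<zeta> (2 ^ j * \<delta>)))"
  proof -
    have [measurable]: "(indicator (ball \<zeta> x) :: complex \<Rightarrow> ennreal) \<in> borel_measurable \<tau>" for x
      by (intro borel_measurable_indicator) (simp add: \<tau>(1))
    have "(\<lambda>\<xi>. ennreal (32 / (4 ^ j * \<delta>)) * indicator (ball \<zeta> (2 ^ j * \<delta>)) \<xi>) \<in> borel_measurable \<tau>" for j :: nat
      by measurable
    then show ?thesis
      by (simp add: nn_integral_suminf nn_integral_cmult_indicator \<tau>(1))
  qed
  also have "\<dots> \<le> (\<Sum>j. ennreal (32 * (1 / 2) ^ j) * maximal_function \<tau> \<zeta>)"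
  proof (intro suminf_le)
    fix j :: nat
    have "ennreal (32 / (4 ^ j * \<delta>)) * emeasure \<tau> (ball \<zeta> (2 ^ j * \<delta>))
        \<le> ennreal (32 / (4 ^ j * \<delta>)) * (ennreal (2 ^ j * \<delta>) * maximal_function \<tau> \<zeta>)"
      using \<delta> by (intro mult_left_mono emeasure_ball_le_maximal) auto
    also have "\<dots> = ennreal (32 / (4 ^ j * \<delta>) * (2 ^ j * \<delta>)) * maximal_function \<tau> \<zeta>"
      using \<delta> by (simp only: mult.assoc[symmetric]) (subst ennreal_mult[symmetric], auto)
    also have "32 / (4 ^ j * \<delta>) * (2 ^ j * \<delta>) = 32 * (1 / 2) ^ j"
      using \<delta> by (simp add: field_simps flip: power_mult_distrib)
    finally show "ennreal (32 / (4 ^ j * \<delta>)) * emeasure \<tau> (ball \<zeta> (2 ^ j * \<delta>))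
        \<le> ennreal (32 * (1 / 2) ^ j) * maximal_function \<tau> \<zeta>" .
  qed auto
  also have "\<dots> = (\<Sum>j. ennreal (32 * (1 / 2) ^ j)) * maximal_function \<tau> \<zeta>"
    by (rule ennreal_suminf_multc)
  also have "(\<Sum>j. ennreal (32 * (1 / 2) ^ j)) = ennreal 64"
  proof -
    have "(\<lambda>j. 32 * (1 / 2 :: real) ^ j) sums (32 * (1 / (1 - 1 / 2)))"
      by (intro sums_mult geometric_sums) auto
    then show ?thesis by (intro suminf_ennreal_eq) auto
  qed
  finally show ?thesis by simp
qed

section \<open>Radial limits of singular inner functions\<close>

text \<open>
  A function on the disk may be non-measurable outside of it, so it is cut off before it is integrated.
\<close>

lemma measurable_on_disk:
  fixes G :: "complex \<Rightarrow> complex"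
  assumes "G holomorphic_on ball 0 1"
  shows "(\<lambda>z. if norm z < 1 then G z else 0) \<in> borel_measurable borel"
proof -
  have "(\<lambda>z. indicator (ball 0 1) z *\<^sub>R G z) \<in> borel_measurable borel"
    using assms by (intro borel_measurable_continuous_on_indicator holomorphic_on_imp_continuous_on) auto
  also have "(\<lambda>z. indicator (ball 0 1) z *\<^sub>R G z) = (\<lambda>z. if norm z < 1 then G z else 0)"
    by (auto simp: fun_eq_iff indicator_def)
  finally show ?thesis .
qed

lemma norm_dilation_less:
  fixes z :: complex
  assumes "0 \<le> \<rho>" "\<rho> < 1" "norm z \<le> 1"
  shows "norm (of_real \<rho> * z) < 1"
  using assms mult_left_le[of "norm z" \<rho>] by (simp add: norm_mult)

lemma continuous_on_dilation:
  assumes "G holomorphic_on ball 0 1" "0 \<le> \<rho>" "\<rho> < 1"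
  shows "continuous_on (cball 0 1) (\<lambda>z. G (of_real \<rho> * z))"
proof (rule continuous_on_compose2[OF holomorphic_on_imp_continuous_on[OF assms(1)]])
  show "(\<lambda>z. of_real \<rho> * z) ` cball 0 1 \<subseteq> ball (0::complex) 1"
    using norm_dilation_less[OF assms(2,3)] by (auto simp del: dist_0_norm simp: dist_norm)
qed (intro continuous_intros)

lemma holomorphic_on_dilation:
  assumes "G holomorphic_on ball 0 1" "0 \<le> \<rho>" "\<rho> < 1"
  shows "(\<lambda>z. G (of_real \<rho> * z)) holomorphic_on ball 0 1"
proof -
  have "(\<lambda>z. of_real \<rho> * z) ` ball 0 1 \<subseteq> ball (0::complex) 1"
    using norm_dilation_less[OF assms(2,3)] by auto
  then have "(G \<circ> (\<lambda>z. of_real \<rho> * z)) holomorphic_on ball 0 1"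
    using assms(1) by (intro holomorphic_on_compose_gen holomorphic_intros)
  then show ?thesis by (simp add: o_def)
qed

text \<open>
  The real part of the dilated function is the Poisson integral of its boundary values, which have mean at most
  \<open>Re (G 0)\<close>, so the weak-type estimate of the maximal function applies. The constant is \<open>640 = 64 * 10\<close>.
\<close>

lemma radial_weak_type_fixed_radius:
  assumes G: "G holomorphic_on ball 0 1" and pos: "\<And>z. norm z < 1 \<Longrightarrow> 0 \<le> Re (G z)"
    and s: "s > 0" and \<rho>: "0 \<le> \<rho>" "\<rho> < 1"
  shows "\<exists>E\<in>sets borel. emeasure circle_measure E \<le> ennreal (640 * Re (G 0) / s) \<and>
    (\<forall>\<zeta> r. norm \<zeta> = 1 \<longrightarrow> \<zeta> \<notin> E \<longrightarrow> 0 \<le> r \<longrightarrow> r < 1 \<longrightarrow> Re (G (of_real \<rho> * (of_real r * \<zeta>))) \<le> s)"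
proof -
  define G' where "G' z = (if norm z < 1 then G z else 0)" for z
  have [measurable]: "G' \<in> borel_measurable borel"
    using measurable_on_disk[OF G] by (simp add: G'_def[abs_def])
  define \<phi> where "\<phi> \<zeta> = Re (G' (of_real \<rho> * \<zeta>))" for \<zeta>
  have \<phi>_meas [measurable]: "\<phi> \<in> borel_measurable borel" unfolding \<phi>_def by measurable
  have \<phi>0: "0 \<le> \<phi> \<zeta>" for \<zeta> using pos by (auto simp: \<phi>_def G'_def)
  have \<phi>G: "\<phi> \<zeta> = Re (G (of_real \<rho> * \<zeta>))" if "norm \<zeta> \<le> 1" for \<zeta>
    using norm_dilation_less[OF \<rho> that] by (simp add: \<phi>_def G'_def)
  have cont: "continuous_on (sphere 0 1) \<phi>"
  proof -
    have "continuous_on (sphere 0 1) (\<lambda>\<zeta>. Re (G (of_real \<rho> * \<zeta>)))"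
      by (intro continuous_intros continuous_on_subset[OF continuous_on_dilation[OF G \<rho>]]) auto
    then show ?thesis by (rule continuous_on_eq) (simp add: \<phi>G)
  qed
  have int: "integrable circle_measure \<phi>" by (rule integrable_circle_continuous[OF \<phi>_meas cont])
  have upper: "Re (G (of_real \<rho> * z)) \<le> poisson_integral circle_measure \<phi> z" if "norm z < 1" for z
  proof -
    have "norm (exp (G (of_real \<rho> * z))) \<le> exp (poisson_integral circle_measure \<phi> z)"
    proof (rule norm_le_exp_poisson_integral[OF _ _ \<phi>_meas cont _ that])
      show "continuous_on (cball 0 1) (\<lambda>z. exp (G (of_real \<rho> * z)))"
        by (intro continuous_intros continuous_on_dilation[OF G \<rho>])
      show "(\<lambda>z. exp (G (of_real \<rho> * z))) holomorphic_on ball 0 1"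
        by (intro holomorphic_on_exp' holomorphic_on_dilation[OF G \<rho>])
    qed (simp add: \<phi>G)
    then show ?thesis by simp
  qed
  have mean: "(\<integral>\<zeta>. \<phi> \<zeta> \<partial>circle_measure) \<le> Re (G 0)"
  proof -
    have "norm (exp (- G (of_real \<rho> * 0))) \<le> exp (poisson_integral circle_measure (\<lambda>\<zeta>. - \<phi> \<zeta>) 0)"
    proof (rule norm_le_exp_poisson_integral[where U = "\<lambda>z. exp (- G (of_real \<rho> * z))"])
      show "continuous_on (cball 0 1) (\<lambda>z. exp (- G (of_real \<rho> * z)))"
        by (intro continuous_intros continuous_on_dilation[OF G \<rho>])
      show "(\<lambda>z. exp (- G (of_real \<rho> * z))) holomorphic_on ball 0 1"
        by (intro holomorphic_on_exp' holomorphic_on_minus holomorphic_on_dilation[OF G \<rho>])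
    qed (auto simp: \<phi>G intro!: continuous_intros cont)
    also have "poisson_integral circle_measure (\<lambda>\<zeta>. - \<phi> \<zeta>) 0 = (\<integral>\<zeta>. - \<phi> \<zeta> \<partial>circle_measure)"
      unfolding poisson_integral_def
    proof (rule integral_cong_AE)
      show "AE \<zeta> in circle_measure. poisson_kernel 0 \<zeta> * - \<phi> \<zeta> = - \<phi> \<zeta>"
        using AE_circle_measure by eventually_elim (simp add: poisson_kernel_def)
    qed auto
    finally show ?thesis by simp
  qed
  define \<tau> where "\<tau> = density circle_measure (\<lambda>\<zeta>. ennreal (\<phi> \<zeta>))"
  have \<tau>_sets: "sets \<tau> = sets borel" by (simp add: \<tau>_def)
  have \<tau>_UNIV: "emeasure \<tau> UNIV = ennreal (\<integral>\<zeta>. \<phi> \<zeta> \<partial>circle_measure)"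
    using int \<phi>0 by (simp add: \<tau>_def emeasure_density nn_integral_eq_integral)
  have \<tau>_fin: "finite_measure \<tau>"
    by (rule finite_measureI) (simp add: \<tau>_def \<tau>_UNIV[unfolded \<tau>_def])
  have \<tau>_AE: "AE \<zeta> in \<tau>. norm \<zeta> = 1"
    unfolding \<tau>_def by (subst AE_density) (use AE_circle_measure in auto)
  define E where "E = {\<zeta>. ennreal (s / 64) < maximal_function \<tau> \<zeta>}"
  show ?thesis
  proof (intro bexI conjI allI impI)
    show "E \<in> sets borel"
      using open_maximal_function_greater[OF \<tau>_sets] by (simp add: E_def)
    have "emeasure circle_measure E \<le> ennreal (10 / (s / 64)) * emeasure \<tau> UNIV"
      unfolding E_def using s by (intro weak_type_maximal_function \<tau>_sets \<tau>_fin) auto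
    also have "\<dots> \<le> ennreal (10 / (s / 64)) * ennreal (Re (G 0))"
      unfolding \<tau>_UNIV by (intro mult_left_mono ennreal_leI mean) auto
    also have "\<dots> = ennreal (640 * Re (G 0) / s)"
      using s pos[of 0] by (subst ennreal_mult[symmetric]) auto
    finally show "emeasure circle_measure E \<le> ennreal (640 * Re (G 0) / s)" .
    fix \<zeta> :: complex and r :: real
    assume \<zeta>: "norm \<zeta> = 1" "\<zeta> \<notin> E" and r: "0 \<le> r" "r < 1"
    define z where "z = of_real r * \<zeta>"
    have z: "norm z < 1" using \<zeta> r by (simp add: z_def norm_mult)
    have "ennreal (Re (G (of_real \<rho> * z))) \<le> ennreal (poisson_integral circle_measure \<phi> z)"
      by (intro ennreal_leI upper z)
    also have "\<dots> = (\<integral>\<^sup>+\<xi>. ennreal (poisson_kernel z \<xi> * \<phi> \<xi>) \<partial>circle_measure)"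
      unfolding poisson_integral_def using \<phi>0 poisson_kernel_nonneg[OF z]
      by (intro nn_integral_eq_integral[symmetric] integrable_poisson[OF circle_borel_circle_measure int z]) auto
    also have "\<dots> = (\<integral>\<^sup>+\<xi>. ennreal (poisson_kernel z \<xi>) \<partial>\<tau>)"
      unfolding \<tau>_def using \<phi>0 poisson_kernel_nonneg[OF z]
      by (subst nn_integral_density) (auto simp: ennreal_mult mult.commute)
    also have "\<dots> \<le> 64 * maximal_function \<tau> \<zeta>"
      unfolding z_def by (intro poisson_le_maximal_function \<tau>_sets \<tau>_AE \<zeta> r)
    also have "\<dots> \<le> 64 * ennreal (s / 64)"
      using \<zeta>(2) by (intro mult_left_mono) (auto simp: E_def not_less)
    also have "\<dots> = ennreal s"
      using s by (subst ennreal_numeral[symmetric], subst ennreal_mult[symmetric]) auto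
    finally show "Re (G (of_real \<rho> * (of_real r * \<zeta>))) \<le> s"
      using s by (simp add: z_def ennreal_le_iff)
  qed
qed

text \<open>
  A point outside infinitely many of the exceptional sets of the dilates is good for \<open>G\<close> itself, and the
  set of the other points is the increasing union of the tail intersections.
\<close>

lemma radial_weak_type:
  assumes G: "G holomorphic_on ball 0 1" and pos: "\<And>z. norm z < 1 \<Longrightarrow> 0 \<le> Re (G z)"
    and s: "s > 0"
  obtains L where "L \<in> sets borel" "emeasure circle_measure L \<le> ennreal (640 * Re (G 0) / s)"
    "\<And>\<zeta> r. norm \<zeta> = 1 \<Longrightarrow> \<zeta> \<notin> L \<Longrightarrow> 0 \<le> r \<Longrightarrow> r < 1 \<Longrightarrow> Re (G (of_real r * \<zeta>)) \<le> s"
proof -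
  define \<rho> where "\<rho> k = 1 - 1 / (real k + 2)" for k :: nat
  have \<rho>: "0 \<le> \<rho> k" "\<rho> k < 1" for k by (auto simp: \<rho>_def)
  have "\<forall>k. \<exists>E\<in>sets borel. emeasure circle_measure E \<le> ennreal (640 * Re (G 0) / s) \<and>
    (\<forall>\<zeta> r. norm \<zeta> = 1 \<longrightarrow> \<zeta> \<notin> E \<longrightarrow> 0 \<le> r \<longrightarrow> r < 1 \<longrightarrow> Re (G (of_real (\<rho> k) * (of_real r * \<zeta>))) \<le> s)"
    using radial_weak_type_fixed_radius[OF G pos s \<rho>] by blast
  then obtain E where E: "\<And>k. E k \<in> sets borel" "\<And>k. emeasure circle_measure (E k) \<le> ennreal (640 * Re (G 0) / s)"
    "\<And>k \<zeta> r. norm \<zeta> = 1 \<Longrightarrow> \<zeta> \<notin> E k \<Longrightarrow> 0 \<le> r \<Longrightarrow> r < 1 \<Longrightarrow> Re (G (of_real (\<rho> k) * (of_real r * \<zeta>))) \<le> s"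
    by metis
  define F where "F K = (\<Inter>k\<in>{K..}. E k)" for K
  have F [measurable]: "F K \<in> sets borel" for K
    unfolding F_def using E(1) by (intro sets.countable_INT'') auto
  show thesis
  proof
    show "(\<Union>K. F K) \<in> sets borel" by auto
    have "incseq F" by (auto simp: F_def incseq_def)
    then have "emeasure circle_measure (\<Union>K. F K) = (SUP K. emeasure circle_measure (F K))"
      by (intro SUP_emeasure_incseq[symmetric]) auto
    also have "\<dots> \<le> ennreal (640 * Re (G 0) / s)"
    proof (rule SUP_least)
      fix K
      have "emeasure circle_measure (F K) \<le> emeasure circle_measure (E K)"
        using E(1) by (intro emeasure_mono) (auto simp: F_def)
      then show "emeasure circle_measure (F K) \<le> ennreal (640 * Re (G 0) / s)"
        using E(2) by (rule order_trans)
    qed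
    finally show "emeasure circle_measure (\<Union>K. F K) \<le> ennreal (640 * Re (G 0) / s)" .
    fix \<zeta> :: complex and r :: real
    assume \<zeta>: "norm \<zeta> = 1" "\<zeta> \<notin> (\<Union>K. F K)" and r: "0 \<le> r" "r < 1"
    obtain K :: nat where "inverse (real (Suc K)) < 1 - r"
      using reals_Archimedean[of "1 - r"] r by auto
    then have K: "1 / (real K + 1) < 1 - r" by (simp add: inverse_eq_divide add.commute)
    \<comment> \<open>A dilate with \<open>\<rho> k > r\<close> already sees the point \<open>r \<zeta>\<close>.\<close>
    from \<zeta>(2) obtain k where k: "k \<ge> K" "\<zeta> \<notin> E k" by (auto simp: F_def)
    have "1 / (real k + 2) \<le> 1 / (real K + 1)" using k by (intro divide_left_mono) auto
    then have r\<rho>: "r < \<rho> k" using K unfolding \<rho>_def by argo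
    then have "\<rho> k > 0" using r by simp
    moreover from this have "of_real (\<rho> k) * (of_real (r / \<rho> k) * \<zeta>) = of_real r * \<zeta>" by simp
    ultimately show "Re (G (of_real r * \<zeta>)) \<le> s"
      using E(3)[OF \<zeta>(1) k(2), of "r / \<rho> k"] r r\<rho> by simp
  qed
qed

text \<open>
  The limits of the approximating functions form a Cauchy sequence.
\<close>

lemma unimodular_limit_of_approximations:
  fixes f :: "'a \<Rightarrow> complex"
  assumes F: "F \<noteq> bot"
    and approx: "\<And>\<epsilon>. \<epsilon> > 0 \<Longrightarrow> \<exists>g w. norm w = 1 \<and> (g \<longlongrightarrow> w) F \<and> (\<forall>\<^sub>F x in F. norm (f x - g x) \<le> \<epsilon>)"
  shows "\<exists>w. norm w = 1 \<and> (f \<longlongrightarrow> w) F"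
proof -
  have "\<forall>n. \<exists>g w. norm w = 1 \<and> (g \<longlongrightarrow> w) F \<and> (\<forall>\<^sub>F x in F. norm (f x - g x) \<le> 1 / (real n + 1))"
    using approx by auto
  then obtain g w where gw: "\<And>n. norm (w n) = 1" "\<And>n. (g n \<longlongrightarrow> w n) F"
    "\<And>n. \<forall>\<^sub>F x in F. norm (f x - g n x) \<le> 1 / (real n + 1)"
    by metis
  have d: "norm (w m - w n) \<le> 1 / (real m + 1) + 1 / (real n + 1)" for m n
  proof (rule tendsto_upperbound[OF _ _ F])
    show "((\<lambda>x. norm (g m x - g n x)) \<longlongrightarrow> norm (w m - w n)) F"
      by (intro tendsto_intros gw)
    show "\<forall>\<^sub>F x in F. norm (g m x - g n x) \<le> 1 / (real m + 1) + 1 / (real n + 1)"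
      using gw(3)[of m] gw(3)[of n]
    proof eventually_elim
      case (elim x)
      then show ?case using norm_triangle_ineq4[of "f x - g n x" "f x - g m x"] by simp
    qed
  qed
  have lim0: "(\<lambda>n. 1 / (real n + 1)) \<longlonglongrightarrow> 0"
    using LIMSEQ_inverse_real_of_nat by (simp add: inverse_eq_divide add.commute)
  have "Cauchy w"
  proof (rule CauchyI)
    fix e :: real assume "e > 0"
    then obtain M where M: "\<And>n. n \<ge> M \<Longrightarrow> 1 / (real n + 1) < e / 2"
      using order_tendstoD(2)[OF lim0, of "e / 2"] by (auto simp: eventually_sequentially)
    show "\<exists>M. \<forall>m\<ge>M. \<forall>n\<ge>M. norm (w m - w n) < e"
    proof (intro exI[of _ M] allI impI)
      fix m n assume "m \<ge> M" "n \<ge> M"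
      then show "norm (w m - w n) < e" using d[of m n] M[of m] M[of n] by linarith
    qed
  qed
  then obtain v where v: "w \<longlonglongrightarrow> v" by (auto simp: Cauchy_convergent_iff convergent_def)
  have "norm v = 1" using tendsto_norm[OF v] gw(1) by (simp add: LIMSEQ_const_iff)
  moreover have "(f \<longlongrightarrow> v) F"
  proof (rule tendstoI)
    fix e :: real assume e: "e > 0"
    have "\<forall>\<^sub>F n in sequentially. 1 / (real n + 1) < e / 3 \<and> dist (w n) v < e / 3"
      using e by (intro eventually_conj order_tendstoD(2)[OF lim0] tendstoD[OF v]) auto
    then obtain n where n: "1 / (real n + 1) < e / 3" "dist (w n) v < e / 3"
      by (auto simp: eventually_sequentially)
    have "\<forall>\<^sub>F x in F. dist (g n x) (w n) < e / 3" using e by (intro tendstoD gw) auto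
    with gw(3)[of n] show "\<forall>\<^sub>F x in F. dist (f x) v < e"
    proof eventually_elim
      case (elim x)
      have "dist (f x) v \<le> dist (f x) (g n x) + dist (g n x) (w n) + dist (w n) v"
        using dist_triangle[of "f x" v "g n x"] dist_triangle[of "g n x" v "w n"] by linarith
      then show ?case using elim n by (simp add: dist_norm)
    qed
  qed
  ultimately show ?thesis by blast
qed

text \<open>
  Off \<open>K\<close> the integrand is Lipschitz in \<open>z\<close> up to the boundary, and on the boundary the real part of
  the Herglotz kernel vanishes.
\<close>

lemma herglotz_radial_limit_off_support:
  assumes \<nu>: "circle_borel \<nu>" and w: "integrable \<nu> w"
    and K: "closed K" "\<And>\<xi>. w \<xi> \<noteq> 0 \<Longrightarrow> \<xi> \<in> K" and \<zeta>: "norm \<zeta> = 1" "\<zeta> \<notin> K"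
  shows "\<exists>v. norm v = 1 \<and> ((\<lambda>r. exp (- herglotz_integral \<nu> w (of_real r * \<zeta>))) \<longlongrightarrow> v) (at_left 1)"
proof -
  note [measurable_cong] = circle_borel_sets[OF \<nu>]
  have [measurable]: "w \<in> borel_measurable \<nu>" using w by auto
  have "open (- K)" "\<zeta> \<in> - K" using K(1) \<zeta>(2) by auto
  then obtain d where d: "d > 0" "ball \<zeta> d \<subseteq> - K" by (rule openE)
  have dist: "d \<le> norm (\<xi> - \<zeta>)" if "w \<xi> \<noteq> 0" for \<xi>
  proof -
    have "\<xi> \<notin> ball \<zeta> d" using d(2) K(2)[OF that] by blast
    then show ?thesis by (simp add: dist_norm norm_minus_commute)
  qed
  have bound: "norm (herglotz_kernel (of_real r * \<zeta>) \<xi> * of_real (w \<xi>) - herglotz_kernel \<zeta> \<xi> * of_real (w \<xi>))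
      \<le> 4 * (1 - r) / d\<^sup>2 * \<bar>w \<xi>\<bar>" if r: "1 - d / 2 < r" "r < 1" and \<xi>: "norm \<xi> = 1" for r \<xi>
  proof (cases "w \<xi> = 0")
    case False
    have n: "norm (of_real r * \<zeta> - \<zeta>) = 1 - r" using \<zeta> r by (intro norm_radial_diff) auto
    have 1: "norm (\<xi> - \<zeta>) \<ge> d" using dist[OF False] .
    have 2: "norm (\<xi> - of_real r * \<zeta>) \<ge> d / 2"
      using norm_triangle_ineq[of "\<xi> - of_real r * \<zeta>" "of_real r * \<zeta> - \<zeta>"] 1 n r by simp
    have nz: "\<xi> - \<zeta> \<noteq> 0" "\<xi> - of_real r * \<zeta> \<noteq> 0" using 1 2 d by auto
    have "herglotz_kernel (of_real r * \<zeta>) \<xi> - herglotz_kernel \<zeta> \<xi>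
        = 2 * \<xi> * (of_real r * \<zeta> - \<zeta>) / ((\<xi> - of_real r * \<zeta>) * (\<xi> - \<zeta>))"
      using nz unfolding herglotz_kernel_def by (simp add: divide_simps) (simp add: algebra_simps)
    then have "norm (herglotz_kernel (of_real r * \<zeta>) \<xi> - herglotz_kernel \<zeta> \<xi>)
        = 2 * (1 - r) / (norm (\<xi> - of_real r * \<zeta>) * norm (\<xi> - \<zeta>))"
      using \<xi> n by (simp add: norm_mult norm_divide)
    also have "\<dots> \<le> 2 * (1 - r) / (d / 2 * d)"
      using 1 2 d r by (intro divide_left_mono mult_mono mult_pos_pos) auto
    also have "\<dots> = 4 * (1 - r) / d\<^sup>2" by (simp add: power2_eq_square)
    finally show ?thesis
      unfolding left_diff_distrib[symmetric] norm_mult norm_of_real by (rule mult_right_mono) simp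
  qed simp
  have int\<zeta>: "integrable \<nu> (\<lambda>\<xi>. herglotz_kernel \<zeta> \<xi> * of_real (w \<xi>))"
  proof (rule Bochner_Integration.integrable_bound)
    show "integrable \<nu> (\<lambda>\<xi>. 2 / d * \<bar>w \<xi>\<bar>)" using w by auto
    show "AE \<xi> in \<nu>. norm (herglotz_kernel \<zeta> \<xi> * of_real (w \<xi>)) \<le> norm (2 / d * \<bar>w \<xi>\<bar>)"
      using circle_borel_AE[OF \<nu>]
    proof eventually_elim
      case (elim \<xi>)
      show ?case
      proof (cases "w \<xi> = 0")
        case False
        have "norm (herglotz_kernel \<zeta> \<xi>) \<le> 2 / d"
          unfolding herglotz_kernel_def norm_divide
          using norm_triangle_ineq[of \<xi> \<zeta>] \<zeta> elim dist[OF False] d by (intro frac_le) auto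
        from mult_right_mono[OF this, of "\<bar>w \<xi>\<bar>"] show ?thesis using d by (simp add: norm_mult abs_mult)
      qed simp
    qed
  qed measurable
  have "((\<lambda>r. herglotz_integral \<nu> w (of_real r * \<zeta>) - herglotz_integral \<nu> w \<zeta>) \<longlongrightarrow> 0) (at_left 1)"
  proof (rule Lim_null_comparison)
    have "\<forall>\<^sub>F r in at_left (1::real). max 0 (1 - d / 2) < r \<and> r < 1"
      using d by (intro eventually_conj) (auto simp: eventually_at_left_field intro!: exI[of _ "max 0 (1 - d / 2)"])
    then show "\<forall>\<^sub>F r in at_left 1. norm (herglotz_integral \<nu> w (of_real r * \<zeta>) - herglotz_integral \<nu> w \<zeta>)
        \<le> 4 * (1 - r) / d\<^sup>2 * (\<integral>\<xi>. \<bar>w \<xi>\<bar> \<partial>\<nu>)"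
    proof eventually_elim
      case (elim r)
      have int_r: "integrable \<nu> (\<lambda>\<xi>. herglotz_kernel (of_real r * \<zeta>) \<xi> * of_real (w \<xi>))"
        using elim \<zeta> w by (intro integrable_herglotz[OF \<nu>] integrable_of_real) (auto simp: norm_mult)
      have "herglotz_integral \<nu> w (of_real r * \<zeta>) - herglotz_integral \<nu> w \<zeta> =
          (\<integral>\<xi>. herglotz_kernel (of_real r * \<zeta>) \<xi> * of_real (w \<xi>) - herglotz_kernel \<zeta> \<xi> * of_real (w \<xi>) \<partial>\<nu>)"
        unfolding herglotz_integral_def using int_r int\<zeta> by simp
      also have "norm \<dots> \<le> (\<integral>\<xi>. 4 * (1 - r) / d\<^sup>2 * \<bar>w \<xi>\<bar> \<partial>\<nu>)"
      proof (rule integral_norm_bound_integral_AE)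
        show "AE \<xi> in \<nu>. norm (herglotz_kernel (of_real r * \<zeta>) \<xi> * of_real (w \<xi>) - herglotz_kernel \<zeta> \<xi> * of_real (w \<xi>))
            \<le> 4 * (1 - r) / d\<^sup>2 * \<bar>w \<xi>\<bar>"
          using circle_borel_AE[OF \<nu>] by eventually_elim (use bound elim in auto)
      qed (use int_r int\<zeta> w in auto)
      finally show ?case by simp
    qed
    have "((\<lambda>r. 4 * (1 - r) / d\<^sup>2 * (\<integral>\<xi>. \<bar>w \<xi>\<bar> \<partial>\<nu>)) \<longlongrightarrow> 4 * (1 - 1) / d\<^sup>2 * (\<integral>\<xi>. \<bar>w \<xi>\<bar> \<partial>\<nu>)) (at_left 1)"
      using d by (intro tendsto_intros) auto
    then show "((\<lambda>r. 4 * (1 - r) / d\<^sup>2 * (\<integral>\<xi>. \<bar>w \<xi>\<bar> \<partial>\<nu>)) \<longlongrightarrow> 0) (at_left 1)" by simp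
  qed
  then have "((\<lambda>r. herglotz_integral \<nu> w (of_real r * \<zeta>)) \<longlongrightarrow> herglotz_integral \<nu> w \<zeta>) (at_left 1)"
    using LIM_zero_iff by blast
  then have "((\<lambda>r. exp (- herglotz_integral \<nu> w (of_real r * \<zeta>))) \<longlongrightarrow> exp (- herglotz_integral \<nu> w \<zeta>)) (at_left 1)"
    by (intro tendsto_intros)
  moreover have "Re (herglotz_integral \<nu> w \<zeta>) = 0"
  proof -
    have "Re (herglotz_integral \<nu> w \<zeta>) = (\<integral>\<xi>. Re (herglotz_kernel \<zeta> \<xi> * of_real (w \<xi>)) \<partial>\<nu>)"
      unfolding herglotz_integral_def by (intro integral_Re[symmetric] int\<zeta>)
    also have "\<dots> = (\<integral>\<xi>. 0 \<partial>\<nu>)"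
    proof (rule integral_cong_AE)
      show "AE \<xi> in \<nu>. Re (herglotz_kernel \<zeta> \<xi> * of_real (w \<xi>)) = 0"
        using circle_borel_AE[OF \<nu>] by eventually_elim (simp add: Re_herglotz_kernel poisson_kernel_def \<zeta>)
    qed auto
    finally show ?thesis by simp
  qed
  ultimately show ?thesis by (intro exI[of _ "exp (- herglotz_integral \<nu> w \<zeta>)"]) simp
qed

lemma singular_circle_measure_imp_circle_borel:
  assumes "singular_circle_measure \<nu>"
  shows "circle_borel \<nu>"
proof -
  have "AE \<zeta> in \<nu>. norm \<zeta> = 1"
    using assms unfolding singular_circle_measure_def
    by (intro AE_I[of _ _ "- sphere 0 1"]) auto
  then show ?thesis using assms by (simp add: singular_circle_measure_def circle_borel_def)
qed

text \<open>
  Let \<open>\<nu>\<close> be carried by the null set \<open>N\<close>, and exhaust \<open>N\<close> from inside by compact sets \<open>K\<close>. The factor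
  that belongs to \<open>K\<close> has unimodular radial limits off \<open>K\<close>. The other factor \<open>S\<close> belongs to a measure of small
  mass; then \<open>Re (1 - S)\<close> is a nonnegative harmonic function with a small value at \<open>0\<close>, hence small
  along whole radii outside a small exceptional set, and it controls \<open>|1 - S|\<^sup>2\<close>.
\<close>

lemma inner_function_singular_measure:
  assumes sing: "singular_circle_measure \<nu>"
  shows "inner_function (\<lambda>z. exp (- herglotz_integral \<nu> (\<lambda>_. 1) z))"
proof -
  have \<nu>: "circle_borel \<nu>" by (rule singular_circle_measure_imp_circle_borel[OF sing])
  note [measurable_cong] = circle_borel_sets[OF \<nu>]
  interpret \<nu>: finite_measure \<nu> by (rule circle_borel_finite[OF \<nu>])
  have sp: "space \<nu> = UNIV" by (rule circle_borel_space[OF \<nu>])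
  define S where "S w z = exp (- herglotz_integral \<nu> w z)" for w z
  have hol: "S w holomorphic_on ball 0 1" if "integrable \<nu> w" for w
    unfolding S_def by (intro holomorphic_on_exp' holomorphic_on_minus herglotz_integral_holomorphic \<nu> that)
  have le1: "norm (S w z) \<le> 1" if "integrable \<nu> w" "\<And>\<xi>. 0 \<le> w \<xi>" "norm z < 1" for w z
  proof -
    have "0 \<le> poisson_integral \<nu> w z"
      unfolding poisson_integral_def using that poisson_kernel_nonneg by (intro integral_nonneg_AE) auto
    then show ?thesis by (simp add: S_def Re_herglotz_integral[OF \<nu> that(1,3)])
  qed
  obtain N where N: "N \<in> sets borel" "emeasure circle_measure N = 0" "emeasure \<nu> (- N) = 0"
    using sing by (auto simp: singular_circle_measure_def)
  \<comment> \<open>Chosen so that the exceptional set of level \<open>1 / (k + 1)\<close> has measure at most \<open>2\<^sup>-\<^sup>k\<close>.\<close>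
  define \<epsilon> where "\<epsilon> k = (1 / 2) ^ k / (640 * (real k + 1))" for k :: nat
  have \<epsilon>: "\<epsilon> k > 0" for k by (simp add: \<epsilon>_def)
  have "\<exists>K. K \<subseteq> N \<and> compact K \<and> measure \<nu> (- K) < \<epsilon> k" for k
  proof -
    have "emeasure \<nu> N = (SUP K \<in> {K. K \<subseteq> N \<and> compact K}. emeasure \<nu> K)"
      by (rule inner_regular) (auto simp: circle_borel_sets[OF \<nu>] N(1))
    moreover have "emeasure \<nu> N = emeasure \<nu> UNIV"
      using emeasure_Un_null_set[of N \<nu> "- N"] N circle_borel_sets[OF \<nu>]
      by (auto simp: null_sets_def Compl_partition)
    ultimately have *: "ennreal (measure \<nu> UNIV) = (SUP K \<in> {K. K \<subseteq> N \<and> compact K}. ennreal (measure \<nu> K))"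
      by (simp add: \<nu>.emeasure_eq_measure)
    have "\<exists>K. K \<subseteq> N \<and> compact K \<and> measure \<nu> UNIV - \<epsilon> k < measure \<nu> K"
    proof (rule ccontr)
      assume "\<not> ?thesis"
      then have "\<forall>K. K \<subseteq> N \<and> compact K \<longrightarrow> measure \<nu> K \<le> measure \<nu> UNIV - \<epsilon> k" by (auto simp: not_less)
      then have "(SUP K \<in> {K. K \<subseteq> N \<and> compact K}. ennreal (measure \<nu> K)) \<le> ennreal (measure \<nu> UNIV - \<epsilon> k)"
        by (intro SUP_least ennreal_leI) auto
      moreover have "measure \<nu> {} \<le> measure \<nu> UNIV - \<epsilon> k"
        using \<open>\<forall>K. _\<close> by (metis compact_empty empty_subsetI)
      ultimately have "0 \<le> measure \<nu> UNIV - \<epsilon> k"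
        and "ennreal (measure \<nu> UNIV) \<le> ennreal (measure \<nu> UNIV - \<epsilon> k)"
        unfolding *[symmetric] by auto
      then have "measure \<nu> UNIV \<le> measure \<nu> UNIV - \<epsilon> k"
        by (simp only: ennreal_le_iff)
      then show False using \<epsilon>[of k] by simp
    qed
    then obtain K where K: "K \<subseteq> N" "compact K" "measure \<nu> UNIV - \<epsilon> k < measure \<nu> K" by blast
    have "measure \<nu> (- K) = measure \<nu> UNIV - measure \<nu> K"
      using \<nu>.finite_measure_compl[of K] K circle_borel_sets[OF \<nu>]
      by (simp add: sp compact_imp_closed Compl_eq_Diff_UNIV)
    then show ?thesis using K by (intro exI[of _ K]) auto
  qed
  then obtain K where K: "\<And>k. K k \<subseteq> N" "\<And>k. compact (K k)" "\<And>k. measure \<nu> (- K k) < \<epsilon> k" by metis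
  have Kb [measurable]: "K k \<in> sets borel" for k
    by (intro borel_closed compact_imp_closed K(2))
  define w1 where "w1 k = (indicator (K k) :: complex \<Rightarrow> real)" for k
  define w2 where "w2 k = (indicator (- K k) :: complex \<Rightarrow> real)" for k
  have int1: "integrable \<nu> (w1 k)" and int2: "integrable \<nu> (w2 k)" for k
    unfolding w1_def w2_def using circle_borel_sets[OF \<nu>] by (auto intro!: integrable_real_indicator simp: \<nu>.emeasure_eq_measure)
  have split: "S (\<lambda>_. 1) z = S (w1 k) z * S (w2 k) z" if "norm z < 1" for k z
  proof -
    have "herglotz_integral \<nu> (\<lambda>_. 1) z = (\<integral>\<xi>. herglotz_kernel z \<xi> * of_real (w1 k \<xi>) + herglotz_kernel z \<xi> * of_real (w2 k \<xi>) \<partial>\<nu>)"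
      unfolding herglotz_integral_def by (intro Bochner_Integration.integral_cong) (auto simp: w1_def w2_def indicator_def)
    also have "\<dots> = herglotz_integral \<nu> (w1 k) z + herglotz_integral \<nu> (w2 k) z"
      unfolding herglotz_integral_def
      by (intro Bochner_Integration.integral_add integrable_herglotz[OF \<nu>] integrable_of_real int1 int2 that)
    finally show ?thesis by (simp add: S_def flip: exp_add)
  qed
  have "\<exists>L. L \<in> sets borel \<and> emeasure circle_measure L \<le> ennreal ((1 / 2) ^ k) \<and>
      (\<forall>\<zeta> r. norm \<zeta> = 1 \<longrightarrow> \<zeta> \<notin> L \<longrightarrow> 0 \<le> r \<longrightarrow> r < 1 \<longrightarrow> Re (1 - S (w2 k) (of_real r * \<zeta>)) \<le> 1 / (real k + 1))" for k
  proof -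
    have h: "(\<lambda>z. 1 - S (w2 k) z) holomorphic_on ball 0 1"
      by (intro holomorphic_intros hol int2)
    have p: "0 \<le> Re (1 - S (w2 k) z)" if "norm z < 1" for z
      using complex_Re_le_cmod[of "S (w2 k) z"] le1[OF int2 _ that, of k] by (simp add: w2_def)
    obtain L where L: "L \<in> sets borel" "emeasure circle_measure L \<le> ennreal (640 * Re (1 - S (w2 k) 0) / (1 / (real k + 1)))"
      "\<And>\<zeta> r. norm \<zeta> = 1 \<Longrightarrow> \<zeta> \<notin> L \<Longrightarrow> 0 \<le> r \<Longrightarrow> r < 1 \<Longrightarrow> Re (1 - S (w2 k) (of_real r * \<zeta>)) \<le> 1 / (real k + 1)"
      using radial_weak_type[OF h p, of "1 / (real k + 1)"] by auto
    have "herglotz_integral \<nu> (w2 k) 0 = (\<integral>\<xi>. of_real (w2 k \<xi>) \<partial>\<nu>)"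
      unfolding herglotz_integral_def
    proof (rule integral_cong_AE)
      show "AE \<xi> in \<nu>. herglotz_kernel 0 \<xi> * of_real (w2 k \<xi>) = of_real (w2 k \<xi>)"
        using circle_borel_AE[OF \<nu>] by eventually_elim (auto simp: herglotz_kernel_def)
    qed (auto simp: w2_def)
    also have "\<dots> = of_real (measure \<nu> (- K k))"
    proof -
      have "(\<integral>\<xi>. w2 k \<xi> \<partial>\<nu>) = measure \<nu> (- K k)"
        unfolding w2_def using circle_borel_sets[OF \<nu>] Kb[of k] by (simp add: sp)
      then show ?thesis using int2[of k] by simp
    qed
    finally have "Re (1 - S (w2 k) 0) = 1 - exp (- measure \<nu> (- K k))"
      by (simp add: S_def exp_of_real flip: of_real_minus)
    also have "\<dots> \<le> measure \<nu> (- K k)"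
      using exp_ge_add_one_self[of "- measure \<nu> (- K k)"] by simp
    also have "\<dots> \<le> \<epsilon> k" using K(3)[of k] by simp
    finally have "640 * Re (1 - S (w2 k) 0) / (1 / (real k + 1)) \<le> 640 * \<epsilon> k / (1 / (real k + 1))"
      by (intro divide_right_mono mult_left_mono) auto
    also have "\<dots> = (1 / 2) ^ k"
    proof -
      have "640 * (p / (640 * c)) / (1 / c) = p" if "c \<noteq> 0" for p c :: real
        using that by simp
      from this[of "real k + 1" "(1 / 2) ^ k"] show ?thesis unfolding \<epsilon>_def by linarith
    qed
    finally have "emeasure circle_measure L \<le> ennreal ((1 / 2) ^ k)"
      using L(2) ennreal_leI order_trans by blast
    then show ?thesis using L by blast
  qed
  then obtain L where L: "\<And>k. L k \<in> sets borel" "\<And>k. emeasure circle_measure (L k) \<le> ennreal ((1 / 2) ^ k)"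
    "\<And>k \<zeta> r. norm \<zeta> = 1 \<Longrightarrow> \<zeta> \<notin> L k \<Longrightarrow> 0 \<le> r \<Longrightarrow> r < 1 \<Longrightarrow> Re (1 - S (w2 k) (of_real r * \<zeta>)) \<le> 1 / (real k + 1)"
    by metis
  have null: "(\<Inter>k\<in>{k0..}. L k) \<in> null_sets circle_measure" for k0
  proof (rule null_setsI)
    show "(\<Inter>k\<in>{k0..}. L k) \<in> sets circle_measure"
      using L(1) by (auto intro!: sets.countable_INT'')
    have "emeasure circle_measure (\<Inter>k\<in>{k0..}. L k) \<le> ennreal ((1 / 2) ^ k)" if "k \<ge> k0" for k
    proof -
      have "emeasure circle_measure (\<Inter>k\<in>{k0..}. L k) \<le> emeasure circle_measure (L k)"
        using that L(1) by (intro emeasure_mono) auto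
      then show ?thesis using L(2) by (rule order_trans)
    qed
    then have "\<forall>\<^sub>F k in sequentially. emeasure circle_measure (\<Inter>k\<in>{k0..}. L k) \<le> ennreal ((1 / 2) ^ k)"
      by (auto simp: eventually_sequentially)
    moreover have "(\<lambda>k. ennreal ((1 / 2) ^ k)) \<longlonglongrightarrow> ennreal 0"
      by (intro tendsto_ennrealI LIMSEQ_realpow_zero) auto
    ultimately have "emeasure circle_measure (\<Inter>k\<in>{k0..}. L k) \<le> ennreal 0"
      by (intro tendsto_lowerbound) auto
    then show "emeasure circle_measure (\<Inter>k\<in>{k0..}. L k) = 0" by simp
  qed
  have "AE \<zeta> in circle_measure. \<forall>k0. \<zeta> \<notin> (\<Inter>k\<in>{k0..}. L k)"
    using null by (intro AE_all_countable[THEN iffD2] allI AE_not_in)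
  moreover have "AE \<zeta> in circle_measure. \<zeta> \<notin> N"
    using N by (intro AE_not_in) auto
  ultimately have "AE \<zeta> in circle_measure. \<exists>v. norm v = 1 \<and> ((\<lambda>r. S (\<lambda>_. 1) (of_real r * \<zeta>)) \<longlongrightarrow> v) (at_left 1)"
    using AE_circle_measure
  proof eventually_elim
    case (elim \<zeta>)
    show ?case
    proof (rule unimodular_limit_of_approximations)
      fix e :: real assume e: "e > 0"
      obtain k0 :: nat where "inverse (real (Suc k0)) < e\<^sup>2 / 2"
        using reals_Archimedean[of "e\<^sup>2 / 2"] e by auto
      then have k0: "1 / (real k0 + 1) < e\<^sup>2 / 2" by (simp add: inverse_eq_divide add.commute)
      obtain k where k: "k \<ge> k0" "\<zeta> \<notin> L k" using elim(1) by auto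
      have "1 / (real k + 1) \<le> 1 / (real k0 + 1)" using k by (intro divide_left_mono) auto
      then have "2 * (1 / (real k + 1)) \<le> e\<^sup>2" using k0 by linarith
      then have ke: "2 / (real k + 1) \<le> e\<^sup>2" by simp
      obtain v where v: "norm v = 1" "((\<lambda>r. S (w1 k) (of_real r * \<zeta>)) \<longlongrightarrow> v) (at_left 1)"
        using herglotz_radial_limit_off_support[OF \<nu> int1, of "K k" k \<zeta>] K elim
        unfolding S_def by (auto simp: w1_def compact_imp_closed indicator_def split: if_splits)
      have "\<forall>\<^sub>F r in at_left (1::real). 0 < r \<and> r < 1"
        by (auto simp: eventually_at_left_field intro!: exI[of _ 0])
      then have "\<forall>\<^sub>F r in at_left 1. norm (S (\<lambda>_. 1) (of_real r * \<zeta>) - S (w1 k) (of_real r * \<zeta>)) \<le> e"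
      proof eventually_elim
        case (elim r)
        define z where "z = of_real r * \<zeta>"
        have z: "norm z < 1" using elim \<open>norm \<zeta> = 1\<close> by (simp add: z_def norm_mult)
        have a: "norm (S (w1 k) z) \<le> 1" by (rule le1[OF int1 _ z]) (simp add: w1_def)
        have b: "norm (S (w2 k) z) \<le> 1" by (rule le1[OF int2 _ z]) (simp add: w2_def)
        \<comment> \<open>For numbers of modulus at most \<open>1\<close>, closeness to \<open>1\<close> is controlled by the real part alone.\<close>
        have "(norm (1 - S (w2 k) z))\<^sup>2 = 1 - 2 * Re (S (w2 k) z) + (norm (S (w2 k) z))\<^sup>2"
          unfolding cmod_power2 by (simp add: power2_eq_square algebra_simps)
        also have "\<dots> \<le> 2 * Re (1 - S (w2 k) z)"
          using b power_le_one[OF norm_ge_zero b, of 2] by simp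
        also have "\<dots> \<le> 2 * (1 / (real k + 1))"
          using L(3)[of \<zeta> k r] k elim \<open>norm \<zeta> = 1\<close> unfolding z_def by (intro mult_left_mono) auto
        also have "\<dots> \<le> e\<^sup>2" using ke by simp
        finally have c: "norm (1 - S (w2 k) z) \<le> e" using e by (simp add: power2_le_iff_abs_le)
        have "S (\<lambda>_. 1) z - S (w1 k) z = - (S (w1 k) z * (1 - S (w2 k) z))"
          using split[OF z, of k] by (simp add: algebra_simps)
        then have "norm (S (\<lambda>_. 1) z - S (w1 k) z) = norm (S (w1 k) z) * norm (1 - S (w2 k) z)"
          by (simp add: norm_mult)
        also have "\<dots> \<le> 1 * e" using a c by (intro mult_mono) auto
        finally show ?case by (simp add: z_def)
      qed
      then show "\<exists>g w. norm w = 1 \<and> (g \<longlongrightarrow> w) (at_left 1) \<and>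
          (\<forall>\<^sub>F r in at_left 1. norm (S (\<lambda>_. 1) (of_real r * \<zeta>) - g r) \<le> e)"
        using v by blast
    qed simp
  qed
  then have "inner_function (S (\<lambda>_. 1))"
    unfolding inner_function_def using hol[of "\<lambda>_. 1"] le1[of "\<lambda>_. 1"] by auto
  then show ?thesis by (simp add: S_def[abs_def])
qed

section \<open>Functions whose derivative has bounded means\<close>

lemma norm_cis_diff_mono:
  assumes "\<bar>s - t\<bar> \<le> \<bar>s' - t'\<bar>" "\<bar>s' - t'\<bar> \<le> pi"
  shows "norm (cis s - cis t) \<le> norm (cis s' - cis t')"
proof -
  have *: "norm (cis x - cis y) = 2 * sin (\<bar>x - y\<bar> / 2)" if "\<bar>x - y\<bar> \<le> pi" for x y
  proof -
    have "\<bar>sin ((x - y) / 2)\<bar> = \<bar>sin (\<bar>x - y\<bar> / 2)\<bar>"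
    proof (cases "x \<ge> y")
      case False
      then have "\<bar>x - y\<bar> / 2 = - ((x - y) / 2)" by argo
      then show ?thesis by (simp only: sin_minus abs_minus_cancel)
    qed simp
    moreover have "0 \<le> sin (\<bar>x - y\<bar> / 2)" using that by (intro sin_ge_zero) auto
    ultimately show ?thesis by (simp add: norm_cis_diff)
  qed
  have "sin (\<bar>s - t\<bar> / 2) \<le> sin (\<bar>s' - t'\<bar> / 2)"
    using assms by (intro sin_monotone_2pi_le) auto
  then show ?thesis using assms by (simp add: *)
qed

lemma norm_arc_increment_le:
  assumes g: "g holomorphic_on ball 0 1" and r: "0 \<le> r" "r < 1" and ab: "a \<le> b"
  shows "ennreal (norm (g (of_real r * cis b) - g (of_real r * cis a))) \<le>
    (\<integral>\<^sup>+t. ennreal (norm (deriv g (of_real r * cis t))) * indicator {a..b} t \<partial>lborel)"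
proof -
  have nr: "norm (of_real r * cis t) < 1" for t using r by (simp add: norm_mult)
  define f where "f t = deriv g (of_real r * cis t) * (of_real r * (\<i> * cis t))" for t
  have der: "((\<lambda>t. g (of_real r * cis t)) has_vector_derivative f t) (at t within A)" for t A
  proof -
    have "(g has_field_derivative deriv g (of_real r * cis t)) (at (of_real r * exp (\<i> * of_real t)))"
      using holomorphic_derivI[OF g, of "of_real r * cis t"] nr by (simp add: cis_conv_exp)
    then have "((\<lambda>z. g (of_real r * exp (\<i> * z))) has_field_derivative
        deriv g (of_real r * cis t) * (of_real r * (\<i> * exp (\<i> * of_real t)))) (at (of_real t))"
      by (rule DERIV_chain2) (auto intro!: derivative_eq_intros)
    from has_vector_derivative_real_field[OF this] show ?thesis
      by (simp add: f_def cis_conv_exp)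
  qed
  have cont: "continuous_on {a..b} f"
  proof -
    have "continuous_on {a..b} (\<lambda>t. deriv g (of_real r * cis t))"
    proof (rule continuous_on_compose2[OF holomorphic_on_imp_continuous_on[OF holomorphic_deriv[OF g]]])
      show "(\<lambda>t. of_real r * cis t) ` {a..b} \<subseteq> ball 0 1" using nr by auto
    qed (auto intro!: continuous_intros)
    then show ?thesis unfolding f_def by (intro continuous_intros)
  qed
  have FTC: "has_bochner_integral lborel (\<lambda>t. indicator {a..b} t *\<^sub>R f t)
      (g (of_real r * cis b) - g (of_real r * cis a))"
    by (rule has_bochner_integral_FTC_Icc[OF ab der cont])
  then have "ennreal (norm (g (of_real r * cis b) - g (of_real r * cis a)))
      \<le> (\<integral>\<^sup>+t. ennreal (norm (indicator {a..b} t *\<^sub>R f t)) \<partial>lborel)"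
    using integral_norm_bound_ennreal[OF integrable.intros[OF FTC]]
    by (simp add: has_bochner_integral_integral_eq[OF FTC])
  also have "\<dots> \<le> (\<integral>\<^sup>+t. ennreal (norm (deriv g (of_real r * cis t))) * indicator {a..b} t \<partial>lborel)"
  proof (rule nn_integral_mono)
    fix t
    have "norm (f t) \<le> norm (deriv g (of_real r * cis t))"
      using r by (simp add: f_def norm_mult mult_left_le)
    then show "ennreal (norm (indicator {a..b} t *\<^sub>R f t)) \<le> ennreal (norm (deriv g (of_real r * cis t))) * indicator {a..b} t"
      by (auto split: split_indicator intro!: ennreal_leI)
  qed
  finally show ?thesis .
qed

text \<open>
  Integrate the derivative along the shorter of the two arcs between the points: all points of this arc are at
  most as far from \<open>\<zeta>\<close> as \<open>\<zeta>'\<close> is.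
\<close>

lemma norm_increment_le_local_integral:
  assumes g: "g holomorphic_on ball 0 1" and r: "0 \<le> r" "r < 1"
    and \<zeta>: "norm \<zeta> = 1" "norm \<zeta>' = 1" "norm (\<zeta> - \<zeta>') < s"
  shows "ennreal (norm (g (of_real r * \<zeta>) - g (of_real r * \<zeta>'))) \<le>
    ennreal (2 * pi) * (\<integral>\<^sup>+\<xi>. ennreal (norm (deriv g (of_real r * \<xi>))) * indicator (ball \<zeta> s) \<xi> \<partial>circle_measure)"
proof -
  obtain a where a: "0 \<le> a" "a < 2 * pi" "\<zeta> = cis a"
    using \<zeta>(1) by (metis Arg2pi_ge_0 Arg2pi_lt_2pi complex_norm_eq_1_exp cis_conv_exp)
  obtain b where b: "0 \<le> b" "b < 2 * pi" "\<zeta>' = cis b"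
    using \<zeta>(2) by (metis Arg2pi_ge_0 Arg2pi_lt_2pi complex_norm_eq_1_exp cis_conv_exp)
  define p where "p = min a b"
  define q where "q = max a b"
  have pq: "0 \<le> p" "p \<le> q" "q < 2 * pi" using a b by (auto simp: p_def q_def)
  have apq: "a = p \<or> a = q" by (auto simp: p_def q_def)
  define d where "d z = (if norm z < 1 then deriv g z else 0)" for z
  have [measurable]: "d \<in> borel_measurable borel"
    using measurable_on_disk[OF holomorphic_deriv[OF g]] by (simp add: d_def[abs_def])
  have nr: "norm (of_real r * \<xi>) < 1" if "norm \<xi> = 1" for \<xi> :: complex
    using r that by (simp add: norm_mult)
  define F where "F t = ennreal (norm (d (of_real r * cis t)))" for t
  have [measurable]: "F \<in> borel_measurable borel" unfolding F_def by measurable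
  have FD: "F t = ennreal (norm (deriv g (of_real r * cis t)))" for t
    by (simp add: F_def d_def nr)
  have incr: "ennreal (norm (g (of_real r * cis y) - g (of_real r * cis x))) \<le> (\<integral>\<^sup>+t. F t * indicator {x..y} t \<partial>lborel)"
    if "x \<le> y" for x y
    unfolding FD by (rule norm_arc_increment_le[OF g r that])
  have pq_eq: "norm (cis p - cis q) < s"
    using \<zeta>(3) by (auto simp: a b p_def q_def min_def max_def norm_minus_commute)
  have "ennreal (norm (g (of_real r * \<zeta>) - g (of_real r * \<zeta>')))
      = ennreal (norm (g (of_real r * cis q) - g (of_real r * cis p)))"
    by (auto simp: a b p_def q_def min_def max_def norm_minus_commute)
  also have "\<dots> \<le> (\<integral>\<^sup>+t. F t * indicator (ball \<zeta> s) (cis t) * indicator {0..<2 * pi} t \<partial>lborel)"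
  proof (cases "q - p \<le> pi")
    case True
    have "cis t \<in> ball \<zeta> s" if "p \<le> t" "t \<le> q" for t
    proof -
      have "norm (cis a - cis t) \<le> norm (cis p - cis q)"
        using that True apq by (intro norm_cis_diff_mono) auto
      then show ?thesis using pq_eq by (simp add: a(3) dist_norm)
    qed
    then have "(\<integral>\<^sup>+t. F t * indicator {p..q} t \<partial>lborel)
        \<le> (\<integral>\<^sup>+t. F t * indicator (ball \<zeta> s) (cis t) * indicator {0..<2 * pi} t \<partial>lborel)"
      using pq by (intro nn_integral_mono) (auto split: split_indicator)
    then show ?thesis using incr[OF pq(2)] by (rule order_trans[rotated])
  next
    case False
    \<comment> \<open>The shorter arc passes through \<open>1\<close>: it consists of the parameters in \<open>[q, 2\<pi>]\<close> and in \<open>[0, p]\<close>.\<close>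
    have per: "cis (x - 2 * pi) = cis x" for x
      using cos_periodic[of "x - 2 * pi"] sin_periodic[of "x - 2 * pi"] by (simp add: complex_eq_iff)
    have "norm (cis p - cis (q - 2 * pi)) < s" using pq_eq by (simp add: per)
    moreover have "norm (cis x - cis y) \<le> norm (cis p - cis (q - 2 * pi))"
      if "\<bar>x - y\<bar> \<le> p + 2 * pi - q" for x y
      using that False pq by (intro norm_cis_diff_mono) auto
    ultimately have near: "norm (cis x - cis y) < s" if "\<bar>x - y\<bar> \<le> p + 2 * pi - q" for x y
      using that le_less_trans by blast
    have in1: "cis t \<in> ball \<zeta> s" if "0 \<le> t" "t \<le> p" for t
    proof (cases "a = p")
      case True
      then show ?thesis using near[of a t] that pq by (simp add: a(3) dist_norm)
    next
      case False
      then show ?thesis using near[of "a - 2 * pi" t] apq that pq by (simp add: a(3) dist_norm per)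
    qed
    have in2: "cis t \<in> ball \<zeta> s" if "q \<le> t" "t \<le> 2 * pi" for t
    proof (cases "a = q")
      case True
      then show ?thesis using near[of a t] that pq by (simp add: a(3) dist_norm)
    next
      case False
      then show ?thesis using near[of a "t - 2 * pi"] apq that pq by (simp add: a(3) dist_norm per)
    qed
    have eq: "cis 0 = cis (2 * pi)" by (simp add: complex_eq_iff)
    have "norm (g (of_real r * cis q) - g (of_real r * cis p))
        \<le> norm (g (of_real r * cis (2 * pi)) - g (of_real r * cis q)) + norm (g (of_real r * cis p) - g (of_real r * cis 0))"
      using norm_triangle_ineq4[of "g (of_real r * cis (2 * pi)) - g (of_real r * cis p)" "g (of_real r * cis (2 * pi)) - g (of_real r * cis q)"]
      unfolding eq by (simp add: norm_minus_commute algebra_simps)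
    then have "ennreal (norm (g (of_real r * cis q) - g (of_real r * cis p)))
        \<le> ennreal (norm (g (of_real r * cis (2 * pi)) - g (of_real r * cis q))) + ennreal (norm (g (of_real r * cis p) - g (of_real r * cis 0)))"
      by (simp add: ennreal_leI flip: ennreal_plus)
    also have "\<dots> \<le> (\<integral>\<^sup>+t. F t * indicator {q..2 * pi} t \<partial>lborel) + (\<integral>\<^sup>+t. F t * indicator {0..p} t \<partial>lborel)"
      using pq by (intro add_mono incr) auto
    also have "\<dots> = (\<integral>\<^sup>+t. F t * indicator {q..2 * pi} t + F t * indicator {0..p} t \<partial>lborel)"
      by (rule nn_integral_add[symmetric]) auto
    also have "\<dots> \<le> (\<integral>\<^sup>+t. F t * indicator (ball \<zeta> s) (cis t) * indicator {0..<2 * pi} t \<partial>lborel)"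
    proof (rule nn_integral_mono_AE)
      have "AE t in lborel. t \<noteq> 2 * pi" by (rule AE_lborel_singleton)
      then show "AE t in lborel. F t * indicator {q..2 * pi} t + F t * indicator {0..p} t
          \<le> F t * indicator (ball \<zeta> s) (cis t) * indicator {0..<2 * pi} t"
        by eventually_elim (use in1 in2 pq False in \<open>auto split: split_indicator\<close>)
    qed
    finally show ?thesis .
  qed
  also have "\<dots> = ennreal (2 * pi) * ((\<integral>\<^sup>+t. F t * indicator (ball \<zeta> s) (cis t) * indicator {0..<2 * pi} t \<partial>lborel) / ennreal (2 * pi))"
    by (simp add: ennreal_times_divide mult.commute[of "ennreal (2 * pi)"] mult_divide_eq_ennreal)
  also have "(\<integral>\<^sup>+t. F t * indicator (ball \<zeta> s) (cis t) * indicator {0..<2 * pi} t \<partial>lborel) / ennreal (2 * pi)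
      = (\<integral>\<^sup>+\<xi>. ennreal (norm (d (of_real r * \<xi>))) * indicator (ball \<zeta> s) \<xi> \<partial>circle_measure)"
  proof -
    have [measurable]: "(indicator (ball \<zeta> s) :: complex \<Rightarrow> ennreal) \<in> borel_measurable borel"
      by (intro borel_measurable_indicator) simp
    show ?thesis unfolding F_def by (subst nn_integral_circle_measure) auto
  qed
  also have "\<dots> = (\<integral>\<^sup>+\<xi>. ennreal (norm (deriv g (of_real r * \<xi>))) * indicator (ball \<zeta> s) \<xi> \<partial>circle_measure)"
  proof (rule nn_integral_cong_AE)
    show "AE \<xi> in circle_measure. ennreal (norm (d (of_real r * \<xi>))) * indicator (ball \<zeta> s) \<xi>
        = ennreal (norm (deriv g (of_real r * \<xi>))) * indicator (ball \<zeta> s) \<xi>"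
      using AE_circle_measure by eventually_elim (simp add: d_def nr)
  qed
  finally show ?thesis .
qed

text \<open>
  The growth condition of the Hardy space without holomorphy, so that it passes to everything that is
  dominated by functions which satisfy it.
\<close>

definition mean_bounded :: "(complex \<Rightarrow> complex) \<Rightarrow> bool" where
  "mean_bounded G \<longleftrightarrow> (\<exists>C\<ge>0. \<forall>r\<in>{0..<1}. (\<integral>\<^sup>+\<xi>. ennreal (norm (G (of_real r * \<xi>))) \<partial>circle_measure) \<le> ennreal C)"

lemma hardy1_imp_mean_bounded:
  assumes "hardy1 G"
  shows "mean_bounded G"
proof -
  define s where "s = (SUP r\<in>{0..<1::real}. \<integral>\<^sup>+ \<zeta>. ennreal (norm (G (of_real r * \<zeta>))) \<partial>circle_measure)"
  have "s < \<infinity>" using assms by (simp add: hardy1_def s_def)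
  then have "s = ennreal (enn2real s)" by (simp add: less_top)
  moreover have "(\<integral>\<^sup>+ \<zeta>. ennreal (norm (G (of_real r * \<zeta>))) \<partial>circle_measure) \<le> s" if "r \<in> {0..<1}" for r
    unfolding s_def using that by (rule SUP_upper)
  ultimately show ?thesis unfolding mean_bounded_def by (intro exI[of _ "enn2real s"]) auto
qed

lemma bounded_imp_mean_bounded:
  assumes "\<And>z. norm z < 1 \<Longrightarrow> norm (G z) \<le> B"
  shows "mean_bounded G"
  unfolding mean_bounded_def
proof (intro exI conjI ballI)
  show "0 \<le> max B 0" by simp
  fix r :: real assume r: "r \<in> {0..<1}"
  have "(\<integral>\<^sup>+\<xi>. ennreal (norm (G (of_real r * \<xi>))) \<partial>circle_measure) \<le> (\<integral>\<^sup>+\<xi>. ennreal (max B 0) \<partial>circle_measure)"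
  proof (rule nn_integral_mono_AE)
    show "AE \<xi> in circle_measure. ennreal (norm (G (of_real r * \<xi>))) \<le> ennreal (max B 0)"
      using AE_circle_measure
    proof eventually_elim
      case (elim \<xi>)
      then have "norm (G (of_real r * \<xi>)) \<le> B" using r by (intro assms) (simp add: norm_mult)
      then show ?case by (intro ennreal_leI) auto
    qed
  qed
  then show "(\<integral>\<^sup>+\<xi>. ennreal (norm (G (of_real r * \<xi>))) \<partial>circle_measure) \<le> ennreal (max B 0)" by simp
qed

text \<open>
  The oscillation of \<open>g\<close> on a circle is bounded by the integral of \<open>|g'|\<close> over it, and by the maximum
  principle \<open>g 0\<close> is no farther than this oscillation from a value on the circle.
\<close>

lemma bounded_if_deriv_mean_bounded:
  assumes g: "g holomorphic_on ball 0 1" and mb: "mean_bounded (deriv g)"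
  obtains B where "\<And>z. norm z < 1 \<Longrightarrow> norm (g z) \<le> B"
proof -
  obtain C where C: "C \<ge> 0"
    "\<And>r. r \<in> {0..<1} \<Longrightarrow> (\<integral>\<^sup>+\<xi>. ennreal (norm (deriv g (of_real r * \<xi>))) \<partial>circle_measure) \<le> ennreal C"
    using mb by (auto simp: mean_bounded_def)
  have osc: "norm (g (of_real r * \<zeta>) - g (of_real r * \<zeta>')) \<le> 2 * pi * C"
    if r: "0 \<le> r" "r < 1" and \<zeta>: "norm \<zeta> = 1" "norm \<zeta>' = 1" for r \<zeta> \<zeta>'
  proof -
    have "norm (\<zeta> - \<zeta>') < 3" using norm_triangle_ineq4[of \<zeta> \<zeta>'] \<zeta> by simp
    from norm_increment_le_local_integral[OF g r \<zeta> this]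
    have "ennreal (norm (g (of_real r * \<zeta>) - g (of_real r * \<zeta>')))
        \<le> ennreal (2 * pi) * (\<integral>\<^sup>+\<xi>. ennreal (norm (deriv g (of_real r * \<xi>))) * indicator (ball \<zeta> 3) \<xi> \<partial>circle_measure)" .
    also have "\<dots> \<le> ennreal (2 * pi) * (\<integral>\<^sup>+\<xi>. ennreal (norm (deriv g (of_real r * \<xi>))) \<partial>circle_measure)"
      by (intro mult_left_mono nn_integral_mono) (auto split: split_indicator)
    also have "\<dots> \<le> ennreal (2 * pi) * ennreal C"
      using r by (intro mult_left_mono C) auto
    also have "\<dots> = ennreal (2 * pi * C)" using C by (subst ennreal_mult) auto
    finally show ?thesis using C by (simp add: ennreal_le_iff)
  qed
  have center: "norm (g 0 - g (of_real r)) \<le> 2 * pi * C" if r: "0 < r" "r < 1" for r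
  proof (rule maximum_modulus_frontier[of "\<lambda>z. g z - g (of_real r)" "cball 0 r"])
    have sub: "cball 0 r \<subseteq> ball (0::complex) 1" using r by auto
    have h: "(\<lambda>z. g z - g (of_real r)) holomorphic_on ball 0 1" by (intro holomorphic_intros g)
    show "(\<lambda>z. g z - g (of_real r)) holomorphic_on interior (cball 0 r)"
      using h sub by (metis holomorphic_on_subset interior_subset subset_trans)
    show "continuous_on (closure (cball 0 r)) (\<lambda>z. g z - g (of_real r))"
      using continuous_on_subset[OF holomorphic_on_imp_continuous_on[OF h] sub] by simp
    show "norm (g z - g (of_real r)) \<le> 2 * pi * C" if "z \<in> frontier (cball 0 r)" for z
      using osc[of r "z / of_real r" 1] that r by (simp add: norm_divide)
  qed (use r in auto)
  show thesis
  proof (rule that)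
    fix z :: complex assume z: "norm z < 1"
    show "norm (g z) \<le> norm (g 0) + 4 * pi * C"
    proof (cases "z = 0")
      case False
      define r where "r = norm z"
      have r: "0 < r" "r < 1" using z False by (auto simp: r_def)
      have "norm (g z - g (of_real r)) \<le> 2 * pi * C"
        using osc[of r "z / of_real r" 1] r False by (simp add: norm_divide r_def)
      moreover have "norm (g z) \<le> norm (g 0) + (norm (g z - g (of_real r)) + norm (g 0 - g (of_real r)))"
        using norm_triangle_ineq[of "g 0" "g z - g 0"] norm_triangle_ineq4[of "g z - g (of_real r)" "g 0 - g (of_real r)"]
        by simp
      ultimately show ?thesis using center[OF r] by simp
    qed (use C in auto)
  qed
qed

section \<open>Uniformly integrable majorants of Poisson integrals\<close>

lemma ennreal_poisson_integral:
  assumes "circle_borel \<mu>" "integrable \<mu> w" "\<And>\<xi>. 0 \<le> w \<xi>" "norm z < 1"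
  shows "ennreal (poisson_integral \<mu> w z) = (\<integral>\<^sup>+\<xi>. ennreal (poisson_kernel z \<xi> * w \<xi>) \<partial>\<mu>)"
  unfolding poisson_integral_def using assms poisson_kernel_nonneg[OF assms(4)]
  by (intro nn_integral_eq_integral[symmetric] integrable_poisson) auto

lemma poisson_integral_nonneg:
  assumes "\<And>\<xi>. 0 \<le> w \<xi>" "norm z < 1"
  shows "0 \<le> poisson_integral \<mu> w z"
  unfolding poisson_integral_def using assms poisson_kernel_nonneg[OF assms(2)]
  by (intro integral_nonneg_AE) auto

lemma nn_integral_poisson_radial:
  assumes "norm \<xi> = 1" "0 \<le> r" "r < 1"
  shows "(\<integral>\<^sup>+\<zeta>. ennreal (poisson_kernel (of_real r * \<zeta>) \<xi>) \<partial>circle_measure) = 1"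
proof -
  have "(\<integral>\<^sup>+\<zeta>. ennreal (poisson_kernel (of_real r * \<zeta>) \<xi>) \<partial>circle_measure)
      = (\<integral>\<^sup>+\<zeta>. ennreal (poisson_kernel (of_real r * \<xi>) \<zeta>) \<partial>circle_measure)"
  proof (rule nn_integral_cong_AE)
    show "AE \<zeta> in circle_measure. ennreal (poisson_kernel (of_real r * \<zeta>) \<xi>) = ennreal (poisson_kernel (of_real r * \<xi>) \<zeta>)"
      using AE_circle_measure by eventually_elim (use assms poisson_kernel_commute in auto)
  qed
  also have "\<dots> = 1"
    using assms by (intro nn_integral_poisson_circle) (simp add: norm_mult)
  finally show ?thesis .
qed

text \<open>
  Poisson integration is symmetric with respect to the two measures.
\<close>

lemma nn_integral_poisson_swap:
  assumes \<mu>: "circle_borel \<mu>" and [measurable]: "u \<in> borel_measurable borel" "v \<in> borel_measurable borel"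
  shows "(\<integral>\<^sup>+\<zeta>. u \<zeta> * (\<integral>\<^sup>+\<xi>. ennreal (poisson_kernel (of_real r * \<zeta>) \<xi>) * v \<xi> \<partial>\<mu>) \<partial>circle_measure)
    = (\<integral>\<^sup>+\<xi>. v \<xi> * (\<integral>\<^sup>+\<zeta>. ennreal (poisson_kernel (of_real r * \<zeta>) \<xi>) * u \<zeta> \<partial>circle_measure) \<partial>\<mu>)"
proof -
  note [measurable_cong] = circle_borel_sets[OF \<mu>]
  interpret \<mu>: finite_measure \<mu> by (rule circle_borel_finite[OF \<mu>])
  interpret P: pair_sigma_finite circle_measure \<mu> ..
  have [measurable]: "(\<lambda>x. poisson_kernel (of_real r * fst x) (snd x)) \<in> borel_measurable (circle_measure \<Otimes>\<^sub>M \<mu>)"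
    unfolding poisson_kernel_def by measurable
  have "(\<integral>\<^sup>+\<zeta>. u \<zeta> * (\<integral>\<^sup>+\<xi>. ennreal (poisson_kernel (of_real r * \<zeta>) \<xi>) * v \<xi> \<partial>\<mu>) \<partial>circle_measure)
      = (\<integral>\<^sup>+\<zeta>. (\<integral>\<^sup>+\<xi>. u \<zeta> * (ennreal (poisson_kernel (of_real r * \<zeta>) \<xi>) * v \<xi>) \<partial>\<mu>) \<partial>circle_measure)"
    by (intro nn_integral_cong nn_integral_cmult[symmetric]) measurable
  also have "\<dots> = (\<integral>\<^sup>+\<xi>. (\<integral>\<^sup>+\<zeta>. u \<zeta> * (ennreal (poisson_kernel (of_real r * \<zeta>) \<xi>) * v \<xi>) \<partial>circle_measure) \<partial>\<mu>)"
    by (rule P.Fubini'[symmetric]) (simp add: case_prod_beta', measurable)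
  also have "\<dots> = (\<integral>\<^sup>+\<xi>. (\<integral>\<^sup>+\<zeta>. v \<xi> * (ennreal (poisson_kernel (of_real r * \<zeta>) \<xi>) * u \<zeta>) \<partial>circle_measure) \<partial>\<mu>)"
    by (intro nn_integral_cong) (simp add: mult_ac)
  also have "\<dots> = (\<integral>\<^sup>+\<xi>. v \<xi> * (\<integral>\<^sup>+\<zeta>. ennreal (poisson_kernel (of_real r * \<zeta>) \<xi>) * u \<zeta> \<partial>circle_measure) \<partial>\<mu>)"
  proof (intro nn_integral_cong nn_integral_cmult)
    fix \<xi> show "(\<lambda>\<zeta>. ennreal (poisson_kernel (of_real r * \<zeta>) \<xi>) * u \<zeta>) \<in> borel_measurable circle_measure"
      unfolding poisson_kernel_def by measurable
  qed
  finally show ?thesis .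
qed

text \<open>
  Uniform integrability of the family \<open>q r\<close>, \<open>0 \<le> r < 1\<close>. Only the positive parts matter:
  \<^const>\<open>ennreal\<close> maps negative numbers to \<open>0\<close>.
\<close>

definition radially_uniformly_integrable :: "(real \<Rightarrow> complex \<Rightarrow> real) \<Rightarrow> bool" where
  "radially_uniformly_integrable q \<longleftrightarrow> (\<forall>r\<in>{0..<1}. q r \<in> borel_measurable borel) \<and>
     (\<forall>\<epsilon>>0. \<exists>M\<ge>0. \<forall>r\<in>{0..<1}. (\<integral>\<^sup>+\<zeta>. ennreal (q r \<zeta> - M) \<partial>circle_measure) \<le> ennreal \<epsilon>)"

lemma radially_uniformly_integrable_const:
  "radially_uniformly_integrable (\<lambda>r \<zeta>. c)"
  unfolding radially_uniformly_integrable_def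
  by (auto intro!: exI[of _ "max c 0"] simp: ennreal_neg)

lemma radially_uniformly_integrable_add:
  assumes "radially_uniformly_integrable p" "radially_uniformly_integrable q"
  shows "radially_uniformly_integrable (\<lambda>r \<zeta>. p r \<zeta> + q r \<zeta>)"
  unfolding radially_uniformly_integrable_def
proof (intro conjI allI impI ballI)
  fix r :: real assume "r \<in> {0..<1}"
  then show "(\<lambda>\<zeta>. p r \<zeta> + q r \<zeta>) \<in> borel_measurable borel"
    using assms unfolding radially_uniformly_integrable_def by (intro borel_measurable_add) auto
next
  fix \<epsilon> :: real assume \<epsilon>: "\<epsilon> > 0"
  obtain M where M: "M \<ge> 0" "\<And>r. r \<in> {0..<1} \<Longrightarrow> (\<integral>\<^sup>+\<zeta>. ennreal (p r \<zeta> - M) \<partial>circle_measure) \<le> ennreal (\<epsilon> / 2)"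
    using assms(1) \<epsilon> unfolding radially_uniformly_integrable_def by (meson half_gt_zero)
  obtain M' where M': "M' \<ge> 0" "\<And>r. r \<in> {0..<1} \<Longrightarrow> (\<integral>\<^sup>+\<zeta>. ennreal (q r \<zeta> - M') \<partial>circle_measure) \<le> ennreal (\<epsilon> / 2)"
    using assms(2) \<epsilon> unfolding radially_uniformly_integrable_def by (meson half_gt_zero)
  show "\<exists>M\<ge>0. \<forall>r\<in>{0..<1}. (\<integral>\<^sup>+\<zeta>. ennreal (p r \<zeta> + q r \<zeta> - M) \<partial>circle_measure) \<le> ennreal \<epsilon>"
  proof (intro exI[of _ "M + M'"] conjI ballI)
    fix r :: real assume r: "r \<in> {0..<1}"
    then have [measurable]: "p r \<in> borel_measurable borel" "q r \<in> borel_measurable borel"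
      using assms unfolding radially_uniformly_integrable_def by auto
    have "(\<integral>\<^sup>+\<zeta>. ennreal (p r \<zeta> + q r \<zeta> - (M + M')) \<partial>circle_measure)
        \<le> (\<integral>\<^sup>+\<zeta>. ennreal (p r \<zeta> - M) + ennreal (q r \<zeta> - M') \<partial>circle_measure)"
    proof (rule nn_integral_mono)
      fix \<zeta>
      from ennreal_add_le[of "p r \<zeta> - M" "q r \<zeta> - M'"]
      show "ennreal (p r \<zeta> + q r \<zeta> - (M + M')) \<le> ennreal (p r \<zeta> - M) + ennreal (q r \<zeta> - M')"
        by (simp add: algebra_simps)
    qed
    also have "\<dots> = (\<integral>\<^sup>+\<zeta>. ennreal (p r \<zeta> - M) \<partial>circle_measure) + (\<integral>\<^sup>+\<zeta>. ennreal (q r \<zeta> - M') \<partial>circle_measure)"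
      by (rule nn_integral_add) auto
    also have "\<dots> \<le> ennreal (\<epsilon> / 2) + ennreal (\<epsilon> / 2)"
      by (intro add_mono M M' r)
    also have "\<dots> = ennreal \<epsilon>" using \<epsilon> by (simp flip: ennreal_plus)
    finally show "(\<integral>\<^sup>+\<zeta>. ennreal (p r \<zeta> + q r \<zeta> - (M + M')) \<partial>circle_measure) \<le> ennreal \<epsilon>" .
  qed (use M M' in auto)
qed

lemma tail_integral_small:
  fixes h :: "complex \<Rightarrow> real"
  assumes h: "integrable circle_measure h" and \<epsilon>: "\<epsilon> > 0"
  obtains M where "M \<ge> 0" "(\<integral>\<^sup>+\<zeta>. ennreal (h \<zeta> - M) \<partial>circle_measure) \<le> ennreal \<epsilon>"
proof -
  have [measurable]: "h \<in> borel_measurable circle_measure" using h by auto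
  have "(\<lambda>n. \<integral>\<zeta>. max 0 (h \<zeta> - real n) \<partial>circle_measure) \<longlonglongrightarrow> (\<integral>\<zeta>. 0 \<partial>circle_measure)"
  proof (rule integral_dominated_convergence[where w = "\<lambda>\<zeta>. \<bar>h \<zeta>\<bar>"])
    show "AE \<zeta> in circle_measure. (\<lambda>n. max 0 (h \<zeta> - real n)) \<longlonglongrightarrow> 0"
    proof (intro AE_I2 tendsto_eventually)
      fix \<zeta> obtain N :: nat where "h \<zeta> \<le> real N" using real_arch_simple by blast
      then show "\<forall>\<^sub>F n in sequentially. max 0 (h \<zeta> - real n) = 0"
        by (intro eventually_sequentiallyI[of N]) auto
    qed
    show "AE \<zeta> in circle_measure. norm (max 0 (h \<zeta> - real n)) \<le> \<bar>h \<zeta>\<bar>" for n by auto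
  qed (use h in auto)
  then have "\<forall>\<^sub>F n in sequentially. (\<integral>\<zeta>. max 0 (h \<zeta> - real n) \<partial>circle_measure) < \<epsilon>"
    using \<epsilon> by (intro order_tendstoD) auto
  then obtain n where n: "(\<integral>\<zeta>. max 0 (h \<zeta> - real n) \<partial>circle_measure) < \<epsilon>"
    by (auto simp: eventually_sequentially)
  have "(\<integral>\<^sup>+\<zeta>. ennreal (h \<zeta> - real n) \<partial>circle_measure) = (\<integral>\<^sup>+\<zeta>. ennreal (max 0 (h \<zeta> - real n)) \<partial>circle_measure)"
    by (intro nn_integral_cong) (auto simp: max_def ennreal_neg)
  also have "\<dots> = ennreal (\<integral>\<zeta>. max 0 (h \<zeta> - real n) \<partial>circle_measure)"
    using h by (intro nn_integral_eq_integral) auto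
  also have "\<dots> \<le> ennreal \<epsilon>" using n by (intro ennreal_leI) auto
  finally show thesis by (intro that[of "real n"]) auto
qed

lemma radially_uniformly_integrable_dominated:
  assumes "\<And>r. r \<in> {0..<1} \<Longrightarrow> q r \<in> borel_measurable borel" "integrable circle_measure h"
    and "\<And>r. r \<in> {0..<1} \<Longrightarrow> AE \<zeta> in circle_measure. q r \<zeta> \<le> h \<zeta>"
  shows "radially_uniformly_integrable q"
  unfolding radially_uniformly_integrable_def
proof (intro conjI allI impI ballI assms(1))
  fix \<epsilon> :: real assume "\<epsilon> > 0"
  from tail_integral_small[OF assms(2) this] obtain M
    where M: "M \<ge> 0" "(\<integral>\<^sup>+\<zeta>. ennreal (h \<zeta> - M) \<partial>circle_measure) \<le> ennreal \<epsilon>" by blast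
  show "\<exists>M\<ge>0. \<forall>r\<in>{0..<1}. (\<integral>\<^sup>+\<zeta>. ennreal (q r \<zeta> - M) \<partial>circle_measure) \<le> ennreal \<epsilon>"
  proof (intro exI[of _ M] conjI ballI M)
    fix r :: real assume "r \<in> {0..<1}"
    from assms(3)[OF this] have "AE \<zeta> in circle_measure. ennreal (q r \<zeta> - M) \<le> ennreal (h \<zeta> - M)"
      by eventually_elim (intro ennreal_leI, simp)
    then show "(\<integral>\<^sup>+\<zeta>. ennreal (q r \<zeta> - M) \<partial>circle_measure) \<le> ennreal \<epsilon>"
      by (rule order_trans[OF nn_integral_mono_AE M(2)])
  qed
qed auto

lemma poisson_integral_radial_measurable:
  assumes h: "integrable circle_measure h"
  shows "(\<lambda>\<zeta>. poisson_integral circle_measure h (of_real r * \<zeta>)) \<in> borel_measurable borel"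
proof -
  have [measurable]: "h \<in> borel_measurable borel" using borel_measurable_integrable[OF h] by simp
  show ?thesis
    unfolding poisson_integral_def
    by (rule circle.borel_measurable_lebesgue_integral) (simp add: case_prod_beta', measurable)
qed

text \<open>
  Since the kernel has mean \<open>1\<close>, the excess of \<open>P h\<close> over a level \<open>M\<close> is at most the Poisson integral of the
  excess of \<open>h\<close> over \<open>M\<close>, and Poisson integration preserves the total mass.
\<close>

lemma radially_uniformly_integrable_poisson:
  assumes h: "integrable circle_measure h"
  shows "radially_uniformly_integrable (\<lambda>r \<zeta>. poisson_integral circle_measure h (of_real r * \<zeta>))"
  unfolding radially_uniformly_integrable_def
proof (intro conjI allI impI ballI poisson_integral_radial_measurable[OF h])
  have [measurable]: "h \<in> borel_measurable borel" using borel_measurable_integrable[OF h] by simp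
  fix \<epsilon> :: real assume "\<epsilon> > 0"
  from tail_integral_small[OF h this] obtain M
    where M: "M \<ge> 0" "(\<integral>\<^sup>+\<zeta>. ennreal (h \<zeta> - M) \<partial>circle_measure) \<le> ennreal \<epsilon>" by blast
  show "\<exists>M\<ge>0. \<forall>r\<in>{0..<1}. (\<integral>\<^sup>+\<zeta>. ennreal (poisson_integral circle_measure h (of_real r * \<zeta>) - M) \<partial>circle_measure) \<le> ennreal \<epsilon>"
  proof (intro exI[of _ M] conjI ballI M)
    fix r :: real assume r: "r \<in> {0..<1}"
    define k where "k \<xi> = max 0 (h \<xi> - M)" for \<xi>
    have "integrable circle_measure (\<lambda>\<xi>. max 0 (h \<xi> - M))"
      by (intro Bochner_Integration.integrable_max Bochner_Integration.integrable_diff h) auto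
    then have k: "integrable circle_measure k" "\<And>\<xi>. 0 \<le> k \<xi>" by (simp_all add: k_def[abs_def])
    have le: "ennreal (poisson_integral circle_measure h z - M) \<le> (\<integral>\<^sup>+\<xi>. ennreal (poisson_kernel z \<xi>) * ennreal (h \<xi> - M) \<partial>circle_measure)"
      if z: "norm z < 1" for z
    proof -
      note ip = integrable_poisson[OF circle_borel_circle_measure _ z]
      have "poisson_integral circle_measure h z - M = (\<integral>\<xi>. poisson_kernel z \<xi> * h \<xi> - poisson_kernel z \<xi> * M \<partial>circle_measure)"
        using ip[OF h] ip[of "\<lambda>_. M"] by (simp add: poisson_integral_def integral_poisson_circle[OF z])
      also have "\<dots> \<le> poisson_integral circle_measure k z"
        unfolding poisson_integral_def
      proof (rule integral_mono)
        show "poisson_kernel z \<xi> * h \<xi> - poisson_kernel z \<xi> * M \<le> poisson_kernel z \<xi> * k \<xi>" for \<xi>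
          using mult_left_mono[of "h \<xi> - M" "k \<xi>" "poisson_kernel z \<xi>"] poisson_kernel_nonneg[OF z]
          by (simp add: k_def right_diff_distrib)
      qed (use ip[OF h] ip[of "\<lambda>_. M"] ip[OF k(1)] in auto)
      finally have "ennreal (poisson_integral circle_measure h z - M) \<le> ennreal (poisson_integral circle_measure k z)"
        by (rule ennreal_leI)
      also have "\<dots> = (\<integral>\<^sup>+\<xi>. ennreal (poisson_kernel z \<xi>) * ennreal (h \<xi> - M) \<partial>circle_measure)"
        unfolding ennreal_poisson_integral[OF circle_borel_circle_measure k z]
        using poisson_kernel_nonneg[OF z]
        by (intro nn_integral_cong) (auto simp: k_def max_def ennreal_mult ennreal_neg)
      finally show ?thesis .
    qed
    have "(\<integral>\<^sup>+\<zeta>. ennreal (poisson_integral circle_measure h (of_real r * \<zeta>) - M) \<partial>circle_measure)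
        \<le> (\<integral>\<^sup>+\<zeta>. 1 * (\<integral>\<^sup>+\<xi>. ennreal (poisson_kernel (of_real r * \<zeta>) \<xi>) * ennreal (h \<xi> - M) \<partial>circle_measure) \<partial>circle_measure)"
    proof (rule nn_integral_mono_AE)
      show "AE \<zeta> in circle_measure. ennreal (poisson_integral circle_measure h (of_real r * \<zeta>) - M)
          \<le> 1 * (\<integral>\<^sup>+\<xi>. ennreal (poisson_kernel (of_real r * \<zeta>) \<xi>) * ennreal (h \<xi> - M) \<partial>circle_measure)"
        using AE_circle_measure by eventually_elim (use le r in \<open>simp add: norm_mult\<close>)
    qed
    also have "\<dots> = (\<integral>\<^sup>+\<xi>. ennreal (h \<xi> - M) * (\<integral>\<^sup>+\<zeta>. ennreal (poisson_kernel (of_real r * \<zeta>) \<xi>) * 1 \<partial>circle_measure) \<partial>circle_measure)"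
      by (rule nn_integral_poisson_swap[OF circle_borel_circle_measure]) auto
    also have "\<dots> = (\<integral>\<^sup>+\<xi>. ennreal (h \<xi> - M) \<partial>circle_measure)"
    proof (rule nn_integral_cong_AE)
      show "AE \<xi> in circle_measure. ennreal (h \<xi> - M) * (\<integral>\<^sup>+\<zeta>. ennreal (poisson_kernel (of_real r * \<zeta>) \<xi>) * 1 \<partial>circle_measure)
          = ennreal (h \<xi> - M)"
        using AE_circle_measure by eventually_elim (use r nn_integral_poisson_radial in simp)
    qed
    also note M(2)
    finally show "(\<integral>\<^sup>+\<zeta>. ennreal (poisson_integral circle_measure h (of_real r * \<zeta>) - M) \<partial>circle_measure) \<le> ennreal \<epsilon>" .
  qed
qed

text \<open>
  A continuous cutoff function that equals \<open>1\<close> on \<open>K\<close>, vanishes at distance \<open>\<delta>\<close> from \<open>K\<close> and decreases to the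
  indicator of \<open>K\<close> as \<open>\<delta>\<close> tends to \<open>0\<close>.
\<close>

definition bump :: "complex set \<Rightarrow> real \<Rightarrow> complex \<Rightarrow> real" where
  "bump K \<delta> \<zeta> = max 0 (1 - infdist \<zeta> K / \<delta>)"

lemma bump_continuous: "\<delta> > 0 \<Longrightarrow> continuous_on A (bump K \<delta>)"
  unfolding bump_def by (intro continuous_intros) auto

lemma bump_measurable [measurable]: "\<delta> > 0 \<Longrightarrow> bump K \<delta> \<in> borel_measurable borel"
  by (intro borel_measurable_continuous_onI bump_continuous)

lemma bump_bounds: "\<delta> > 0 \<Longrightarrow> 0 \<le> bump K \<delta> \<zeta>" "\<delta> > 0 \<Longrightarrow> bump K \<delta> \<zeta> \<le> 1"
  by (auto simp: bump_def infdist_nonneg)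

lemma bump_eq_1: "\<zeta> \<in> K \<Longrightarrow> bump K \<delta> \<zeta> = 1"
  by (simp add: bump_def)

lemma bump_eq_0: "\<delta> > 0 \<Longrightarrow> \<delta> \<le> infdist \<zeta> K \<Longrightarrow> bump K \<delta> \<zeta> = 0"
  by (simp add: bump_def field_simps)

lemma bump_tendsto_indicator:
  assumes "closed K" "K \<noteq> {}"
  shows "(\<lambda>n. bump K (1 / (real n + 1)) \<zeta>) \<longlonglongrightarrow> indicator K \<zeta>"
proof (cases "\<zeta> \<in> K")
  case False
  then have d: "infdist \<zeta> K > 0"
    using assms in_closed_iff_infdist_zero[of K \<zeta>] infdist_nonneg[of \<zeta> K] by fastforce
  then obtain N where N: "inverse (real (Suc N)) < infdist \<zeta> K" using reals_Archimedean by blast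
  have "\<forall>\<^sub>F n in sequentially. bump K (1 / (real n + 1)) \<zeta> = 0"
  proof (intro eventually_sequentiallyI[of N] bump_eq_0)
    fix n assume "n \<ge> N"
    then have "1 / (real n + 1) \<le> inverse (real (Suc N))" by (simp add: field_simps)
    then show "1 / (real n + 1) \<le> infdist \<zeta> K" using N by linarith
  qed auto
  then show ?thesis using False by (simp add: tendsto_eventually)
qed (simp add: bump_eq_1)

lemma integral_bump_tendsto:
  assumes \<sigma>: "sets \<sigma> = sets borel" "finite_measure \<sigma>" and K: "closed K" "K \<noteq> {}"
  shows "(\<lambda>n. \<integral>\<zeta>. bump K (1 / (real n + 1)) \<zeta> \<partial>\<sigma>) \<longlonglongrightarrow> measure \<sigma> K"
proof -
  note [measurable_cong] = \<sigma>(1)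
  interpret \<sigma>: finite_measure \<sigma> by fact
  have [measurable]: "K \<in> sets borel" using K by auto
  have [measurable]: "bump K (1 / (real n + 1)) \<in> borel_measurable borel" for n :: nat
    by (rule bump_measurable) simp
  have "(\<lambda>n. \<integral>\<zeta>. bump K (1 / (real n + 1)) \<zeta> \<partial>\<sigma>) \<longlonglongrightarrow> (\<integral>\<zeta>. indicator K \<zeta> \<partial>\<sigma>)"
  proof (rule integral_dominated_convergence[where w = "\<lambda>_. 1"])
    show "AE \<zeta> in \<sigma>. (\<lambda>n. bump K (1 / (real n + 1)) \<zeta>) \<longlonglongrightarrow> indicator K \<zeta>"
      using bump_tendsto_indicator[OF K] by auto
    show "AE \<zeta> in \<sigma>. norm (bump K (1 / (real n + 1)) \<zeta>) \<le> 1" for n :: nat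
      using bump_bounds[of "1 / (real n + 1)" K] by auto
  qed auto
  moreover have "space \<sigma> = UNIV" using sets_eq_imp_space_eq[OF \<sigma>(1)] by simp
  ultimately show ?thesis using \<sigma>(1) by simp
qed

text \<open>
  Test against the cutoff function \<open>\<phi>\<close> of \<open>K\<close>. As \<open>r\<close> tends to \<open>1\<close>, the integral of \<open>\<phi>\<close> against
  the Poisson integral of \<open>\<mu>\<close> tends to the \<open>\<mu>\<close>-integral of \<open>\<phi>\<close>, which is at least \<open>\<mu> K\<close>. The part of the
  majorant that comes from \<open>q\<close> is small because \<open>\<phi>\<close> lives on a set of small arc length. The dependence on \<open>w\<close> is
  kept explicit: \<open>w = 0\<close> detects the support of \<open>\<mu>\<close>, and \<open>w = log\<^sup>-|W|\<close> compares \<open>\<mu>\<close> with a weak limit.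
\<close>

lemma emeasure_null_compact_le:
  assumes \<mu>: "circle_borel \<mu>" and q: "radially_uniformly_integrable q"
    and K: "compact K" "K \<noteq> {}" "emeasure circle_measure K = 0" "K \<subseteq> U" and U: "open U" and \<epsilon>: "\<epsilon> > 0"
  obtains \<delta>\<^sub>0 where "\<delta>\<^sub>0 > 0"
    "\<And>\<delta>. 0 < \<delta> \<Longrightarrow> \<delta> \<le> \<delta>\<^sub>0 \<Longrightarrow> \<exists>r\<^sub>0. 0 \<le> r\<^sub>0 \<and> r\<^sub>0 < 1 \<and> (\<forall>r w. r\<^sub>0 \<le> r \<longrightarrow> r < 1 \<longrightarrow> w \<in> borel_measurable borel \<longrightarrow>
       (\<forall>\<zeta>. norm \<zeta> = 1 \<longrightarrow> \<zeta> \<in> U \<longrightarrow> ennreal (poisson_integral \<mu> (\<lambda>_. 1) (of_real r * \<zeta>)) \<le> w \<zeta> + ennreal (q r \<zeta>)) \<longrightarrow>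
       emeasure \<mu> K \<le> (\<integral>\<^sup>+\<zeta>. ennreal (bump K \<delta> \<zeta>) * w \<zeta> \<partial>circle_measure) + ennreal \<epsilon>)"
proof -
  note [measurable_cong] = circle_borel_sets[OF \<mu>]
  interpret \<mu>: finite_measure \<mu> by (rule circle_borel_finite[OF \<mu>])
  have sp: "space \<mu> = UNIV" by (rule circle_borel_space[OF \<mu>])
  have Kc: "closed K" using K by (simp add: compact_imp_closed)
  obtain M where M: "M \<ge> 0" "\<And>r. r \<in> {0..<1} \<Longrightarrow> (\<integral>\<^sup>+\<zeta>. ennreal (q r \<zeta> - M) \<partial>circle_measure) \<le> ennreal (\<epsilon> / 3)"
    using q \<epsilon> unfolding radially_uniformly_integrable_def by (metis divide_pos_pos zero_less_numeral)
  have "(\<lambda>n. \<integral>\<zeta>. bump K (1 / (real n + 1)) \<zeta> \<partial>circle_measure) \<longlonglongrightarrow> measure circle_measure K"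
    by (intro integral_bump_tendsto circle.finite_measure_axioms Kc K) simp
  then have "(\<lambda>n. M * (\<integral>\<zeta>. bump K (1 / (real n + 1)) \<zeta> \<partial>circle_measure)) \<longlonglongrightarrow> M * 0"
    using K(3) by (intro tendsto_mult_left) (simp add: measure_def)
  then have "\<forall>\<^sub>F n in sequentially. M * (\<integral>\<zeta>. bump K (1 / (real n + 1)) \<zeta> \<partial>circle_measure) < \<epsilon> / 3"
    using \<epsilon> by (intro order_tendstoD) auto
  then obtain n where n: "M * (\<integral>\<zeta>. bump K (1 / (real n + 1)) \<zeta> \<partial>circle_measure) < \<epsilon> / 3"
    by (auto simp: eventually_sequentially)
  obtain d where d: "d > 0" "{\<zeta>. infdist \<zeta> K < d} \<subseteq> U"
  proof -
    obtain e where e: "e > 0" "(\<Union>x\<in>K. ball x e) \<subseteq> U"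
      using compact_subset_open_imp_ball_epsilon_subset[OF K(1) U K(4)] by blast
    have "{\<zeta>. infdist \<zeta> K < e} \<subseteq> (\<Union>x\<in>K. ball x e)"
    proof
      fix \<zeta> assume "\<zeta> \<in> {\<zeta>. infdist \<zeta> K < e}"
      moreover obtain x where "x \<in> K" "infdist \<zeta> K = dist \<zeta> x"
        using infdist_attains_inf[OF Kc K(2)] by blast
      ultimately show "\<zeta> \<in> (\<Union>x\<in>K. ball x e)" by (auto simp: dist_commute)
    qed
    then show thesis using e that by blast
  qed
  have int_bump: "integrable circle_measure (bump K \<delta>)" if "\<delta> > 0" for \<delta>
    using that by (intro integrable_circle_continuous bump_measurable bump_continuous)
  show thesis
  proof (rule that[of "min d (1 / (real n + 1))"])
    fix \<delta> assume \<delta>: "0 < \<delta>" "\<delta> \<le> min d (1 / (real n + 1))"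
    note [measurable] = bump_measurable[OF \<delta>(1)]
    \<comment> \<open>The factor makes the total error from uniform convergence at most \<open>\<epsilon> / 3\<close>; \<open>+ 1\<close> covers \<open>\<mu> = 0\<close>.\<close>
    define \<epsilon>' where "\<epsilon>' = \<epsilon> / (3 * (measure \<mu> UNIV + 1))"
    have \<mu>0: "measure \<mu> UNIV + 1 > 0" by (simp add: add_nonneg_pos)
    then have \<epsilon>': "\<epsilon>' > 0" using \<epsilon> by (simp add: \<epsilon>'_def)
    obtain r0 where r0: "0 \<le> r0" "r0 < 1"
      "\<And>r \<xi>. r0 \<le> r \<Longrightarrow> r < 1 \<Longrightarrow> norm \<xi> = 1 \<Longrightarrow>
         \<bar>poisson_integral circle_measure (bump K \<delta>) (of_real r * \<xi>) - bump K \<delta> \<xi>\<bar> < \<epsilon>'"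
      using poisson_integral_uniform_limit[OF bump_measurable[OF \<delta>(1)] bump_continuous[OF \<delta>(1)] \<epsilon>'] by metis
    have bump_M: "M * (\<integral>\<zeta>. bump K \<delta> \<zeta> \<partial>circle_measure) < \<epsilon> / 3"
    proof -
      have "(\<integral>\<zeta>. bump K \<delta> \<zeta> \<partial>circle_measure) \<le> (\<integral>\<zeta>. bump K (1 / (real n + 1)) \<zeta> \<partial>circle_measure)"
      proof (intro integral_mono int_bump \<delta>)
        fix \<zeta>
        have "infdist \<zeta> K / (1 / (real n + 1)) \<le> infdist \<zeta> K / \<delta>"
          using \<delta> by (intro divide_left_mono infdist_nonneg) auto
        then show "bump K \<delta> \<zeta> \<le> bump K (1 / (real n + 1)) \<zeta>" by (auto simp: bump_def)
      qed auto
      then have "M * (\<integral>\<zeta>. bump K \<delta> \<zeta> \<partial>circle_measure) \<le> M * (\<integral>\<zeta>. bump K (1 / (real n + 1)) \<zeta> \<partial>circle_measure)"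
        using M(1) by (rule mult_left_mono)
      then show ?thesis using n by linarith
    qed
    have "emeasure \<mu> K \<le> (\<integral>\<^sup>+\<zeta>. ennreal (bump K \<delta> \<zeta>) * w \<zeta> \<partial>circle_measure) + ennreal \<epsilon>"
      if r: "r0 \<le> r" "r < 1" and [measurable]: "w \<in> borel_measurable borel"
        and le: "\<And>\<zeta>. norm \<zeta> = 1 \<Longrightarrow> \<zeta> \<in> U \<Longrightarrow> ennreal (poisson_integral \<mu> (\<lambda>_. 1) (of_real r * \<zeta>)) \<le> w \<zeta> + ennreal (q r \<zeta>)"
      for r w
    proof -
      have r': "r \<in> {0..<1}" "0 \<le> r" using r r0 by auto
      have [measurable]: "q r \<in> borel_measurable borel"
        using q r' unfolding radially_uniformly_integrable_def by auto
      have nr: "norm (of_real r * \<zeta>) < 1" if "norm \<zeta> = 1" for \<zeta> :: complex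
        using r' that by (simp add: norm_mult)
      have "emeasure \<mu> K = (\<integral>\<^sup>+\<xi>. indicator K \<xi> \<partial>\<mu>)"
        using Kc circle_borel_sets[OF \<mu>] by (intro nn_integral_indicator[symmetric]) auto
      also have "\<dots> \<le> (\<integral>\<^sup>+\<xi>. ennreal (bump K \<delta> \<xi>) \<partial>\<mu>)"
        by (intro nn_integral_mono) (auto simp: bump_eq_1 split: split_indicator)
      also have "\<dots> \<le> (\<integral>\<^sup>+\<xi>. (\<integral>\<^sup>+\<zeta>. ennreal (poisson_kernel (of_real r * \<zeta>) \<xi>) * ennreal (bump K \<delta> \<zeta>) \<partial>circle_measure) + ennreal \<epsilon>' \<partial>\<mu>)"
      proof (rule nn_integral_mono_AE)
        show "AE \<xi> in \<mu>. ennreal (bump K \<delta> \<xi>)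
            \<le> (\<integral>\<^sup>+\<zeta>. ennreal (poisson_kernel (of_real r * \<zeta>) \<xi>) * ennreal (bump K \<delta> \<zeta>) \<partial>circle_measure) + ennreal \<epsilon>'"
          using circle_borel_AE[OF \<mu>]
        proof eventually_elim
          case (elim \<xi>)
          have "bump K \<delta> \<xi> \<le> poisson_integral circle_measure (bump K \<delta>) (of_real r * \<xi>) + \<epsilon>'"
            using r0(3)[OF r elim] by linarith
          then have "ennreal (bump K \<delta> \<xi>) \<le> ennreal (poisson_integral circle_measure (bump K \<delta>) (of_real r * \<xi>)) + ennreal \<epsilon>'"
            using poisson_integral_nonneg[OF bump_bounds(1)[OF \<delta>(1)] nr[OF elim]] \<epsilon>'
            by (simp add: ennreal_leI flip: ennreal_plus)
          also have "ennreal (poisson_integral circle_measure (bump K \<delta>) (of_real r * \<xi>))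
              = (\<integral>\<^sup>+\<zeta>. ennreal (poisson_kernel (of_real r * \<xi>) \<zeta> * bump K \<delta> \<zeta>) \<partial>circle_measure)"
            by (intro ennreal_poisson_integral circle_borel_circle_measure int_bump bump_bounds \<delta> nr elim)
          also have "\<dots> = (\<integral>\<^sup>+\<zeta>. ennreal (poisson_kernel (of_real r * \<zeta>) \<xi>) * ennreal (bump K \<delta> \<zeta>) \<partial>circle_measure)"
          proof (rule nn_integral_cong_AE)
            show "AE \<zeta> in circle_measure. ennreal (poisson_kernel (of_real r * \<xi>) \<zeta> * bump K \<delta> \<zeta>)
                = ennreal (poisson_kernel (of_real r * \<zeta>) \<xi>) * ennreal (bump K \<delta> \<zeta>)"
              using AE_circle_measure
            proof eventually_elim
              case (elim \<zeta>)
              then show ?case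
                using poisson_kernel_commute[OF elim \<open>norm \<xi> = 1\<close>, of r] poisson_kernel_nonneg[OF nr[OF \<open>norm \<xi> = 1\<close>]]
                by (simp add: ennreal_mult bump_bounds \<delta>)
            qed
          qed
          finally show ?case .
        qed
      qed
      also have "\<dots> = (\<integral>\<^sup>+\<xi>. 1 * (\<integral>\<^sup>+\<zeta>. ennreal (poisson_kernel (of_real r * \<zeta>) \<xi>) * ennreal (bump K \<delta> \<zeta>) \<partial>circle_measure) \<partial>\<mu>) + ennreal \<epsilon>' * emeasure \<mu> UNIV"
      proof -
        have "(\<lambda>(\<xi>, \<zeta>). ennreal (poisson_kernel (of_real r * \<zeta>) \<xi>) * ennreal (bump K \<delta> \<zeta>)) \<in> borel_measurable (\<mu> \<Otimes>\<^sub>M circle_measure)"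
          unfolding poisson_kernel_def by measurable
        from circle.borel_measurable_nn_integral[OF this] show ?thesis
          by (subst nn_integral_add) (auto simp: sp)
      qed
      finally have 1: "emeasure \<mu> K \<le> (\<integral>\<^sup>+\<xi>. 1 * (\<integral>\<^sup>+\<zeta>. ennreal (poisson_kernel (of_real r * \<zeta>) \<xi>) * ennreal (bump K \<delta> \<zeta>) \<partial>circle_measure) \<partial>\<mu>)
          + ennreal \<epsilon>' * emeasure \<mu> UNIV" .
      have "(\<integral>\<^sup>+\<xi>. 1 * (\<integral>\<^sup>+\<zeta>. ennreal (poisson_kernel (of_real r * \<zeta>) \<xi>) * ennreal (bump K \<delta> \<zeta>) \<partial>circle_measure) \<partial>\<mu>)
          = (\<integral>\<^sup>+\<zeta>. ennreal (bump K \<delta> \<zeta>) * (\<integral>\<^sup>+\<xi>. ennreal (poisson_kernel (of_real r * \<zeta>) \<xi>) * 1 \<partial>\<mu>) \<partial>circle_measure)"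
        by (rule nn_integral_poisson_swap[OF \<mu>, symmetric]) auto
      also have "\<dots> \<le> (\<integral>\<^sup>+\<zeta>. ennreal (bump K \<delta> \<zeta>) * w \<zeta> + (ennreal (q r \<zeta> - M) + ennreal (M * bump K \<delta> \<zeta>)) \<partial>circle_measure)"
      proof (rule nn_integral_mono_AE)
        show "AE \<zeta> in circle_measure. ennreal (bump K \<delta> \<zeta>) * (\<integral>\<^sup>+\<xi>. ennreal (poisson_kernel (of_real r * \<zeta>) \<xi>) * 1 \<partial>\<mu>)
            \<le> ennreal (bump K \<delta> \<zeta>) * w \<zeta> + (ennreal (q r \<zeta> - M) + ennreal (M * bump K \<delta> \<zeta>))"
          using AE_circle_measure
        proof eventually_elim
          case (elim \<zeta>)
          show ?case
          proof (cases "\<zeta> \<in> U")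
            case False
            then have "\<not> infdist \<zeta> K < d" using d by auto
            then have "infdist \<zeta> K \<ge> \<delta>" using \<delta> by simp
            then show ?thesis using \<delta> by (simp add: bump_eq_0)
          next
            case True
            have "(\<integral>\<^sup>+\<xi>. ennreal (poisson_kernel (of_real r * \<zeta>) \<xi>) * 1 \<partial>\<mu>) = ennreal (poisson_integral \<mu> (\<lambda>_. 1) (of_real r * \<zeta>))"
              using ennreal_poisson_integral[OF \<mu>, of "\<lambda>_. 1", OF _ _ nr[OF elim]] by simp
            also have "\<dots> \<le> w \<zeta> + ennreal (q r \<zeta>)" by (rule le[OF elim True])
            finally have "ennreal (bump K \<delta> \<zeta>) * (\<integral>\<^sup>+\<xi>. ennreal (poisson_kernel (of_real r * \<zeta>) \<xi>) * 1 \<partial>\<mu>)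
                \<le> ennreal (bump K \<delta> \<zeta>) * (w \<zeta> + ennreal (q r \<zeta>))" by (rule mult_left_mono) simp
            also have "\<dots> = ennreal (bump K \<delta> \<zeta>) * w \<zeta> + ennreal (bump K \<delta> \<zeta> * q r \<zeta>)"
              using bump_bounds[OF \<delta>(1)] by (simp add: distrib_left ennreal_mult')
            also have "ennreal (bump K \<delta> \<zeta> * q r \<zeta>) \<le> ennreal (q r \<zeta> - M) + ennreal (M * bump K \<delta> \<zeta>)"
            proof (cases "q r \<zeta> \<le> M")
              case True
              then have "bump K \<delta> \<zeta> * q r \<zeta> \<le> M * bump K \<delta> \<zeta>"
                using bump_bounds[OF \<delta>(1), of K \<zeta>] mult_right_mono[OF True, of "bump K \<delta> \<zeta>"] by (simp add: mult.commute)
              then have "ennreal (bump K \<delta> \<zeta> * q r \<zeta>) \<le> 0 + ennreal (M * bump K \<delta> \<zeta>)" by (simp add: ennreal_leI)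
              also have "\<dots> \<le> ennreal (q r \<zeta> - M) + ennreal (M * bump K \<delta> \<zeta>)" by (intro add_mono) auto
              finally show ?thesis .
            next
              case False
              have "bump K \<delta> \<zeta> * (q r \<zeta> - M) \<le> 1 * (q r \<zeta> - M)"
                using bump_bounds[OF \<delta>(1), of K \<zeta>] False by (intro mult_right_mono) auto
              then have "bump K \<delta> \<zeta> * q r \<zeta> \<le> (q r \<zeta> - M) + M * bump K \<delta> \<zeta>"
                by (simp add: algebra_simps)
              then show ?thesis
                using False M(1) bump_bounds[OF \<delta>(1), of K \<zeta>] by (simp add: ennreal_leI flip: ennreal_plus)
            qed
            finally show ?thesis by (simp add: add_left_mono)
          qed
        qed
      qed
      also have "\<dots> = (\<integral>\<^sup>+\<zeta>. ennreal (bump K \<delta> \<zeta>) * w \<zeta> \<partial>circle_measure)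
          + ((\<integral>\<^sup>+\<zeta>. ennreal (q r \<zeta> - M) \<partial>circle_measure) + (\<integral>\<^sup>+\<zeta>. ennreal (M * bump K \<delta> \<zeta>) \<partial>circle_measure))"
        by (simp add: nn_integral_add)
      also have "(\<integral>\<^sup>+\<zeta>. ennreal (M * bump K \<delta> \<zeta>) \<partial>circle_measure) = ennreal (M * (\<integral>\<zeta>. bump K \<delta> \<zeta> \<partial>circle_measure))"
        using int_bump[OF \<delta>(1)] M(1) bump_bounds[OF \<delta>(1)] by (subst nn_integral_eq_integral) auto
      finally have "(\<integral>\<^sup>+\<xi>. 1 * (\<integral>\<^sup>+\<zeta>. ennreal (poisson_kernel (of_real r * \<zeta>) \<xi>) * ennreal (bump K \<delta> \<zeta>) \<partial>circle_measure) \<partial>\<mu>)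
          \<le> (\<integral>\<^sup>+\<zeta>. ennreal (bump K \<delta> \<zeta>) * w \<zeta> \<partial>circle_measure)
            + ((\<integral>\<^sup>+\<zeta>. ennreal (q r \<zeta> - M) \<partial>circle_measure) + ennreal (M * (\<integral>\<zeta>. bump K \<delta> \<zeta> \<partial>circle_measure)))" .
      with 1 have "emeasure \<mu> K \<le> (\<integral>\<^sup>+\<zeta>. ennreal (bump K \<delta> \<zeta>) * w \<zeta> \<partial>circle_measure)
          + ((\<integral>\<^sup>+\<zeta>. ennreal (q r \<zeta> - M) \<partial>circle_measure) + ennreal (M * (\<integral>\<zeta>. bump K \<delta> \<zeta> \<partial>circle_measure))) + ennreal \<epsilon>' * emeasure \<mu> UNIV"
        by (meson add_right_mono order_trans)
      also have "\<dots> \<le> (\<integral>\<^sup>+\<zeta>. ennreal (bump K \<delta> \<zeta>) * w \<zeta> \<partial>circle_measure) + (ennreal (\<epsilon> / 3) + ennreal (\<epsilon> / 3)) + ennreal (\<epsilon> / 3)"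
      proof (intro add_mono M(2) r' ennreal_leI order_refl)
        show "M * (\<integral>\<zeta>. bump K \<delta> \<zeta> \<partial>circle_measure) \<le> \<epsilon> / 3" using bump_M by simp
        have "\<epsilon>' * measure \<mu> UNIV \<le> \<epsilon> / 3"
          using \<mu>0 \<epsilon> by (simp add: \<epsilon>'_def field_simps)
        then show "ennreal \<epsilon>' * emeasure \<mu> UNIV \<le> ennreal (\<epsilon> / 3)"
          using \<epsilon>' by (simp add: \<mu>.emeasure_eq_measure ennreal_leI flip: ennreal_mult)
      qed
      also have "\<dots> = (\<integral>\<^sup>+\<zeta>. ennreal (bump K \<delta> \<zeta>) * w \<zeta> \<partial>circle_measure) + ennreal \<epsilon>"
        using \<epsilon> by (simp add: add.assoc flip: ennreal_plus)
      finally show ?thesis .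
    qed
    then show "\<exists>r\<^sub>0. 0 \<le> r\<^sub>0 \<and> r\<^sub>0 < 1 \<and> (\<forall>r w. r\<^sub>0 \<le> r \<longrightarrow> r < 1 \<longrightarrow> w \<in> borel_measurable borel \<longrightarrow>
       (\<forall>\<zeta>. norm \<zeta> = 1 \<longrightarrow> \<zeta> \<in> U \<longrightarrow> ennreal (poisson_integral \<mu> (\<lambda>_. 1) (of_real r * \<zeta>)) \<le> w \<zeta> + ennreal (q r \<zeta>)) \<longrightarrow>
       emeasure \<mu> K \<le> (\<integral>\<^sup>+\<zeta>. ennreal (bump K \<delta> \<zeta>) * w \<zeta> \<partial>circle_measure) + ennreal \<epsilon>)"
      using r0 by (intro exI[of _ r0]) auto
  qed (use d in auto)
qed

section \<open>Logarithmic integrals\<close>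

text \<open>
  Jensen's inequality at a point where \<open>G\<close> does not vanish bounds a weighted integral of the negative part of
  \<open>ln |G|\<close> by that of the positive part, which is at most \<open>|G|\<close>. The truncation at \<open>\<delta>\<close> keeps the boundary
  values continuous when \<open>G\<close> has zeros on the circle.
\<close>

lemma log_integral_bounded_near_boundary:
  assumes G: "G holomorphic_on ball 0 1" and mb: "mean_bounded G" and z0: "norm z0 < 1" "G z0 \<noteq> 0"
  obtains C r\<^sub>1 where "C \<ge> 0" "0 \<le> r\<^sub>1" "r\<^sub>1 < 1"
    "\<And>r \<delta>. r\<^sub>1 \<le> r \<Longrightarrow> r < 1 \<Longrightarrow> 0 < \<delta> \<Longrightarrow> \<delta> \<le> 1 \<Longrightarrow>
       (\<integral>\<^sup>+\<zeta>. ennreal (- ln (max (norm (G (of_real r * \<zeta>))) \<delta>)) \<partial>circle_measure) \<le> ennreal C"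
proof -
  obtain C0 where C0: "C0 \<ge> 0"
    "\<And>r. r \<in> {0..<1} \<Longrightarrow> (\<integral>\<^sup>+\<xi>. ennreal (norm (G (of_real r * \<xi>))) \<partial>circle_measure) \<le> ennreal C0"
    using mb by (auto simp: mean_bounded_def)
  define c where "c = norm (G z0) / 2"
  have c: "c > 0" using z0 by (simp add: c_def)
  have "isCont G z0"
    using G z0 by (meson continuous_on_eq_continuous_at holomorphic_on_imp_continuous_on mem_ball_0 open_ball)
  moreover have "((\<lambda>r. of_real r * z0) \<longlongrightarrow> of_real 1 * z0) (at_left (1::real))"
    by (intro tendsto_intros)
  ultimately have "((\<lambda>r. norm (G (of_real r * z0))) \<longlongrightarrow> norm (G z0)) (at_left (1::real))"
    by (intro tendsto_norm isCont_tendsto_compose[of z0 G]) auto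
  then have "\<forall>\<^sub>F r in at_left (1::real). c < norm (G (of_real r * z0))"
    using c by (intro order_tendstoD) (auto simp: c_def)
  then obtain b where b: "b < 1" "\<And>r. b < r \<Longrightarrow> r < 1 \<Longrightarrow> c < norm (G (of_real r * z0))"
    by (auto simp: eventually_at_left_field)
  define r1 where "r1 = max 0 ((1 + b) / 2)"
  have "b < (1 + b) / 2" using b by simp
  then have r1: "0 \<le> r1" "r1 < 1" "b < r1" using b by (auto simp: r1_def less_max_iff_disj)
  define p where "p = 1 - norm z0"
  have p: "p > 0" using z0 by (simp add: p_def)
  define C where "C = max 0 (4 / p * (2 / p * C0 - ln c))"
  show thesis
  proof
    show "C \<ge> 0" by (simp add: C_def)
    fix r \<delta> :: real assume r: "r1 \<le> r" "r < 1" and \<delta>: "0 < \<delta>" "\<delta> \<le> 1"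
    have r0: "0 \<le> r" using r r1 by simp
    define G' where "G' z = (if norm z < 1 then G z else 0)" for z
    have [measurable]: "G' \<in> borel_measurable borel"
      using measurable_on_disk[OF G] by (simp add: G'_def[abs_def])
    define \<phi> where "\<phi> \<zeta> = ln (max (norm (G' (of_real r * \<zeta>))) \<delta>)" for \<zeta>
    have G'G: "G' (of_real r * \<zeta>) = G (of_real r * \<zeta>)" if "norm \<zeta> \<le> 1" for \<zeta>
      using norm_dilation_less[OF r0 r(2) that] by (simp add: G'_def)
    have \<phi>m [measurable]: "\<phi> \<in> borel_measurable borel" unfolding \<phi>_def by measurable
    have \<phi>c: "continuous_on (sphere 0 1) \<phi>"
    proof -
      have "continuous_on (sphere 0 1) (\<lambda>\<zeta>. ln (max (norm (G (of_real r * \<zeta>))) \<delta>))"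
        using \<delta> by (intro continuous_intros continuous_on_subset[OF continuous_on_dilation[OF G r0 r(2)]]) auto
      then show ?thesis by (rule continuous_on_eq) (simp add: \<phi>_def G'G)
    qed
    define \<phi>p where "\<phi>p \<zeta> = max 0 (\<phi> \<zeta>)" for \<zeta>
    define \<phi>n where "\<phi>n \<zeta> = max 0 (- \<phi> \<zeta>)" for \<zeta>
    have pn0: "0 \<le> \<phi>p \<zeta>" "0 \<le> \<phi>n \<zeta>" for \<zeta> by (simp_all add: \<phi>p_def \<phi>n_def)
    have int: "integrable circle_measure \<phi>" by (rule integrable_circle_continuous[OF \<phi>m \<phi>c])
    have intp: "integrable circle_measure \<phi>p" unfolding \<phi>p_def using int by auto
    have intn: "integrable circle_measure \<phi>n" unfolding \<phi>n_def using int by auto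
    note pi = integrable_poisson[OF circle_borel_circle_measure _ z0(1)]
    have "c \<le> norm (G (of_real r * z0))" using b(2)[of r] r r1 by simp
    also have "\<dots> \<le> exp (poisson_integral circle_measure \<phi> z0)"
    proof (rule norm_le_exp_poisson_integral[OF _ _ \<phi>m \<phi>c _ z0(1)])
      show "continuous_on (cball 0 1) (\<lambda>z. G (of_real r * z))" by (rule continuous_on_dilation[OF G r0 r(2)])
      show "(\<lambda>z. G (of_real r * z)) holomorphic_on ball 0 1" by (rule holomorphic_on_dilation[OF G r0 r(2)])
      show "norm (G (of_real r * \<zeta>)) \<le> exp (\<phi> \<zeta>)" if "norm \<zeta> = 1" for \<zeta>
        using that \<delta> by (simp add: \<phi>_def G'G)
    qed
    finally have "ln c \<le> poisson_integral circle_measure \<phi> z0"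
      using c by (metis exp_le_cancel_iff exp_ln)
    also have "\<dots> = (\<integral>\<zeta>. poisson_kernel z0 \<zeta> * \<phi>p \<zeta> - poisson_kernel z0 \<zeta> * \<phi>n \<zeta> \<partial>circle_measure)"
      unfolding poisson_integral_def
      by (intro Bochner_Integration.integral_cong) (auto simp: \<phi>p_def \<phi>n_def max_def)
    also have "\<dots> = (\<integral>\<zeta>. poisson_kernel z0 \<zeta> * \<phi>p \<zeta> \<partial>circle_measure) - (\<integral>\<zeta>. poisson_kernel z0 \<zeta> * \<phi>n \<zeta> \<partial>circle_measure)"
      by (intro Bochner_Integration.integral_diff pi intp intn)
    finally have 1: "(\<integral>\<zeta>. poisson_kernel z0 \<zeta> * \<phi>n \<zeta> \<partial>circle_measure)
        \<le> (\<integral>\<zeta>. poisson_kernel z0 \<zeta> * \<phi>p \<zeta> \<partial>circle_measure) - ln c" by simp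
    have "(\<integral>\<zeta>. poisson_kernel z0 \<zeta> * \<phi>p \<zeta> \<partial>circle_measure) \<le> (\<integral>\<zeta>. 2 / p * \<phi>p \<zeta> \<partial>circle_measure)"
    proof (rule integral_mono_AE)
      show "AE \<zeta> in circle_measure. poisson_kernel z0 \<zeta> * \<phi>p \<zeta> \<le> 2 / p * \<phi>p \<zeta>"
        using AE_circle_measure
        by eventually_elim (intro mult_right_mono, auto simp: p_def \<phi>p_def intro!: poisson_kernel_le z0)
    qed (use pi intp in auto)
    also have "\<dots> = 2 / p * (\<integral>\<zeta>. \<phi>p \<zeta> \<partial>circle_measure)" by simp
    also have "\<dots> \<le> 2 / p * C0"
    proof (intro mult_left_mono)
      have "ennreal (\<integral>\<zeta>. \<phi>p \<zeta> \<partial>circle_measure) = (\<integral>\<^sup>+\<zeta>. ennreal (\<phi>p \<zeta>) \<partial>circle_measure)"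
        using intp pn0 by (intro nn_integral_eq_integral[symmetric]) auto
      also have "\<dots> \<le> (\<integral>\<^sup>+\<zeta>. ennreal (norm (G (of_real r * \<zeta>))) \<partial>circle_measure)"
      proof (rule nn_integral_mono_AE)
        show "AE \<zeta> in circle_measure. ennreal (\<phi>p \<zeta>) \<le> ennreal (norm (G (of_real r * \<zeta>)))"
          using AE_circle_measure
        proof eventually_elim
          case (elim \<zeta>)
          define x where "x = norm (G (of_real r * \<zeta>))"
          have x0: "x \<ge> 0" by (simp add: x_def)
          have "max 0 (ln (max x \<delta>)) \<le> x"
          proof (cases "x \<ge> 1")
            case True
            then have "max x \<delta> = x" using \<delta> by simp
            then show ?thesis using ln_le_minus_one[of x] True by simp
          next
            case False
            then have "ln (max x \<delta>) \<le> 0" using \<delta> x0 by (simp add: max_def)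
            then show ?thesis using x0 by simp
          qed
          then show ?case using elim by (simp add: \<phi>p_def \<phi>_def G'G x_def ennreal_leI)
        qed
      qed
      also have "\<dots> \<le> ennreal C0" using r0 r by (intro C0) auto
      finally show "(\<integral>\<zeta>. \<phi>p \<zeta> \<partial>circle_measure) \<le> C0" using C0(1) by (simp add: ennreal_le_iff)
    qed (use p in auto)
    finally have 2: "(\<integral>\<zeta>. poisson_kernel z0 \<zeta> * \<phi>p \<zeta> \<partial>circle_measure) \<le> 2 / p * C0" .
    have "p / 4 * (\<integral>\<zeta>. \<phi>n \<zeta> \<partial>circle_measure) = (\<integral>\<zeta>. p / 4 * \<phi>n \<zeta> \<partial>circle_measure)" by simp
    also have "\<dots> \<le> (\<integral>\<zeta>. poisson_kernel z0 \<zeta> * \<phi>n \<zeta> \<partial>circle_measure)"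
    proof (rule integral_mono_AE)
      show "AE \<zeta> in circle_measure. p / 4 * \<phi>n \<zeta> \<le> poisson_kernel z0 \<zeta> * \<phi>n \<zeta>"
        using AE_circle_measure
        by eventually_elim (intro mult_right_mono pn0, unfold p_def, intro poisson_kernel_ge z0(1))
    qed (use pi intn in auto)
    finally have "p / 4 * (\<integral>\<zeta>. \<phi>n \<zeta> \<partial>circle_measure) \<le> 2 / p * C0 - ln c" using 1 2 by linarith
    then have "4 / p * (p / 4 * (\<integral>\<zeta>. \<phi>n \<zeta> \<partial>circle_measure)) \<le> 4 / p * (2 / p * C0 - ln c)"
      using p by (intro mult_left_mono) auto
    then have 3: "(\<integral>\<zeta>. \<phi>n \<zeta> \<partial>circle_measure) \<le> C" using p by (simp add: C_def)
    have "(\<integral>\<^sup>+\<zeta>. ennreal (- ln (max (norm (G (of_real r * \<zeta>))) \<delta>)) \<partial>circle_measure)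
        = (\<integral>\<^sup>+\<zeta>. ennreal (\<phi>n \<zeta>) \<partial>circle_measure)"
    proof (rule nn_integral_cong_AE)
      show "AE \<zeta> in circle_measure. ennreal (- ln (max (norm (G (of_real r * \<zeta>))) \<delta>)) = ennreal (\<phi>n \<zeta>)"
        using AE_circle_measure by eventually_elim (auto simp: \<phi>n_def \<phi>_def G'G max_def ennreal_neg)
    qed
    also have "\<dots> = ennreal (\<integral>\<zeta>. \<phi>n \<zeta> \<partial>circle_measure)"
      using intn pn0 by (intro nn_integral_eq_integral) auto
    also have "\<dots> \<le> ennreal C" using 3 by (rule ennreal_leI)
    finally show "(\<integral>\<^sup>+\<zeta>. ennreal (- ln (max (norm (G (of_real r * \<zeta>))) \<delta>)) \<partial>circle_measure) \<le> ennreal C" .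
  qed (use r1 in auto)
qed

text \<open>
  The number of \<open>j\<close> such that \<open>2\<^sup>j\<close> is below \<open>1\<close> plus the maximal function bounds its logarithm, and by the
  weak-type estimate the measures of these level sets form a geometric series.
\<close>

lemma log_maximal_function_integral:
  assumes \<tau>: "sets \<tau> = sets borel" "emeasure \<tau> UNIV \<le> ennreal C" and C: "C \<ge> 0"
  obtains L where "L \<in> borel_measurable borel" "(\<integral>\<^sup>+\<zeta>. L \<zeta> \<partial>circle_measure) \<le> ennreal (2 * (20 * C + 1))"
    "\<And>\<zeta> x. 0 < x \<Longrightarrow> ennreal x \<le> 1 + maximal_function \<tau> \<zeta> \<Longrightarrow> ennreal (ln x) \<le> L \<zeta>"
proof -
  have sp: "space \<tau> = UNIV" using sets_eq_imp_space_eq[OF \<tau>(1)] by simp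
  have fin: "finite_measure \<tau>"
    using \<tau>(2) by (intro finite_measureI) (auto simp: sp top_unique)
  note [measurable] = maximal_function_measurable[OF \<tau>(1)]
  define E where "E j = {\<zeta>. ennreal (2 ^ j - 1) < maximal_function \<tau> \<zeta>}" for j :: nat
  have E [measurable]: "E j \<in> sets borel" for j
    unfolding E_def using open_maximal_function_greater[OF \<tau>(1)] by (intro borel_open)
  define L where "L \<zeta> = (\<Sum>j. indicator (E j) \<zeta> :: ennreal)" for \<zeta>
  show thesis
  proof
    show "L \<in> borel_measurable borel" unfolding L_def by measurable
    have Ej: "emeasure circle_measure (E j) \<le> ennreal ((20 * C + 1) * (1 / 2) ^ j)" for j
    proof (cases "j = 0")
      case True
      have "emeasure circle_measure (E j) \<le> 1" by (rule circle.emeasure_le_1)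
      also have "\<dots> \<le> ennreal (20 * C + 1)" using C ennreal_leI[of 1 "20 * C + 1"] by simp
      finally show ?thesis using True by simp
    next
      case False
      then have p: "(2::real) ^ j \<ge> 2" using power_increasing[of 1 j "2::real"] by simp
      have "emeasure circle_measure (E j) \<le> ennreal (10 / (2 ^ j - 1)) * emeasure \<tau> UNIV"
        unfolding E_def using p by (intro weak_type_maximal_function \<tau> fin) simp
      also have "\<dots> \<le> ennreal (20 / 2 ^ j) * ennreal C"
        using p by (intro mult_mono ennreal_leI \<tau>) (auto simp: field_simps)
      also have "\<dots> = ennreal (20 * C * (1 / 2) ^ j)"
        using C by (simp add: power_one_over field_simps flip: ennreal_mult)
      also have "\<dots> \<le> ennreal ((20 * C + 1) * (1 / 2) ^ j)"
        by (intro ennreal_leI mult_right_mono) auto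
      finally show ?thesis .
    qed
    have "(\<integral>\<^sup>+\<zeta>. L \<zeta> \<partial>circle_measure) = (\<Sum>j. emeasure circle_measure (E j))"
      unfolding L_def by (subst nn_integral_suminf) auto
    also have "\<dots> \<le> (\<Sum>j. ennreal ((20 * C + 1) * (1 / 2) ^ j))"
      by (intro suminf_le Ej) auto
    also have "\<dots> = ennreal (2 * (20 * C + 1))"
    proof -
      have "(\<lambda>j. (20 * C + 1) * (1 / 2 :: real) ^ j) sums ((20 * C + 1) * (1 / (1 - 1 / 2)))"
        by (intro sums_mult geometric_sums) auto
      then show ?thesis using C by (intro suminf_ennreal_eq) (auto simp: mult.commute)
    qed
    finally show "(\<integral>\<^sup>+\<zeta>. L \<zeta> \<partial>circle_measure) \<le> ennreal (2 * (20 * C + 1))" .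
    fix \<zeta> :: complex and x :: real
    assume x: "0 < x" "ennreal x \<le> 1 + maximal_function \<tau> \<zeta>"
    show "ennreal (ln x) \<le> L \<zeta>"
    proof (cases "x \<le> 1")
      case True
      then show ?thesis using x by (simp add: ennreal_neg)
    next
      case False
      have ex: "\<exists>n::nat. x \<le> 2 ^ n" using real_arch_pow[of 2 x] less_imp_le by auto
      define n where "n = (LEAST n::nat. x \<le> 2 ^ n)"
      have n: "x \<le> 2 ^ n" unfolding n_def by (rule LeastI_ex[OF ex])
      have mem: "\<zeta> \<in> E j" if "j < n" for j
      proof -
        have "\<not> x \<le> 2 ^ j" using that not_less_Least[of j "\<lambda>n. x \<le> 2 ^ n"] by (simp add: n_def)
        then have "ennreal (2 ^ j) < ennreal x" by (simp add: ennreal_less_iff)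
        also note x(2)
        finally have "ennreal 1 + ennreal (2 ^ j - 1) < 1 + maximal_function \<tau> \<zeta>"
          by (subst ennreal_plus[symmetric]) auto
        then show ?thesis unfolding E_def by (simp add: ennreal_add_left_cancel_less)
      qed
      have "ln x \<le> ln (2 ^ n)" using n x by simp
      also have "\<dots> = real n * ln 2" by (simp add: ln_realpow)
      also have "\<dots> \<le> real n * 1" using ln_2_less_1 by (intro mult_left_mono) auto
      finally have "ennreal (ln x) \<le> of_nat n" by (simp add: ennreal_leI flip: ennreal_of_nat_eq_real_of_nat)
      also have "of_nat n = (\<Sum>j<n. indicator (E j) \<zeta> :: ennreal)" using mem by simp
      also have "\<dots> \<le> L \<zeta>" unfolding L_def by (intro sum_le_suminf) auto
      finally show ?thesis .
    qed
  qed
qed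

text \<open>
  Put \<open>D = max d \<delta>\<close> with the distance \<open>d\<close> to \<open>Z\<close>. Within distance \<open>3 D\<close> of \<open>\<zeta>\<close> there is a unimodular
  \<open>\<zeta>'\<close> with \<open>|f (r \<zeta>')| < \<delta>\<close>, so \<open>|f|\<close> at \<open>r \<zeta>\<close> is at most a multiple of \<open>D\<close> times \<open>1\<close> plus the maximal
  function of \<open>|f'|\<close>. Take logarithms and integrate; the bound does not depend on the
  radius \<open>r\<close>, which has to be close to \<open>1\<close> in terms of \<open>\<delta>\<close>.
\<close>

lemma log_distance_integral_bounded:
  assumes f: "f holomorphic_on ball 0 1" and mb: "mean_bounded f" "mean_bounded (deriv f)"
    and z0: "norm z0 < 1" "f z0 \<noteq> 0"
    and Z: "closed Z" "Z \<noteq> {}" "Z \<subseteq> sphere 0 1"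
    and small: "\<And>\<alpha> \<delta>. \<alpha> \<in> Z \<Longrightarrow> \<delta> > 0 \<Longrightarrow>
      \<forall>\<^sub>F r in at_left 1. \<exists>\<zeta>. norm \<zeta> = 1 \<and> norm (\<zeta> - \<alpha>) < \<delta> \<and> norm (f (of_real r * \<zeta>)) < \<delta>"
  obtains C where "C \<ge> 0" "\<And>\<delta>. 0 < \<delta> \<Longrightarrow> \<delta> \<le> 1 \<Longrightarrow>
    (\<integral>\<^sup>+\<zeta>. ennreal (- ln (max (infdist \<zeta> Z) \<delta>)) \<partial>circle_measure) \<le> ennreal C"
proof -
  obtain C1 r1 where C1: "C1 \<ge> 0" "0 \<le> r1" "r1 < 1"
    "\<And>r \<delta>. r1 \<le> r \<Longrightarrow> r < 1 \<Longrightarrow> 0 < \<delta> \<Longrightarrow> \<delta> \<le> 1 \<Longrightarrow>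
       (\<integral>\<^sup>+\<zeta>. ennreal (- ln (max (norm (f (of_real r * \<zeta>))) \<delta>)) \<partial>circle_measure) \<le> ennreal C1"
    using log_integral_bounded_near_boundary[OF f mb(1) z0] by metis
  obtain C2 where C2: "C2 \<ge> 0"
    "\<And>r. r \<in> {0..<1} \<Longrightarrow> (\<integral>\<^sup>+\<xi>. ennreal (norm (deriv f (of_real r * \<xi>))) \<partial>circle_measure) \<le> ennreal C2"
    using mb(2) by (auto simp: mean_bounded_def)
  have comp: "compact Z"
    using Z by (meson bounded_sphere bounded_subset compact_eq_bounded_closed)
  show thesis
  proof
    show "ln 24 + 2 * (20 * C2 + 1) + C1 \<ge> 0" using C1 C2 by simp
    fix \<delta> :: real assume \<delta>: "0 < \<delta>" "\<delta> \<le> 1"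
    \<comment> \<open>A finite net turns the pointwise condition on \<open>Z\<close> into one that holds at all points of \<open>Z\<close> for a single radius.\<close>
    obtain A where A: "A \<subseteq> Z" "finite A" "Z \<subseteq> (\<Union>\<alpha>\<in>A. ball \<alpha> (\<delta> / 2))"
    proof (rule compactE_image[OF comp, of Z "\<lambda>\<alpha>. ball \<alpha> (\<delta> / 2)"])
      show "Z \<subseteq> (\<Union>\<alpha>\<in>Z. ball \<alpha> (\<delta> / 2))" using \<delta> by auto
    qed auto
    have "\<forall>\<^sub>F r in at_left (1::real). max r1 0 < r \<and> r < 1"
      using C1 by (auto simp: eventually_at_left_field intro!: exI[of _ "max r1 0"])
    moreover have "\<forall>\<^sub>F r in at_left 1. \<forall>\<alpha>\<in>A. \<exists>\<zeta>. norm \<zeta> = 1 \<and> norm (\<zeta> - \<alpha>) < \<delta> / 2 \<and> norm (f (of_real r * \<zeta>)) < \<delta> / 2"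
      using A \<delta> by (intro eventually_ball_finite ballI small) auto
    ultimately have "\<forall>\<^sub>F r in at_left 1. (max r1 0 < r \<and> r < 1) \<and>
        (\<forall>\<alpha>\<in>A. \<exists>\<zeta>. norm \<zeta> = 1 \<and> norm (\<zeta> - \<alpha>) < \<delta> / 2 \<and> norm (f (of_real r * \<zeta>)) < \<delta> / 2)"
      by (rule eventually_conj)
    from eventually_happens'[OF trivial_limit_at_left_real this] obtain r where "max r1 0 < r \<and> r < 1"
      and near: "\<And>\<alpha>. \<alpha> \<in> A \<Longrightarrow> \<exists>\<zeta>. norm \<zeta> = 1 \<and> norm (\<zeta> - \<alpha>) < \<delta> / 2 \<and> norm (f (of_real r * \<zeta>)) < \<delta> / 2"
      by blast
    then have r: "r1 < r" "0 < r" "r < 1" by auto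
    define d where "d z = (if norm z < 1 then deriv f z else 0)" for z
    have [measurable]: "d \<in> borel_measurable borel"
      using measurable_on_disk[OF holomorphic_deriv[OF f]] by (simp add: d_def[abs_def])
    define F where "F z = (if norm z < 1 then f z else 0)" for z
    have [measurable]: "F \<in> borel_measurable borel"
      using measurable_on_disk[OF f] by (simp add: F_def[abs_def])
    have nr: "norm (of_real r * \<xi>) < 1" if "norm \<xi> = 1" for \<xi> :: complex
      using r that by (simp add: norm_mult)
    define \<tau> where "\<tau> = density circle_measure (\<lambda>\<xi>. ennreal (norm (d (of_real r * \<xi>))))"
    have \<tau>s: "sets \<tau> = sets borel" by (simp add: \<tau>_def)
    have \<tau>em: "emeasure \<tau> B = (\<integral>\<^sup>+\<xi>. ennreal (norm (deriv f (of_real r * \<xi>))) * indicator B \<xi> \<partial>circle_measure)"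
      if "B \<in> sets borel" for B
    proof -
      have "emeasure \<tau> B = (\<integral>\<^sup>+\<xi>. ennreal (norm (d (of_real r * \<xi>))) * indicator B \<xi> \<partial>circle_measure)"
        unfolding \<tau>_def using that by (intro emeasure_density) auto
      also have "\<dots> = (\<integral>\<^sup>+\<xi>. ennreal (norm (deriv f (of_real r * \<xi>))) * indicator B \<xi> \<partial>circle_measure)"
        by (rule nn_integral_cong_AE, rule eventually_mono[OF AE_circle_measure]) (simp add: d_def nr)
      finally show ?thesis .
    qed
    have \<tau>C: "emeasure \<tau> UNIV \<le> ennreal C2"
      using C2(2)[of r] r by (simp add: \<tau>em)
    obtain L where L: "L \<in> borel_measurable borel" "(\<integral>\<^sup>+\<zeta>. L \<zeta> \<partial>circle_measure) \<le> ennreal (2 * (20 * C2 + 1))"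
      "\<And>\<zeta> x. 0 < x \<Longrightarrow> ennreal x \<le> 1 + maximal_function \<tau> \<zeta> \<Longrightarrow> ennreal (ln x) \<le> L \<zeta>"
      using log_maximal_function_integral[OF \<tau>s \<tau>C C2(1)] by metis
    note [measurable] = L(1)
    have ptw: "ennreal (- ln (max (infdist \<zeta> Z) \<delta>))
        \<le> ennreal (ln 24) + L \<zeta> + ennreal (- ln (max (norm (F (of_real r * \<zeta>))) \<delta>))" if \<zeta>: "norm \<zeta> = 1" for \<zeta>
    proof -
      define D where "D = max (infdist \<zeta> Z) \<delta>"
      have D: "D > 0" "\<delta> \<le> D" "infdist \<zeta> Z \<le> D" using \<delta> by (auto simp: D_def)
      define a where "a = max (norm (f (of_real r * \<zeta>))) \<delta>"
      have a: "a > 0" using \<delta> by (auto simp: a_def)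
      obtain \<alpha> where \<alpha>: "\<alpha> \<in> Z" "infdist \<zeta> Z = dist \<zeta> \<alpha>"
        using infdist_attains_inf[OF Z(1,2)] by blast
      obtain \<alpha>' where \<alpha>': "\<alpha>' \<in> A" "\<alpha> \<in> ball \<alpha>' (\<delta> / 2)" using A(3) \<alpha>(1) by auto
      obtain \<zeta>' where \<zeta>': "norm \<zeta>' = 1" "norm (\<zeta>' - \<alpha>') < \<delta> / 2" "norm (f (of_real r * \<zeta>')) < \<delta> / 2"
        using near[OF \<alpha>'(1)] by blast
      have "dist \<zeta> \<zeta>' \<le> dist \<zeta> \<alpha> + dist \<alpha> \<alpha>' + dist \<alpha>' \<zeta>'"
        using dist_triangle[of \<zeta> \<zeta>' \<alpha>] dist_triangle[of \<alpha> \<zeta>' \<alpha>'] by linarith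
      moreover have "dist \<alpha> \<alpha>' < \<delta> / 2" using \<alpha>'(2) by (simp add: dist_commute)
      moreover have "dist \<alpha>' \<zeta>' < \<delta> / 2" using \<zeta>'(2) by (simp add: dist_norm norm_minus_commute)
      ultimately have "norm (\<zeta> - \<zeta>') < 3 * D" using D \<alpha>(2) unfolding dist_norm by linarith
      from norm_increment_le_local_integral[OF f _ r(3) \<zeta> \<zeta>'(1) this]
      have "ennreal (norm (f (of_real r * \<zeta>) - f (of_real r * \<zeta>'))) \<le> ennreal (2 * pi) * emeasure \<tau> (ball \<zeta> (3 * D))"
        using r by (simp add: \<tau>em)
      also have "\<dots> \<le> ennreal (2 * pi) * (ennreal (3 * D) * maximal_function \<tau> \<zeta>)"
        using D by (intro mult_left_mono emeasure_ball_le_maximal) auto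
      also have "\<dots> = ennreal (2 * pi * (3 * D)) * maximal_function \<tau> \<zeta>"
        using D by (simp add: mult.assoc[symmetric] flip: ennreal_mult)
      also have "\<dots> \<le> ennreal (24 * D) * maximal_function \<tau> \<zeta>"
        using pi_less_4 D by (intro mult_right_mono ennreal_leI) auto
      finally have incr: "ennreal (norm (f (of_real r * \<zeta>) - f (of_real r * \<zeta>'))) \<le> ennreal (24 * D) * maximal_function \<tau> \<zeta>" .
      have "a \<le> norm (f (of_real r * \<zeta>) - f (of_real r * \<zeta>')) + D"
        using norm_triangle_ineq[of "f (of_real r * \<zeta>) - f (of_real r * \<zeta>')" "f (of_real r * \<zeta>')"] \<zeta>'(3) D \<delta>
        by (auto simp: a_def max_def intro: add_increasing)
      then have "ennreal a \<le> ennreal (norm (f (of_real r * \<zeta>) - f (of_real r * \<zeta>'))) + ennreal (24 * D)"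
        using D by (simp add: ennreal_leI flip: ennreal_plus)
      also have "\<dots> \<le> ennreal (24 * D) * maximal_function \<tau> \<zeta> + ennreal (24 * D)"
        by (intro add_right_mono incr)
      also have "\<dots> = ennreal (24 * D) * (1 + maximal_function \<tau> \<zeta>)"
        by (simp add: distrib_left add.commute)
      finally have "ennreal (1 / (24 * D)) * ennreal a \<le> ennreal (1 / (24 * D)) * (ennreal (24 * D) * (1 + maximal_function \<tau> \<zeta>))"
        by (rule mult_left_mono) simp
      also have "\<dots> = 1 + maximal_function \<tau> \<zeta>"
        using D by (simp add: mult.assoc[symmetric] flip: ennreal_mult)
      finally have "ennreal (a / (24 * D)) \<le> 1 + maximal_function \<tau> \<zeta>"
        using D a by (simp flip: ennreal_mult)
      then have lnL: "ennreal (ln (a / (24 * D))) \<le> L \<zeta>" using D a by (intro L(3)) auto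
      have "- ln D = ln 24 + ln (a / (24 * D)) + - ln a"
        using D a by (simp add: ln_div ln_mult)
      then have "ennreal (- ln D) \<le> ennreal (ln 24 + ln (a / (24 * D))) + ennreal (- ln a)"
        using ennreal_add_le by metis
      also have "\<dots> \<le> ennreal (ln 24) + ennreal (ln (a / (24 * D))) + ennreal (- ln a)"
        by (intro add_right_mono ennreal_add_le)
      also have "\<dots> \<le> ennreal (ln 24) + L \<zeta> + ennreal (- ln a)"
        by (intro add_right_mono add_left_mono lnL)
      finally show ?thesis using nr[OF \<zeta>] by (simp add: D_def a_def F_def)
    qed
    have "(\<integral>\<^sup>+\<zeta>. ennreal (- ln (max (infdist \<zeta> Z) \<delta>)) \<partial>circle_measure)
        \<le> (\<integral>\<^sup>+\<zeta>. ennreal (ln 24) + L \<zeta> + ennreal (- ln (max (norm (F (of_real r * \<zeta>))) \<delta>)) \<partial>circle_measure)"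
      by (rule nn_integral_mono_AE, rule eventually_mono[OF AE_circle_measure ptw])
    also have "\<dots> = ennreal (ln 24) + (\<integral>\<^sup>+\<zeta>. L \<zeta> \<partial>circle_measure)
        + (\<integral>\<^sup>+\<zeta>. ennreal (- ln (max (norm (F (of_real r * \<zeta>))) \<delta>)) \<partial>circle_measure)"
      by (simp add: nn_integral_add)
    also have "(\<integral>\<^sup>+\<zeta>. ennreal (- ln (max (norm (F (of_real r * \<zeta>))) \<delta>)) \<partial>circle_measure)
        = (\<integral>\<^sup>+\<zeta>. ennreal (- ln (max (norm (f (of_real r * \<zeta>))) \<delta>)) \<partial>circle_measure)"
      by (rule nn_integral_cong_AE, rule eventually_mono[OF AE_circle_measure]) (simp add: F_def nr)
    also have "ennreal (ln 24) + (\<integral>\<^sup>+\<zeta>. L \<zeta> \<partial>circle_measure) + \<dots>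
        \<le> ennreal (ln 24) + ennreal (2 * (20 * C2 + 1)) + ennreal C1"
      using r \<delta> C1(4)[of r \<delta>] L(2) by (intro add_mono) auto
    also have "\<dots> = ennreal (ln 24 + 2 * (20 * C2 + 1) + C1)"
      using C1 C2 by (simp flip: ennreal_plus)
    finally show "(\<integral>\<^sup>+\<zeta>. ennreal (- ln (max (infdist \<zeta> Z) \<delta>)) \<partial>circle_measure)
        \<le> ennreal (ln 24 + 2 * (20 * C2 + 1) + C1)" .
  qed
qed

lemma log_distance_integrable:
  assumes C: "\<And>\<delta>. 0 < \<delta> \<Longrightarrow> \<delta> \<le> 1 \<Longrightarrow>
    (\<integral>\<^sup>+\<zeta>. ennreal (- ln (max (infdist \<zeta> Z) \<delta>)) \<partial>circle_measure) \<le> ennreal C"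
  obtains h where "integrable circle_measure h"
    "AE \<zeta> in circle_measure. \<forall>\<delta>. 0 < \<delta> \<longrightarrow> \<delta> \<le> 1 \<longrightarrow> - ln (max (infdist \<zeta> Z) \<delta>) \<le> h \<zeta>"
proof -
  define u where "u n \<zeta> = ennreal (- ln (max (infdist \<zeta> Z) (1 / (real n + 1))))" for n :: nat and \<zeta>
  have [measurable]: "(\<lambda>\<zeta>. infdist \<zeta> Z) \<in> borel_measurable borel"
    by (intro borel_measurable_continuous_onI continuous_intros)
  have um [measurable]: "u n \<in> borel_measurable borel" for n unfolding u_def by measurable
  have pos: "max (infdist \<zeta> Z) (1 / (real n + 1)) > 0" for \<zeta> and n :: nat by (simp add: less_max_iff_disj)
  have "incseq u"
  proof (intro incseq_SucI le_funI)
    fix n \<zeta>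
    have "1 / (real (Suc n) + 1) \<le> 1 / (real n + 1)" by (intro divide_left_mono) auto
    then have "ln (max (infdist \<zeta> Z) (1 / (real (Suc n) + 1))) \<le> ln (max (infdist \<zeta> Z) (1 / (real n + 1)))"
      using pos[of \<zeta> "Suc n"] pos[of \<zeta> n] by (subst ln_le_cancel_iff) auto
    then show "u n \<zeta> \<le> u (Suc n) \<zeta>" unfolding u_def by (intro ennreal_leI) simp
  qed
  then have "(\<integral>\<^sup>+\<zeta>. (SUP n. u n \<zeta>) \<partial>circle_measure) = (SUP n. \<integral>\<^sup>+\<zeta>. u n \<zeta> \<partial>circle_measure)"
    by (intro nn_integral_monotone_convergence_SUP) auto
  also have "\<dots> \<le> ennreal C" unfolding u_def by (intro SUP_least C) auto
  finally have fin: "(\<integral>\<^sup>+\<zeta>. (SUP n. u n \<zeta>) \<partial>circle_measure) < \<infinity>"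
    using ennreal_less_top le_less_trans by (metis infinity_ennreal_def)
  have ae: "AE \<zeta> in circle_measure. (SUP n. u n \<zeta>) \<noteq> \<infinity>"
    using fin by (intro nn_integral_noteq_infinite) auto
  define h where "h \<zeta> = enn2real (SUP n. u n \<zeta>)" for \<zeta>
  have hm [measurable]: "h \<in> borel_measurable borel" unfolding h_def by measurable
  have heq: "AE \<zeta> in circle_measure. ennreal (h \<zeta>) = (SUP n. u n \<zeta>)"
    using ae by eventually_elim (metis ennreal_enn2real h_def infinity_ennreal_def less_top)
  have h0: "0 \<le> h \<zeta>" for \<zeta> by (simp add: h_def)
  show thesis
  proof
    show "integrable circle_measure h"
    proof (rule integrableI_nonneg)
      have "(\<integral>\<^sup>+\<zeta>. ennreal (h \<zeta>) \<partial>circle_measure) = (\<integral>\<^sup>+\<zeta>. (SUP n. u n \<zeta>) \<partial>circle_measure)"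
        by (rule nn_integral_cong_AE[OF heq])
      then show "(\<integral>\<^sup>+\<zeta>. ennreal (h \<zeta>) \<partial>circle_measure) < \<infinity>" using fin by simp
    qed (auto simp: h0)
    show "AE \<zeta> in circle_measure. \<forall>\<delta>. 0 < \<delta> \<longrightarrow> \<delta> \<le> 1 \<longrightarrow> - ln (max (infdist \<zeta> Z) \<delta>) \<le> h \<zeta>"
      using heq
    proof eventually_elim
      case (elim \<zeta>)
      show ?case
      proof (intro allI impI)
        fix \<delta> :: real assume \<delta>: "0 < \<delta>" "\<delta> \<le> 1"
        obtain n :: nat where "inverse (real (Suc n)) < \<delta>" using reals_Archimedean \<delta> by blast
        then have n: "1 / (real n + 1) \<le> \<delta>" by (simp add: inverse_eq_divide add.commute)
        have "ln (max (infdist \<zeta> Z) (1 / (real n + 1))) \<le> ln (max (infdist \<zeta> Z) \<delta>)"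
          using n pos[of \<zeta> n] \<delta> by (subst ln_le_cancel_iff) auto
        then have "ennreal (- ln (max (infdist \<zeta> Z) \<delta>)) \<le> u n \<zeta>"
          unfolding u_def by (intro ennreal_leI) simp
        also have "\<dots> \<le> (SUP n. u n \<zeta>)" by (rule SUP_upper) simp
        finally show "- ln (max (infdist \<zeta> Z) \<delta>) \<le> h \<zeta>"
          using h0[of \<zeta>] by (simp add: elim[symmetric] ennreal_le_iff)
      qed
    qed
  qed
qed

section \<open>Supports of measures\<close>

definition measure_support :: "complex measure \<Rightarrow> complex set" where
  "measure_support \<mu> = {\<alpha>. \<forall>\<epsilon>>0. emeasure \<mu> (ball \<alpha> \<epsilon>) > 0}"

lemma closed_measure_support:
  assumes "sets \<mu> = sets borel"
  shows "closed (measure_support \<mu>)"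
proof -
  have "open (- measure_support \<mu>)"
  proof (subst open_contains_ball, intro ballI)
    fix \<alpha> assume "\<alpha> \<in> - measure_support \<mu>"
    then obtain \<epsilon> where \<epsilon>: "\<epsilon> > 0" "emeasure \<mu> (ball \<alpha> \<epsilon>) = 0"
      by (auto simp: measure_support_def not_gr_zero)
    have "\<beta> \<notin> measure_support \<mu>" if "\<beta> \<in> ball \<alpha> \<epsilon>" for \<beta>
    proof -
      have "ball \<beta> (\<epsilon> - dist \<alpha> \<beta>) \<subseteq> ball \<alpha> \<epsilon>"
        by (auto simp: subset_iff) (smt (verit) dist_triangle)
      then have "emeasure \<mu> (ball \<beta> (\<epsilon> - dist \<alpha> \<beta>)) \<le> emeasure \<mu> (ball \<alpha> \<epsilon>)"
        by (intro emeasure_mono) (auto simp: assms)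
      then show ?thesis using \<epsilon> that by (auto simp: measure_support_def intro!: exI[of _ "\<epsilon> - dist \<alpha> \<beta>"])
    qed
    then show "\<exists>e>0. ball \<alpha> e \<subseteq> - measure_support \<mu>" using \<epsilon> by blast
  qed
  then show ?thesis by (simp add: closed_def)
qed

lemma AE_in_measure_support:
  assumes "sets \<mu> = sets borel"
  shows "AE \<zeta> in \<mu>. \<zeta> \<in> measure_support \<mu>"
proof -
  define \<F> where "\<F> = {ball \<alpha> \<epsilon> |\<alpha> \<epsilon>. emeasure \<mu> (ball \<alpha> \<epsilon>) = 0}"
  obtain \<F>' where F': "\<F>' \<subseteq> \<F>" "countable \<F>'" "\<Union>\<F>' = \<Union>\<F>"
    using Lindelof[of \<F>] by (auto simp: \<F>_def)
  have "\<Union>\<F>' \<in> null_sets \<mu>"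
    using F' by (intro null_sets_UN'[where N = "\<lambda>x. x" and I = \<F>', simplified]) (auto simp: \<F>_def assms intro!: null_setsI)
  then have "AE \<zeta> in \<mu>. \<zeta> \<notin> \<Union>\<F>" unfolding F'(3) by (rule AE_not_in)
  then show ?thesis
  proof eventually_elim
    case (elim \<zeta>)
    show ?case
    proof (rule ccontr)
      assume "\<zeta> \<notin> measure_support \<mu>"
      then obtain \<epsilon> where "\<epsilon> > 0" "emeasure \<mu> (ball \<zeta> \<epsilon>) = 0"
        by (auto simp: measure_support_def not_gr_zero)
      then have "ball \<zeta> \<epsilon> \<in> \<F>" "\<zeta> \<in> ball \<zeta> \<epsilon>" by (auto simp: \<F>_def)
      then show False using elim by blast
    qed
  qed
qed

lemma measure_support_subset_sphere:
  assumes "circle_borel \<mu>"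
  shows "measure_support \<mu> \<subseteq> sphere 0 1"
proof
  fix \<alpha> assume \<alpha>: "\<alpha> \<in> measure_support \<mu>"
  show "\<alpha> \<in> sphere 0 1"
  proof (rule ccontr)
    assume "\<alpha> \<notin> sphere 0 1"
    then have "\<alpha> \<in> - sphere 0 1" "open (- sphere (0::complex) 1)" by auto
    then obtain \<epsilon> where \<epsilon>: "\<epsilon> > 0" "ball \<alpha> \<epsilon> \<subseteq> - sphere 0 1" by (metis openE)
    have "AE \<zeta> in \<mu>. \<zeta> \<notin> ball \<alpha> \<epsilon>"
      using circle_borel_AE[OF assms] by eventually_elim (use \<epsilon> in auto)
    then have "emeasure \<mu> (ball \<alpha> \<epsilon>) = 0"
      by (subst (asm) AE_iff_measurable[of "ball \<alpha> \<epsilon>"]) (auto simp: circle_borel_sets[OF assms] circle_borel_space[OF assms])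
    then show False using \<alpha> \<epsilon> by (auto simp: measure_support_def)
  qed
qed

section \<open>The Wronskian\<close>

definition wronskian_mat :: "(nat \<Rightarrow> complex \<Rightarrow> complex) \<Rightarrow> nat \<Rightarrow> complex \<Rightarrow> complex mat" where
  "wronskian_mat f N z = mat N N (\<lambda>(i, j). (deriv ^^ i) (f j) z)"

lemma wronskian_mat_carrier [simp]: "wronskian_mat f N z \<in> carrier_mat N N"
  by (simp add: wronskian_mat_def)

lemma wronskian_mat_index [simp]:
  "i < N \<Longrightarrow> j < N \<Longrightarrow> wronskian_mat f N z $$ (i, j) = (deriv ^^ i) (f j) z"
  by (simp add: wronskian_mat_def)

lemma wronskian_mat_dim [simp]: "dim_row (wronskian_mat f N z) = N" "dim_col (wronskian_mat f N z) = N"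
  by (simp_all add: wronskian_mat_def)

lemma norm_prod_le_power:
  fixes a :: "nat \<Rightarrow> complex"
  assumes "\<And>i. i \<in> I \<Longrightarrow> norm (a i) \<le> b" "1 \<le> b" "finite I" "card I \<le> N"
  shows "norm (\<Prod>i\<in>I. a i) \<le> b ^ N"
proof -
  have "norm (\<Prod>i\<in>I. a i) \<le> (\<Prod>i\<in>I. b)"
    unfolding prod_norm[symmetric] using assms by (intro prod_mono) auto
  also have "\<dots> = b ^ card I" by simp
  also have "\<dots> \<le> b ^ N" using assms by (intro power_increasing) auto
  finally show ?thesis .
qed

lemma permutes_lessThan: "p permutes {0..<m} \<Longrightarrow> i < m \<Longrightarrow> p i < (m::nat)"
  using permutes_in_image[of p "{0..<m}" i] by simp

lemma abs_real_sign [simp]: "\<bar>real_of_int (sign p)\<bar> = 1"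
  by (simp add: sign_def)

lemma norm_det_le:
  fixes A :: "complex mat"
  assumes A: "A \<in> carrier_mat m m" and le: "\<And>i j. i < m \<Longrightarrow> j < m \<Longrightarrow> norm (A $$ (i, j)) \<le> b" and b: "1 \<le> b"
  shows "norm (det A) \<le> fact m * b ^ m"
proof -
  have "norm (det A) \<le> (\<Sum>p\<in>{p. p permutes {0..<m}}. norm (signof p * (\<Prod>i = 0..<m. A $$ (i, p i))))"
    unfolding det_def'[OF A] by (rule norm_sum)
  also have "\<dots> \<le> (\<Sum>p\<in>{p. p permutes {0..<m}}. b ^ m)"
  proof (rule sum_mono)
    fix p assume p: "p \<in> {p. p permutes {0..<m}}"
    have "norm (\<Prod>i = 0..<m. A $$ (i, p i)) \<le> b ^ m"
      using p b by (intro norm_prod_le_power le) (auto simp: permutes_lessThan)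
    then show "norm (signof p * (\<Prod>i = 0..<m. A $$ (i, p i))) \<le> b ^ m" by (simp add: norm_mult)
  qed
  also have "\<dots> = fact m * b ^ m"
    by (simp add: card_permutations)
  finally show ?thesis .
qed

lemma norm_cofactor_le:
  fixes A :: "complex mat"
  assumes A: "A \<in> carrier_mat m m" and le: "\<And>i j. i < m \<Longrightarrow> j < m \<Longrightarrow> norm (A $$ (i, j)) \<le> b" and b: "1 \<le> b"
    and ij: "i < m" "j < m"
  shows "norm (cofactor A i j) \<le> fact m * b ^ m"
proof -
  have "norm (cofactor A i j) = norm (det (mat_delete A i j))"
    by (simp add: cofactor_def norm_mult norm_power)
  also have "\<dots> \<le> fact (m - 1) * b ^ (m - 1)"
  proof (rule norm_det_le[OF _ _ b])
    show "mat_delete A i j \<in> carrier_mat (m - 1) (m - 1)"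
      by (rule mat_delete_carrier[OF A])
    fix i' j' assume ij': "i' < m - 1" "j' < m - 1"
    then show "norm (mat_delete A i j $$ (i', j')) \<le> b"
      using A by (auto simp: mat_delete_def intro!: le)
  qed
  also have "\<dots> \<le> fact m * b ^ m"
    using b by (intro mult_mono fact_mono power_increasing) auto
  finally show ?thesis .
qed

lemma sum_cofactor_row:
  fixes A :: "complex mat"
  assumes A: "A \<in> carrier_mat m m" and "i < m" "k < m"
  shows "(\<Sum>j<m. A $$ (i, j) * cofactor A k j) = (if i = k then det A else 0)"
proof -
  have "(A * adj_mat A) $$ (i, k) = (\<Sum>j<m. A $$ (i, j) * cofactor A k j)"
    using assms by (auto simp: adj_mat_def scalar_prod_def atLeast0LessThan intro!: sum.cong)
  then show ?thesis using assms adj_mat(2)[OF A] by (cases "i = k"; simp)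
qed

text \<open>
  Cramer's rule for the system whose unknowns are the \<open>l j\<close>.
\<close>

lemma det_mult_eq_sum_cofactor:
  fixes A :: "complex mat"
  assumes A: "A \<in> carrier_mat m m" and k: "k < m"
  shows "det A * l k = (\<Sum>i<m. cofactor A i k * (\<Sum>j<m. A $$ (i, j) * l j))"
proof -
  have col: "(\<Sum>i<m. cofactor A i k * A $$ (i, j)) = (if k = j then det A else 0)" if "j < m" for j
  proof -
    have "(adj_mat A * A) $$ (k, j) = (\<Sum>i<m. cofactor A i k * A $$ (i, j))"
      using A k that by (auto simp: adj_mat_def scalar_prod_def atLeast0LessThan intro!: sum.cong)
    then show ?thesis using k that adj_mat(3)[OF A] by (cases "k = j"; simp)
  qed
  have "(\<Sum>i<m. cofactor A i k * (\<Sum>j<m. A $$ (i, j) * l j)) = (\<Sum>i<m. \<Sum>j<m. cofactor A i k * A $$ (i, j) * l j)"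
    by (simp add: sum_distrib_left mult.assoc)
  also have "\<dots> = (\<Sum>j<m. \<Sum>i<m. cofactor A i k * A $$ (i, j) * l j)"
    by (rule sum.swap)
  also have "\<dots> = (\<Sum>j<m. (if k = j then det A else 0) * l j)"
    by (intro sum.cong) (simp_all add: sum_distrib_right[symmetric] col)
  also have "\<dots> = det A * l k" using k by (simp add: if_distrib[of "\<lambda>x. x * _"] cong: if_cong)
  finally show ?thesis by simp
qed

lemma holomorphic_det:
  fixes a :: "nat \<Rightarrow> nat \<Rightarrow> complex \<Rightarrow> complex"
  assumes "\<And>i j. i < m \<Longrightarrow> j < m \<Longrightarrow> a i j holomorphic_on S"
  shows "(\<lambda>z. det (mat m m (\<lambda>(i, j). a i j z))) holomorphic_on S"
proof -
  have "(\<lambda>z. \<Sum>p\<in>{p. p permutes {0..<m}}. signof p * (\<Prod>i = 0..<m. a i (p i) z)) holomorphic_on S"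
    by (intro holomorphic_intros assms) (auto simp: permutes_lessThan)
  also have "(\<lambda>z. \<Sum>p\<in>{p. p permutes {0..<m}}. signof p * (\<Prod>i = 0..<m. a i (p i) z))
      = (\<lambda>z. det (mat m m (\<lambda>(i, j). a i j z)))"
  proof
    fix z
    show "(\<Sum>p\<in>{p. p permutes {0..<m}}. signof p * (\<Prod>i = 0..<m. a i (p i) z)) = det (mat m m (\<lambda>(i, j). a i j z))"
      unfolding det_def'[OF mat_carrier]
      by (intro sum.cong arg_cong2[where f = "(*)"] prod.cong refl) (auto simp: permutes_lessThan)
  qed
  finally show ?thesis .
qed

lemma holomorphic_cofactor_wronskian:
  assumes f: "\<And>j. j < m \<Longrightarrow> f j holomorphic_on ball 0 1"
  shows "(\<lambda>z. cofactor (wronskian_mat f m z) i j) holomorphic_on ball 0 1"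
proof -
  define a where "a i' j' = (deriv ^^ (if i' < i then i' else Suc i')) (f (if j' < j then j' else Suc j'))" for i' j'
  have "mat_delete (wronskian_mat f m z) i j = mat (m - 1) (m - 1) (\<lambda>(i', j'). a i' j' z)" for z
    by (rule eq_matI) (auto simp: mat_delete_def a_def)
  moreover have "(\<lambda>z. det (mat (m - 1) (m - 1) (\<lambda>(i', j'). a i' j' z))) holomorphic_on ball 0 1"
    unfolding a_def by (intro holomorphic_det holomorphic_higher_deriv f) auto
  ultimately show ?thesis unfolding cofactor_def by (intro holomorphic_intros) simp
qed

lemma holomorphic_wronskian:
  assumes "\<And>j. j < m \<Longrightarrow> f j holomorphic_on ball 0 1"
  shows "(\<lambda>z. det (wronskian_mat f m z)) holomorphic_on ball 0 1"
  unfolding wronskian_mat_def by (intro holomorphic_det holomorphic_higher_deriv assms) auto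

lemma higher_deriv_has_field_derivative:
  assumes "g holomorphic_on ball 0 1" "z \<in> ball 0 1"
  shows "((deriv ^^ i) g has_field_derivative (deriv ^^ Suc i) g z) (at z)"
  using holomorphic_derivI[OF holomorphic_higher_deriv[OF assms(1) open_ball] open_ball assms(2), of i]
  by simp

text \<open>
  If the larger Wronskian vanishes identically, then near \<open>z\<^sub>0\<close> the cofactors of its last row, divided by
  the last of them, are coefficients \<open>c\<^sub>j\<close> of a linear relation between its columns with \<open>c\<^sub>k\<^sub>+\<^sub>1 = 1\<close>. Differentiating this relation
  shows that the derivatives of the \<open>c\<^sub>j\<close> solve a homogeneous system with the smaller Wronskian as determinant. So
  the \<open>c\<^sub>j\<close> are constant, contrary to linear independence.
\<close>

lemma wronskian_nonzero_step:
  assumes f: "\<And>j. j \<le> n \<Longrightarrow> f j holomorphic_on ball 0 1" and ind: "lin_indep_on_disk n f"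
    and k: "Suc k \<le> n" and z0: "z0 \<in> ball 0 1" "det (wronskian_mat f (Suc k) z0) \<noteq> 0"
  shows "\<exists>z\<in>ball 0 1. det (wronskian_mat f (Suc (Suc k)) z) \<noteq> 0"
proof (rule ccontr)
  assume "\<not> ?thesis"
  then have W0: "det (wronskian_mat f (Suc (Suc k)) z) = 0" if "z \<in> ball 0 1" for z using that by blast
  define A where "A z = wronskian_mat f (Suc (Suc k)) z" for z
  define C where "C j z = cofactor (A z) (Suc k) j" for j z
  define W where "W z = det (wronskian_mat f (Suc k) z)" for z
  have Chol: "C j holomorphic_on ball 0 1" for j
    unfolding C_def A_def using f k by (intro holomorphic_cofactor_wronskian) auto
  have Whol: "W holomorphic_on ball 0 1"
    unfolding W_def using f k by (intro holomorphic_wronskian) auto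
  have CW: "C (Suc k) z = W z" for z
  proof -
    have "mat_delete (A z) (Suc k) (Suc k) = wronskian_mat f (Suc k) z"
      by (rule eq_matI) (auto simp: mat_delete_def A_def)
    then show ?thesis by (simp add: C_def W_def cofactor_def)
  qed
  have rel: "(\<Sum>j<Suc (Suc k). (deriv ^^ i) (f j) z * C j z) = 0" if "i < Suc (Suc k)" "z \<in> ball 0 1" for i z
    using sum_cofactor_row[of "A z" "Suc (Suc k)" i "Suc k"] that W0[OF that(2)]
    by (simp add: A_def C_def del: sum.lessThan_Suc)
  have "open ({z \<in> ball 0 1. W z \<noteq> 0})"
  proof -
    have "open (ball 0 1 \<inter> W -` (- {0}))"
      using Whol by (intro continuous_open_preimage holomorphic_on_imp_continuous_on) auto
    moreover have "ball 0 1 \<inter> W -` (- {0}) = {z \<in> ball 0 1. W z \<noteq> 0}" by auto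
    ultimately show ?thesis by simp
  qed
  moreover have "z0 \<in> {z \<in> ball 0 1. W z \<noteq> 0}" using z0 by (simp add: W_def)
  ultimately obtain e where e: "e > 0" "ball z0 e \<subseteq> {z \<in> ball 0 1. W z \<noteq> 0}" by (metis openE)
  define c where "c j z = C j z / W z" for j z
  have chol: "c j holomorphic_on ball z0 e" for j
  proof -
    have "ball z0 e \<subseteq> ball 0 1" using e by auto
    then have "C j holomorphic_on ball z0 e" "W holomorphic_on ball z0 e"
      by (rule holomorphic_on_subset[OF Chol], rule holomorphic_on_subset[OF Whol])
    then show ?thesis unfolding c_def using e by (intro holomorphic_on_divide) auto
  qed
  have crel: "(\<Sum>j<Suc (Suc k). (deriv ^^ i) (f j) z * c j z) = 0" if "i < Suc (Suc k)" "z \<in> ball z0 e" for i z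
  proof -
    have "(\<Sum>j<Suc (Suc k). (deriv ^^ i) (f j) z * c j z) = (\<Sum>j<Suc (Suc k). (deriv ^^ i) (f j) z * C j z) / W z"
      by (simp add: c_def sum_divide_distrib del: sum.lessThan_Suc)
    then show ?thesis using rel[OF that(1), of z] that e by (auto simp del: sum.lessThan_Suc)
  qed
  have c1: "c (Suc k) z = 1" if "z \<in> ball z0 e" for z
    using that e CW[of z] by (auto simp: c_def)
  have dc: "deriv (c j) z = 0" if j: "j < Suc k" and z: "z \<in> ball z0 e" for j z
  proof -
    have zb: "z \<in> ball 0 1" using z e by auto
    have dcz: "(c j has_field_derivative deriv (c j) z) (at z)" for j
      by (rule holomorphic_derivI[OF chol open_ball z])
    \<comment> \<open>This is why the vector of derivatives has one nontrivial component less than the relation.\<close>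
    have last: "deriv (c (Suc k)) z = 0"
    proof -
      have "((\<lambda>_. 1) has_field_derivative deriv (c (Suc k)) z) (at z)"
        by (rule has_field_derivative_transform_within_open[OF dcz open_ball z c1])
      moreover have "((\<lambda>_. 1 :: complex) has_field_derivative 0) (at z)" by (rule DERIV_const)
      ultimately show ?thesis by (rule DERIV_unique)
    qed
    have zero: "(\<Sum>j<Suc k. (deriv ^^ i) (f j) z * deriv (c j) z) = 0" if i: "i < Suc k" for i
    proof -
      have "((\<lambda>z. \<Sum>j<Suc (Suc k). (deriv ^^ i) (f j) z * c j z) has_field_derivative
          (\<Sum>j<Suc (Suc k). (deriv ^^ i) (f j) z * deriv (c j) z + (deriv ^^ Suc i) (f j) z * c j z)) (at z)"
      proof (rule DERIV_sum)
        fix j assume "j \<in> {..<Suc (Suc k)}"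
        then have "f j holomorphic_on ball 0 1" using f k by auto
        from DERIV_mult'[OF higher_deriv_has_field_derivative[OF this zb, of i] dcz[of j]]
        show "((\<lambda>z. (deriv ^^ i) (f j) z * c j z) has_field_derivative
            (deriv ^^ i) (f j) z * deriv (c j) z + (deriv ^^ Suc i) (f j) z * c j z) (at z)" .
      qed
      then have "((\<lambda>_. 0) has_field_derivative
          (\<Sum>j<Suc (Suc k). (deriv ^^ i) (f j) z * deriv (c j) z + (deriv ^^ Suc i) (f j) z * c j z)) (at z)"
        by (rule has_field_derivative_transform_within_open[OF _ open_ball z]) (rule crel, use i in auto)
      moreover have "((\<lambda>_. 0 :: complex) has_field_derivative 0) (at z)" by (rule DERIV_const)
      ultimately have "(\<Sum>j<Suc (Suc k). (deriv ^^ i) (f j) z * deriv (c j) z + (deriv ^^ Suc i) (f j) z * c j z) = 0"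
        by (rule DERIV_unique)
      then have "(\<Sum>j<Suc (Suc k). (deriv ^^ i) (f j) z * deriv (c j) z)
          + (\<Sum>j<Suc (Suc k). (deriv ^^ Suc i) (f j) z * c j z) = 0"
        by (simp only: sum.distrib)
      then have "(\<Sum>j<Suc (Suc k). (deriv ^^ i) (f j) z * deriv (c j) z) = 0"
        using crel[of "Suc i" z] i z by (simp del: sum.lessThan_Suc funpow.simps)
      then show ?thesis using last by simp
    qed
    have "det (wronskian_mat f (Suc k) z) * deriv (c j) z
        = (\<Sum>i<Suc k. cofactor (wronskian_mat f (Suc k) z) i j * (\<Sum>j<Suc k. wronskian_mat f (Suc k) z $$ (i, j) * deriv (c j) z))"
      by (rule det_mult_eq_sum_cofactor) (use j in auto)
    also have "\<dots> = 0"
    proof (intro sum.neutral ballI)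
      fix i assume i: "i \<in> {..<Suc k}"
      have "(\<Sum>j<Suc k. wronskian_mat f (Suc k) z $$ (i, j) * deriv (c j) z) = (\<Sum>j<Suc k. (deriv ^^ i) (f j) z * deriv (c j) z)"
        using i by (intro sum.cong) auto
      then show "cofactor (wronskian_mat f (Suc k) z) i j * (\<Sum>j<Suc k. wronskian_mat f (Suc k) z $$ (i, j) * deriv (c j) z) = 0"
        using zero i by (simp del: sum.lessThan_Suc)
    qed
    finally show ?thesis using z e by (auto simp: W_def)
  qed
  have cconst: "c j z = c j z0" if "j < Suc (Suc k)" "z \<in> ball z0 e" for j z
  proof (cases "j = Suc k")
    case True
    then show ?thesis using c1[OF that(2)] c1[of z0] e by simp
  next
    case False
    then have j: "j < Suc k" using that by simp
    have "(c j has_field_derivative 0) (at w within ball z0 e)" if "w \<in> ball z0 e" for w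
      using holomorphic_derivI[OF chol open_ball that, of j] dc[OF j that]
      by (auto intro: has_field_derivative_at_within)
    then obtain v where "\<And>w. w \<in> ball z0 e \<Longrightarrow> c j w = v"
      using has_field_derivative_zero_constant[OF convex_ball] by metis
    then show ?thesis using that e by simp
  qed
  define \<gamma> where "\<gamma> j = (if j < Suc (Suc k) then c j z0 else 0)" for j
  have sum0: "(\<Sum>j=0..n. \<gamma> j * f j z) = 0" if z: "z \<in> ball 0 1" for z
  proof -
    have hol: "(\<lambda>z. \<Sum>j=0..n. \<gamma> j * f j z) holomorphic_on ball 0 1"
      using f by (intro holomorphic_intros) auto
    show ?thesis
    proof (rule analytic_continuation[OF hol, of "ball z0 e" z0])
      show "(\<Sum>j=0..n. \<gamma> j * f j z) = 0" if z: "z \<in> ball z0 e" for z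
      proof -
        have "(\<Sum>j=0..n. \<gamma> j * f j z) = (\<Sum>j<Suc (Suc k). \<gamma> j * f j z)"
          using k by (intro sum.mono_neutral_right) (auto simp: \<gamma>_def)
        also have "\<dots> = (\<Sum>j<Suc (Suc k). (deriv ^^ 0) (f j) z * c j z)"
          by (intro sum.cong) (auto simp: \<gamma>_def cconst[OF _ z])
        also have "\<dots> = 0" by (rule crel) (use z in auto)
        finally show ?thesis .
      qed
    qed (use z z0 e in \<open>auto simp: islimpt_ball\<close>)
  qed
  have "\<gamma> (Suc k) = 0"
    using ind sum0 k unfolding lin_indep_on_disk_def by blast
  moreover have "\<gamma> (Suc k) = 1" using c1[of z0] e by (simp add: \<gamma>_def)
  ultimately show False by simp
qed

lemma wronskian_nonzero:
  assumes f: "\<And>j. j \<le> n \<Longrightarrow> f j holomorphic_on ball 0 1" and ind: "lin_indep_on_disk n f"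
  shows "\<exists>z\<in>ball 0 1. det (wronskian_mat f (Suc n) z) \<noteq> 0"
proof -
  have "\<exists>z\<in>ball 0 1. det (wronskian_mat f (Suc k) z) \<noteq> 0" if "k \<le> n" for k
    using that
  proof (induction k)
    case 0
    have "\<exists>z\<in>ball 0 1. f 0 z \<noteq> 0"
    proof (rule ccontr)
      assume "\<not> ?thesis"
      then have "\<forall>z\<in>ball 0 1. (\<Sum>j=0..n. (if j = 0 then 1 else 0) * f j z) = 0"
        by (simp add: if_distrib[of "\<lambda>x. x * _"] cong: if_cong)
      then have "\<forall>j\<le>n. (if j = 0 then 1 else 0 :: complex) = 0"
        using ind[unfolded lin_indep_on_disk_def, THEN spec[of _ "\<lambda>j. if j = 0 then 1 else 0"]] by blast
      then show False by (metis le0 zero_neq_one)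
    qed
    moreover have "det (wronskian_mat f (Suc 0) z) = f 0 z" for z
      using det_single[of "wronskian_mat f (Suc 0) z"] by (simp add: wronskian_mat_def)
    ultimately show ?case by simp
  next
    case (Suc k)
    then obtain z0 where "z0 \<in> ball 0 1" "det (wronskian_mat f (Suc k) z0) \<noteq> 0" by auto
    then show ?case using wronskian_nonzero_step[OF f ind Suc.prems] by blast
  qed
  then show ?thesis by blast
qed

lemma mean_bounded_dominated:
  fixes g :: "nat \<Rightarrow> complex \<Rightarrow> complex"
  assumes g: "\<And>j. j < N \<Longrightarrow> g j holomorphic_on ball 0 1" "\<And>j. j < N \<Longrightarrow> mean_bounded (g j)"
    and c: "c \<ge> 0" and le: "\<And>z. norm z < 1 \<Longrightarrow> norm (G z) \<le> c * (\<Sum>j<N. norm (g j z))"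
  shows "mean_bounded G"
proof -
  have "\<forall>j. \<exists>C\<ge>0. j < N \<longrightarrow> (\<forall>r\<in>{0..<1}. (\<integral>\<^sup>+\<xi>. ennreal (norm (g j (of_real r * \<xi>))) \<partial>circle_measure) \<le> ennreal C)"
    using g(2) unfolding mean_bounded_def by (metis order_refl)
  then obtain C where C: "\<And>j. C j \<ge> 0"
    "\<And>j r. j < N \<Longrightarrow> r \<in> {0..<1} \<Longrightarrow> (\<integral>\<^sup>+\<xi>. ennreal (norm (g j (of_real r * \<xi>))) \<partial>circle_measure) \<le> ennreal (C j)"
    by metis
  define g' where "g' j z = (if norm z < 1 then g j z else 0)" for j z
  have [measurable]: "g' j \<in> borel_measurable borel" if "j < N" for j
    using measurable_on_disk[OF g(1)[OF that]] by (simp add: g'_def[abs_def])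
  show ?thesis
    unfolding mean_bounded_def
  proof (intro exI conjI ballI)
    show "0 \<le> c * (\<Sum>j<N. C j)" using c C by (simp add: sum_nonneg)
    fix r :: real assume r: "r \<in> {0..<1}"
    have nr: "norm (of_real r * \<xi>) < 1" if "norm \<xi> = 1" for \<xi> :: complex
      using r that by (simp add: norm_mult)
    have "(\<integral>\<^sup>+\<xi>. ennreal (norm (G (of_real r * \<xi>))) \<partial>circle_measure)
        \<le> (\<integral>\<^sup>+\<xi>. ennreal c * (\<Sum>j<N. ennreal (norm (g' j (of_real r * \<xi>)))) \<partial>circle_measure)"
    proof (rule nn_integral_mono_AE, rule eventually_mono[OF AE_circle_measure])
      fix \<xi> :: complex assume \<xi>: "norm \<xi> = 1"
      have "norm (G (of_real r * \<xi>)) \<le> c * (\<Sum>j<N. norm (g' j (of_real r * \<xi>)))"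
        using le[OF nr[OF \<xi>]] nr[OF \<xi>] by (simp add: g'_def)
      then show "ennreal (norm (G (of_real r * \<xi>))) \<le> ennreal c * (\<Sum>j<N. ennreal (norm (g' j (of_real r * \<xi>))))"
        using c by (simp add: ennreal_leI sum_nonneg flip: ennreal_mult)
    qed
    also have "\<dots> = ennreal c * (\<Sum>j<N. \<integral>\<^sup>+\<xi>. ennreal (norm (g' j (of_real r * \<xi>))) \<partial>circle_measure)"
    proof -
      have m: "(\<lambda>\<xi>. ennreal (norm (g' j (of_real r * \<xi>)))) \<in> borel_measurable circle_measure" if "j < N" for j
        using that by measurable
      then have "(\<lambda>\<xi>. \<Sum>j<N. ennreal (norm (g' j (of_real r * \<xi>)))) \<in> borel_measurable circle_measure"
        by (intro borel_measurable_sum) auto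
      then have "(\<integral>\<^sup>+\<xi>. ennreal c * (\<Sum>j<N. ennreal (norm (g' j (of_real r * \<xi>)))) \<partial>circle_measure)
          = ennreal c * (\<integral>\<^sup>+\<xi>. (\<Sum>j<N. ennreal (norm (g' j (of_real r * \<xi>)))) \<partial>circle_measure)"
        by (rule nn_integral_cmult)
      also have "(\<integral>\<^sup>+\<xi>. (\<Sum>j<N. ennreal (norm (g' j (of_real r * \<xi>)))) \<partial>circle_measure)
          = (\<Sum>j<N. \<integral>\<^sup>+\<xi>. ennreal (norm (g' j (of_real r * \<xi>))) \<partial>circle_measure)"
        using m by (intro nn_integral_sum) auto
      finally show ?thesis .
    qed
    also have "(\<Sum>j<N. \<integral>\<^sup>+\<xi>. ennreal (norm (g' j (of_real r * \<xi>))) \<partial>circle_measure)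
        = (\<Sum>j<N. \<integral>\<^sup>+\<xi>. ennreal (norm (g j (of_real r * \<xi>))) \<partial>circle_measure)"
      by (intro sum.cong refl nn_integral_cong_AE eventually_mono[OF AE_circle_measure]) (simp add: g'_def nr)
    also have "ennreal c * \<dots> \<le> ennreal c * (\<Sum>j<N. ennreal (C j))"
      using r by (intro mult_left_mono sum_mono C) auto
    also have "\<dots> = ennreal (c * (\<Sum>j<N. C j))"
      using c C by (simp add: ennreal_mult sum_nonneg)
    finally show "(\<integral>\<^sup>+\<xi>. ennreal (norm (G (of_real r * \<xi>))) \<partial>circle_measure) \<le> ennreal (c * (\<Sum>j<N. C j))" .
  qed
qed

text \<open>
  Every term of the Leibniz expansion contains exactly one factor from the last row; all the others are bounded.
\<close>

lemma mean_bounded_wronskian: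
  assumes f: "\<And>j. j \<le> n \<Longrightarrow> f j holomorphic_on ball 0 1"
    and low: "\<And>i j z. i < n \<Longrightarrow> j \<le> n \<Longrightarrow> norm z < 1 \<Longrightarrow> norm ((deriv ^^ i) (f j) z) \<le> B" and B: "1 \<le> B"
    and top: "\<And>j. j \<le> n \<Longrightarrow> mean_bounded ((deriv ^^ n) (f j))"
  shows "mean_bounded (\<lambda>z. det (wronskian_mat f (Suc n) z))"
proof (rule mean_bounded_dominated[where g = "\<lambda>j. (deriv ^^ n) (f j)" and N = "Suc n" and c = "fact (Suc n) * B ^ n"])
  fix z :: complex assume z: "norm z < 1"
  have "norm (det (wronskian_mat f (Suc n) z))
      \<le> (\<Sum>p\<in>{p. p permutes {0..<Suc n}}. norm (signof p * (\<Prod>i = 0..<Suc n. wronskian_mat f (Suc n) z $$ (i, p i))))"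
    unfolding det_def'[OF wronskian_mat_carrier] by (rule norm_sum)
  also have "\<dots> \<le> (\<Sum>p\<in>{p. p permutes {0..<Suc n}}. B ^ n * (\<Sum>j<Suc n. norm ((deriv ^^ n) (f j) z)))"
  proof (rule sum_mono)
    fix p assume "p \<in> {p. p permutes {0..<Suc n}}"
    then have p: "p i < Suc n" if "i < Suc n" for i using that by (simp add: permutes_lessThan)
    have "norm (signof p * (\<Prod>i = 0..<Suc n. wronskian_mat f (Suc n) z $$ (i, p i)))
        = norm (\<Prod>i = 0..<n. wronskian_mat f (Suc n) z $$ (i, p i)) * norm ((deriv ^^ n) (f (p n)) z)"
      using p[of n] by (simp add: norm_mult)
    also have "\<dots> \<le> B ^ n * (\<Sum>j<Suc n. norm ((deriv ^^ n) (f j) z))"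
    proof (rule mult_mono)
      show "norm (\<Prod>i = 0..<n. wronskian_mat f (Suc n) z $$ (i, p i)) \<le> B ^ n"
      proof (rule norm_prod_le_power[OF _ B])
        fix i assume "i \<in> {0..<n}"
        then show "norm (wronskian_mat f (Suc n) z $$ (i, p i)) \<le> B"
          using p[of i] low[of i "p i" z] z by simp
      qed auto
      show "norm ((deriv ^^ n) (f (p n)) z) \<le> (\<Sum>j<Suc n. norm ((deriv ^^ n) (f j) z))"
        using p[of n] by (intro member_le_sum) auto
    qed (use B in auto)
    finally show "norm (signof p * (\<Prod>i = 0..<Suc n. wronskian_mat f (Suc n) z $$ (i, p i)))
        \<le> B ^ n * (\<Sum>j<Suc n. norm ((deriv ^^ n) (f j) z))" .
  qed
  also have "\<dots> = fact (Suc n) * B ^ n * (\<Sum>j<Suc n. norm ((deriv ^^ n) (f j) z))"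
    by (simp add: card_permutations mult.assoc del: fact_Suc sum.lessThan_Suc)
  finally show "norm (det (wronskian_mat f (Suc n) z)) \<le> fact (Suc n) * B ^ n * (\<Sum>j<Suc n. norm ((deriv ^^ n) (f j) z))" .
qed (use f top B in \<open>auto intro!: holomorphic_higher_deriv mult_nonneg_nonneg\<close>)

section \<open>Functions with a given singular factor\<close>

lemma poisson_integral_le_total:
  assumes \<mu>: "circle_borel \<mu>" and z: "norm z < 1"
  shows "poisson_integral \<mu> (\<lambda>_. 1) z \<le> 2 / (1 - norm z) * measure \<mu> UNIV"
proof -
  interpret \<mu>: finite_measure \<mu> by (rule circle_borel_finite[OF \<mu>])
  have "poisson_integral \<mu> (\<lambda>_. 1) z \<le> (\<integral>\<xi>. 2 / (1 - norm z) \<partial>\<mu>)"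
    unfolding poisson_integral_def
  proof (rule integral_mono_AE)
    show "AE \<xi> in \<mu>. poisson_kernel z \<xi> * 1 \<le> 2 / (1 - norm z)"
      using circle_borel_AE[OF \<mu>] by eventually_elim (use poisson_kernel_le z in simp)
  qed (use integrable_poisson[OF \<mu>, of "\<lambda>_. 1" z] z in auto)
  then show ?thesis by (simp add: circle_borel_space[OF \<mu>] mult.commute)
qed

text \<open>
  For \<open>\<xi>\<close> in the support, \<open>|\<xi> - r \<zeta>|\<close> is at least half the distance of \<open>\<zeta>\<close> from the support, so the kernel is
  at most \<open>8 (1 - r)\<close> divided by the square of this distance.
\<close>

lemma poisson_integral_le_distance:
  assumes \<mu>: "circle_borel \<mu>" and \<zeta>: "norm \<zeta> = 1" and r: "0 \<le> r" "r < 1"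
    and near: "1 - r \<le> (infdist \<zeta> (measure_support \<mu>))\<^sup>2"
  shows "poisson_integral \<mu> (\<lambda>_. 1) (of_real r * \<zeta>) \<le> 8 * measure \<mu> UNIV"
proof -
  interpret \<mu>: finite_measure \<mu> by (rule circle_borel_finite[OF \<mu>])
  have nz: "norm (of_real r * \<zeta>) = r" using \<zeta> r by (simp add: norm_mult)
  define d where "d = infdist \<zeta> (measure_support \<mu>)"
  have d0: "d > 0" using near r infdist_nonneg[of \<zeta> "measure_support \<mu>"]
    unfolding d_def by (metis diff_gt_0_iff_gt le_less_trans less_le not_le power_zero_numeral)
  have "poisson_integral \<mu> (\<lambda>_. 1) (of_real r * \<zeta>) \<le> (\<integral>\<xi>. 8 \<partial>\<mu>)"
    unfolding poisson_integral_def
  proof (rule integral_mono_AE)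
    show "AE \<xi> in \<mu>. poisson_kernel (of_real r * \<zeta>) \<xi> * 1 \<le> 8"
      using circle_borel_AE[OF \<mu>] AE_in_measure_support[OF circle_borel_sets[OF \<mu>]]
    proof eventually_elim
      case (elim \<xi>)
      define x where "x = norm (\<xi> - of_real r * \<zeta>)"
      have x1: "1 - r \<le> x" using norm_diff_circle_ge[OF elim(1), of "of_real r * \<zeta>"] nz by (simp add: x_def)
      have "d \<le> norm (\<xi> - \<zeta>)"
        using infdist_le[OF elim(2), of \<zeta>] by (simp add: d_def dist_norm norm_minus_commute)
      also have "\<dots> \<le> x + norm (of_real r * \<zeta> - \<zeta>)"
        using norm_triangle_ineq[of "\<xi> - of_real r * \<zeta>" "of_real r * \<zeta> - \<zeta>"] by (simp add: x_def)
      also have "norm (of_real r * \<zeta> - \<zeta>) = 1 - r"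
        using norm_radial_diff[OF \<zeta>, of r] r by simp
      finally have "d \<le> 2 * x" using x1 by simp
      then have "d\<^sup>2 \<le> (2 * x)\<^sup>2" using d0 by (intro power_mono) auto
      then have dx: "d\<^sup>2 \<le> 4 * x\<^sup>2" by (simp add: power_mult_distrib)
      have "1 - r\<^sup>2 = (1 - r) * (1 + r)" by (simp add: power2_eq_square algebra_simps)
      also have "\<dots> \<le> (1 - r) * 2" using r by (intro mult_left_mono) auto
      also have "\<dots> \<le> 8 * x\<^sup>2" using near dx by (simp add: d_def)
      finally have "1 - r\<^sup>2 \<le> 8 * x\<^sup>2" .
      moreover have "x > 0" using x1 r by simp
      ultimately show ?case
        unfolding poisson_kernel_def nz x_def[symmetric] by (simp add: divide_le_eq)
    qed
  qed (use integrable_poisson[OF \<mu>, of "\<lambda>_. 1" "of_real r * \<zeta>"] nz r in auto)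
  then show ?thesis by (simp add: circle_borel_space[OF \<mu>] mult.commute)
qed

lemma norm_blaschke_factor_le:
  assumes a: "norm a < 1" and z: "norm z < 1"
  shows "norm (blaschke_factor a z) \<le> 1"
proof (cases "a = 0")
  case False
  have "(norm (1 - cnj a * z))\<^sup>2 - (norm (a - z))\<^sup>2 = (1 - (norm a)\<^sup>2) * (1 - (norm z)\<^sup>2)"
    unfolding cmod_power2 by (simp add: power2_eq_square algebra_simps)
  moreover have "(1 - (norm a)\<^sup>2) * (1 - (norm z)\<^sup>2) \<ge> 0"
    using a z by (intro mult_nonneg_nonneg) (auto simp: power_le_one)
  ultimately have "(norm (a - z))\<^sup>2 \<le> (norm (1 - cnj a * z))\<^sup>2" by linarith
  then have "norm (a - z) \<le> norm (1 - cnj a * z)" by (rule power2_le_imp_le) simp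
  then have "norm ((a - z) / (1 - cnj a * z)) \<le> 1"
    by (simp add: norm_divide divide_le_eq_1)
  then show ?thesis using False by (simp add: blaschke_factor_def norm_mult norm_divide)
qed (use z in \<open>simp add: blaschke_factor_def\<close>)

lemma norm_blaschke_product_le:
  assumes B: "blaschke_product B" and z: "norm z < 1"
  shows "norm (B z) \<le> 1"
proof -
  obtain K a where a': "\<forall>k\<in>K. norm (a k) < 1"
    and prod': "\<forall>z\<in>ball 0 1. (\<lambda>k. if k \<in> K then blaschke_factor (a k) z else 1) has_prod B z"
    using B unfolding blaschke_product_def by blast
  have a: "norm (a k) < 1" if "k \<in> K" for k using a' that by blast
  have prod: "(\<lambda>k. if k \<in> K then blaschke_factor (a k) z else 1) has_prod B z" using prod' z by simp
  define p where "p k = (if k \<in> K then blaschke_factor (a k) z else 1)" for k :: nat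
  have p1: "norm (p k) \<le> 1" for k using norm_blaschke_factor_le[OF a z] by (simp add: p_def)
  consider "raw_has_prod p 0 (B z)" | "B z = 0"
    using prod by (auto simp: has_prod_def p_def[abs_def])
  then show ?thesis
  proof cases
    case 1
    then have "(\<lambda>n. \<Prod>i\<le>n. p i) \<longlonglongrightarrow> B z" by (simp add: raw_has_prod_def)
    then have "(\<lambda>n. norm (\<Prod>i\<le>n. p i)) \<longlonglongrightarrow> norm (B z)" by (rule tendsto_norm)
    moreover have "norm (\<Prod>i\<le>n. p i) \<le> 1" for n
      unfolding prod_norm[symmetric] using p1 by (intro prod_le_1) auto
    ultimately show ?thesis by (intro LIMSEQ_le_const2) auto
  qed simp
qed

text \<open>
  The Blaschke product is bounded by \<open>1\<close>, and \<open>h\<close> is the absolute value of the logarithm of the boundary modulus of the outer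
  factor.
\<close>

lemma singular_factor_majorant:
  assumes S: "is_singular_factor T f"
  obtains \<mu> h where "singular_circle_measure \<mu>" "\<And>z. norm z < 1 \<Longrightarrow> T z = exp (- herglotz_integral \<mu> (\<lambda>_. 1) z)"
    "integrable circle_measure h" "\<And>\<zeta>. 0 \<le> h \<zeta>"
    "\<And>z. norm z < 1 \<Longrightarrow> norm (f z) \<le> exp (poisson_integral circle_measure h z - poisson_integral \<mu> (\<lambda>_. 1) z)"
proof -
  obtain c B F where cBF: "norm c = 1" "blaschke_product B" "outer_function F"
    "\<And>z. norm z < 1 \<Longrightarrow> f z = c * B z * T z * F z" and T: "singular_inner T"
    using S by (auto simp: is_singular_factor_def)
  obtain \<mu> where \<mu>: "singular_circle_measure \<mu>" "\<And>z. norm z < 1 \<Longrightarrow> T z = exp (- herglotz_integral \<mu> (\<lambda>_. 1) z)"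
    using T by (auto simp: singular_inner_def herglotz_integral_def herglotz_kernel_def)
  have \<mu>c: "circle_borel \<mu>" by (rule singular_circle_measure_imp_circle_borel[OF \<mu>(1)])
  obtain k where k: "integrable circle_measure (\<lambda>\<zeta>. ln (k \<zeta>))"
    and F: "\<forall>z\<in>ball 0 1. F z = exp (herglotz_integral circle_measure (\<lambda>\<zeta>. ln (k \<zeta>)) z)"
    using cBF(3) unfolding outer_function_def herglotz_integral_def herglotz_kernel_def by blast
  define h where "h \<zeta> = \<bar>ln (k \<zeta>)\<bar>" for \<zeta>
  have h: "integrable circle_measure h" unfolding h_def by (intro integrable_abs k)
  have h0: "0 \<le> h \<zeta>" for \<zeta> by (simp add: h_def)
  show thesis
  proof (rule that[OF \<mu> h h0])
    fix z :: complex assume z: "norm z < 1"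
    interpret finite_measure \<mu> by (rule circle_borel_finite[OF \<mu>c])
    have "norm (F z) = exp (poisson_integral circle_measure (\<lambda>\<zeta>. ln (k \<zeta>)) z)"
      using F z by (simp add: Re_herglotz_integral[OF circle_borel_circle_measure k z])
    also have "\<dots> \<le> exp (poisson_integral circle_measure h z)"
      unfolding poisson_integral_def exp_le_cancel_iff
      using integrable_poisson[OF circle_borel_circle_measure k z] integrable_poisson[OF circle_borel_circle_measure h z]
      by (intro integral_mono mult_left_mono poisson_kernel_nonneg z) (auto simp: h_def)
    finally have F: "norm (F z) \<le> exp (poisson_integral circle_measure h z)" .
    have Tz: "norm (T z) = exp (- poisson_integral \<mu> (\<lambda>_. 1) z)"
      using \<mu>(2)[OF z] Re_herglotz_integral[OF \<mu>c _ z, of "\<lambda>_. 1"] by simp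
    have "norm (f z) = norm (B z) * (norm (T z) * norm (F z))"
      by (simp add: cBF(4)[OF z] norm_mult cBF(1))
    also have "\<dots> \<le> 1 * (norm (T z) * exp (poisson_integral circle_measure h z))"
      by (intro mult_mono norm_blaschke_product_le cBF z F order_refl mult_nonneg_nonneg) auto
    also have "\<dots> = exp (poisson_integral circle_measure h z - poisson_integral \<mu> (\<lambda>_. 1) z)"
      by (simp add: Tz flip: exp_add)
    finally show "norm (f z) \<le> exp (poisson_integral circle_measure h z - poisson_integral \<mu> (\<lambda>_. 1) z)" .
  qed
qed

text \<open>
  If \<open>|f|\<close> were at least \<open>\<delta>\<close> near a point \<open>\<alpha>\<close> of the support on circles of radii arbitrarily close to
  \<open>1\<close>, then there the Poisson integral of \<open>\<mu>\<close> would be at most \<open>P h - ln \<delta>\<close>, a uniformly integrable bound,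
  and the singular measure \<open>\<mu>\<close> would vanish near \<open>\<alpha>\<close>.
\<close>

lemma log_distance_to_support_integrable:
  assumes f: "f holomorphic_on ball 0 1" and mb: "mean_bounded f" "mean_bounded (deriv f)"
    and z0: "norm z0 < 1" "f z0 \<noteq> 0" and sing: "singular_circle_measure \<mu>" and pos: "emeasure \<mu> UNIV > 0"
    and h: "integrable circle_measure h" "\<And>\<zeta>. 0 \<le> h \<zeta>"
    and le: "\<And>z. norm z < 1 \<Longrightarrow> norm (f z) \<le> exp (poisson_integral circle_measure h z - poisson_integral \<mu> (\<lambda>_. 1) z)"
  obtains g where "integrable circle_measure g"
    "AE \<zeta> in circle_measure. \<forall>\<delta>. 0 < \<delta> \<longrightarrow> \<delta> \<le> 1 \<longrightarrow> - ln (max (infdist \<zeta> (measure_support \<mu>)) \<delta>) \<le> g \<zeta>"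
proof -
  have \<mu>: "circle_borel \<mu>" by (rule singular_circle_measure_imp_circle_borel[OF sing])
  interpret \<mu>: finite_measure \<mu> by (rule circle_borel_finite[OF \<mu>])
  obtain N where N: "N \<in> sets borel" "emeasure circle_measure N = 0" "emeasure \<mu> (- N) = 0"
    using sing by (auto simp: singular_circle_measure_def)
  define Z where "Z = measure_support \<mu>"
  have Z: "closed Z" "Z \<subseteq> sphere 0 1"
    unfolding Z_def by (intro closed_measure_support circle_borel_sets[OF \<mu>] measure_support_subset_sphere \<mu>)+
  have "Z \<noteq> {}"
  proof
    assume "Z = {}"
    then have "AE \<zeta> in \<mu>. False"
      using AE_in_measure_support[OF circle_borel_sets[OF \<mu>]] by (simp add: Z_def)
    then have "emeasure \<mu> UNIV = 0"
      by (subst (asm) AE_iff_measurable[of UNIV]) (auto simp: circle_borel_sets[OF \<mu>] circle_borel_space[OF \<mu>])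
    then show False using pos by simp
  qed
  have small: "\<forall>\<^sub>F r in at_left 1. \<exists>\<zeta>. norm \<zeta> = 1 \<and> norm (\<zeta> - \<alpha>) < \<delta> \<and> norm (f (of_real r * \<zeta>)) < \<delta>"
    if \<alpha>: "\<alpha> \<in> Z" and \<delta>: "\<delta> > 0" for \<alpha> \<delta>
  proof (rule ccontr)
    assume neg: "\<not> ?thesis"
    define U where "U = ball \<alpha> \<delta>"
    define q where "q r \<zeta> = - ln \<delta> + poisson_integral circle_measure h (of_real r * \<zeta>)" for r :: real and \<zeta>
    have q: "radially_uniformly_integrable q"
      unfolding q_def by (intro radially_uniformly_integrable_add radially_uniformly_integrable_const radially_uniformly_integrable_poisson h)
    have K0: "emeasure \<mu> K = 0" if K: "compact K" "K \<subseteq> U \<inter> N" for K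
    proof (cases "K = {}")
      case False
      have mK: "emeasure circle_measure K = 0"
        using emeasure_mono[of K N circle_measure] K N by auto
      have "emeasure \<mu> K \<le> ennreal \<epsilon>" if \<epsilon>: "\<epsilon> > 0" for \<epsilon>
      proof -
        obtain \<delta>0 where d0: "\<delta>0 > 0" "\<And>\<delta>. 0 < \<delta> \<Longrightarrow> \<delta> \<le> \<delta>0 \<Longrightarrow> \<exists>r\<^sub>0. 0 \<le> r\<^sub>0 \<and> r\<^sub>0 < 1 \<and> (\<forall>r w. r\<^sub>0 \<le> r \<longrightarrow> r < 1 \<longrightarrow> w \<in> borel_measurable borel \<longrightarrow>
         (\<forall>\<zeta>. norm \<zeta> = 1 \<longrightarrow> \<zeta> \<in> U \<longrightarrow> ennreal (poisson_integral \<mu> (\<lambda>_. 1) (of_real r * \<zeta>)) \<le> w \<zeta> + ennreal (q r \<zeta>)) \<longrightarrow>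
         emeasure \<mu> K \<le> (\<integral>\<^sup>+\<zeta>. ennreal (bump K \<delta> \<zeta>) * w \<zeta> \<partial>circle_measure) + ennreal \<epsilon>)"
          using emeasure_null_compact_le[OF \<mu> q K(1) False mK _ _ \<epsilon>, of U] K(2) by (auto simp: U_def)
        from d0(2)[OF d0(1) order_refl] obtain r0 where r0: "0 \<le> r0" "r0 < 1"
          "\<And>r w. r0 \<le> r \<Longrightarrow> r < 1 \<Longrightarrow> w \<in> borel_measurable borel \<Longrightarrow>
           (\<forall>\<zeta>. norm \<zeta> = 1 \<longrightarrow> \<zeta> \<in> U \<longrightarrow> ennreal (poisson_integral \<mu> (\<lambda>_. 1) (of_real r * \<zeta>)) \<le> w \<zeta> + ennreal (q r \<zeta>)) \<Longrightarrow>
           emeasure \<mu> K \<le> (\<integral>\<^sup>+\<zeta>. ennreal (bump K \<delta>0 \<zeta>) * w \<zeta> \<partial>circle_measure) + ennreal \<epsilon>"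
          by blast
        have "\<exists>r. r0 < r \<and> r < 1 \<and> \<not> (\<exists>\<zeta>. norm \<zeta> = 1 \<and> norm (\<zeta> - \<alpha>) < \<delta> \<and> norm (f (of_real r * \<zeta>)) < \<delta>)"
          using neg r0(2) unfolding eventually_at_left_field by blast
        then obtain r where r: "r0 < r" "r < 1"
          and nex: "\<not> (\<exists>\<zeta>. norm \<zeta> = 1 \<and> norm (\<zeta> - \<alpha>) < \<delta> \<and> norm (f (of_real r * \<zeta>)) < \<delta>)"
          by blast
        have big: "\<delta> \<le> norm (f (of_real r * \<zeta>))" if "norm \<zeta> = 1" "norm (\<zeta> - \<alpha>) < \<delta>" for \<zeta>
          using nex that not_less by blast
        have "emeasure \<mu> K \<le> (\<integral>\<^sup>+\<zeta>. ennreal (bump K \<delta>0 \<zeta>) * 0 \<partial>circle_measure) + ennreal \<epsilon>"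
        proof (rule r0(3); (intro allI impI)?)
          fix \<zeta> :: complex assume \<zeta>: "norm \<zeta> = 1" "\<zeta> \<in> U"
          have nz: "norm (of_real r * \<zeta>) < 1" using \<zeta> r r0 by (simp add: norm_mult)
          have "\<delta> \<le> norm (f (of_real r * \<zeta>))"
            using \<zeta> by (intro big) (auto simp: U_def dist_norm norm_minus_commute)
          also have "\<dots> \<le> exp (poisson_integral circle_measure h (of_real r * \<zeta>) - poisson_integral \<mu> (\<lambda>_. 1) (of_real r * \<zeta>))"
            by (rule le[OF nz])
          finally have "ln \<delta> \<le> poisson_integral circle_measure h (of_real r * \<zeta>) - poisson_integral \<mu> (\<lambda>_. 1) (of_real r * \<zeta>)"
            using \<delta> by (metis exp_le_cancel_iff exp_ln)
          then show "ennreal (poisson_integral \<mu> (\<lambda>_. 1) (of_real r * \<zeta>)) \<le> 0 + ennreal (q r \<zeta>)"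
            by (simp add: q_def ennreal_leI)
        qed (use r in auto)
        then show ?thesis by simp
      qed
      then have "emeasure \<mu> K \<le> 0 + ennreal \<epsilon>" if "\<epsilon> > 0" for \<epsilon> using that by simp
      then have "emeasure \<mu> K \<le> 0" by (rule ennreal_le_epsilon)
      then show ?thesis by simp
    qed simp
    have "emeasure \<mu> (U \<inter> N) = (SUP K \<in> {K. K \<subseteq> U \<inter> N \<and> compact K}. emeasure \<mu> K)"
      by (rule inner_regular) (auto simp: circle_borel_sets[OF \<mu>] N(1) U_def)
    also have "\<dots> \<le> 0" using K0 by (intro SUP_least) auto
    finally have "emeasure \<mu> (U \<inter> N) = 0" by simp
    moreover have "emeasure \<mu> U \<le> emeasure \<mu> (U \<inter> N) + emeasure \<mu> (- N)"
    proof -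
      have "emeasure \<mu> U \<le> emeasure \<mu> ((U \<inter> N) \<union> - N)"
        using N(1) by (intro emeasure_mono) (auto simp: circle_borel_sets[OF \<mu>] U_def)
      also have "\<dots> \<le> emeasure \<mu> (U \<inter> N) + emeasure \<mu> (- N)"
        using N(1) by (intro emeasure_subadditive) (auto simp: circle_borel_sets[OF \<mu>] U_def)
      finally show ?thesis .
    qed
    ultimately have "emeasure \<mu> U = 0" using N(3) by simp
    then show False using \<alpha> \<delta> by (auto simp: Z_def U_def measure_support_def)
  qed
  obtain C where "\<And>\<delta>. 0 < \<delta> \<Longrightarrow> \<delta> \<le> 1 \<Longrightarrow>
    (\<integral>\<^sup>+\<zeta>. ennreal (- ln (max (infdist \<zeta> Z) \<delta>)) \<partial>circle_measure) \<le> ennreal C"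
    using log_distance_integral_bounded[OF f mb z0 Z(1) \<open>Z \<noteq> {}\<close> Z(2) small] by blast
  from log_distance_integrable[OF this] that show thesis unfolding Z_def by blast
qed

text \<open>
  Cauchy's estimate on the circle of radius \<open>(1 - |z|)\<^sup>2 / 4\<close> about \<open>z\<close>: there every Poisson kernel differs from its value
  at \<open>z\<close> by at most \<open>1\<close>, so the exponent changes by at most the total masses of \<open>h\<close> and \<open>\<mu>\<close>.
\<close>

lemma higher_deriv_le_majorant:
  assumes f: "f holomorphic_on ball 0 1" and \<mu>: "circle_borel \<mu>"
    and h: "integrable circle_measure h" "\<And>\<zeta>. 0 \<le> h \<zeta>"
    and le: "\<And>z. norm z < 1 \<Longrightarrow> norm (f z) \<le> exp (poisson_integral circle_measure h z - poisson_integral \<mu> (\<lambda>_. 1) z)"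
    and z: "norm z < 1"
  shows "norm ((deriv ^^ i) f z) \<le> fact i * (4 / (1 - norm z)\<^sup>2) ^ i *
    exp ((\<integral>\<zeta>. h \<zeta> \<partial>circle_measure) + measure \<mu> UNIV + poisson_integral circle_measure h z - poisson_integral \<mu> (\<lambda>_. 1) z)"
proof -
  interpret \<mu>: finite_measure \<mu> by (rule circle_borel_finite[OF \<mu>])
  define s where "s = 1 - norm z"
  have s: "0 < s" "s \<le> 1" using z by (auto simp: s_def)
  \<comment> \<open>With this radius the kernel bound of \<open>poisson_kernel_diff_le\<close> is at most \<open>1\<close>.\<close>
  define \<rho> where "\<rho> = s\<^sup>2 / 4"
  have s2: "s\<^sup>2 \<le> s" using s by (simp add: power2_eq_square mult_left_le)
  have \<rho>: "0 < \<rho>" "\<rho> \<le> s / 4" using s s2 by (auto simp: \<rho>_def)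
  have close: "\<bar>poisson_kernel w \<xi> - poisson_kernel z \<xi>\<bar> \<le> 1" and w1: "norm w < 1"
    if w: "norm (z - w) = \<rho>" and \<xi>: "norm \<xi> = 1" for w \<xi>
  proof -
    have "norm w \<le> norm z + \<rho>" using norm_triangle_ineq2[of w z] w by (simp add: norm_minus_commute)
    then have nw: "s / 2 \<le> 1 - norm w" using \<rho> s by (simp add: s_def)
    then show w1: "norm w < 1" using s by simp
    have "\<bar>poisson_kernel w \<xi> - poisson_kernel z \<xi>\<bar> \<le> 2 * norm (w - z) / ((1 - norm w) * (1 - norm z))"
      by (rule poisson_kernel_diff_le[OF \<xi> w1 z])
    also have "\<dots> = 2 * \<rho> / ((1 - norm w) * s)" using w by (simp add: norm_minus_commute s_def)
    also have "\<dots> \<le> 2 * \<rho> / (s / 2 * s)"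
      using nw s \<rho> by (intro divide_left_mono mult_right_mono mult_pos_pos) auto
    also have "\<dots> = 1" using s by (simp add: \<rho>_def power2_eq_square)
    finally show "\<bar>poisson_kernel w \<xi> - poisson_kernel z \<xi>\<bar> \<le> 1" .
  qed
  have "norm ((deriv ^^ i) f z) \<le> fact i * exp ((\<integral>\<zeta>. h \<zeta> \<partial>circle_measure) + measure \<mu> UNIV
      + poisson_integral circle_measure h z - poisson_integral \<mu> (\<lambda>_. 1) z) / \<rho> ^ i"
  proof (rule Cauchy_inequality)
    have sub: "cball z \<rho> \<subseteq> ball 0 1"
    proof
      fix w assume "w \<in> cball z \<rho>"
      then have "norm w \<le> norm z + \<rho>"
        using norm_triangle_ineq2[of w z] by (simp add: dist_norm norm_minus_commute)
      then show "w \<in> ball 0 1" using \<rho> s by (simp add: s_def)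
    qed
    show "f holomorphic_on ball z \<rho>" using f sub ball_subset_cball by (metis holomorphic_on_subset subset_trans)
    show "continuous_on (cball z \<rho>) f" using holomorphic_on_imp_continuous_on[OF f] sub by (rule continuous_on_subset)
    show "0 < \<rho>" by (rule \<rho>)
    fix w assume w: "norm (z - w) = \<rho>"
    have nw: "norm w < 1" using w1[OF w, of 1] by simp
    have 1: "poisson_integral circle_measure h w \<le> (\<integral>\<zeta>. h \<zeta> \<partial>circle_measure) + poisson_integral circle_measure h z"
    proof -
      have "poisson_integral circle_measure h w \<le> (\<integral>\<xi>. h \<xi> + poisson_kernel z \<xi> * h \<xi> \<partial>circle_measure)"
        unfolding poisson_integral_def
      proof (rule integral_mono_AE)
        show "AE \<xi> in circle_measure. poisson_kernel w \<xi> * h \<xi> \<le> h \<xi> + poisson_kernel z \<xi> * h \<xi>"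
          using AE_circle_measure
        proof eventually_elim
          case (elim \<xi>)
          have "poisson_kernel w \<xi> \<le> 1 + poisson_kernel z \<xi>" using close[OF w elim] by simp
          from mult_right_mono[OF this h(2)[of \<xi>]] show ?case by (simp add: distrib_right)
        qed
      qed (use integrable_poisson[OF circle_borel_circle_measure h(1)] nw z h in auto)
      also have "\<dots> = (\<integral>\<zeta>. h \<zeta> \<partial>circle_measure) + poisson_integral circle_measure h z"
        unfolding poisson_integral_def
        using integrable_poisson[OF circle_borel_circle_measure h(1) z] h by (intro Bochner_Integration.integral_add) auto
      finally show ?thesis .
    qed
    have 2: "poisson_integral \<mu> (\<lambda>_. 1) z \<le> measure \<mu> UNIV + poisson_integral \<mu> (\<lambda>_. 1) w"
    proof -
      have "poisson_integral \<mu> (\<lambda>_. 1) z \<le> (\<integral>\<xi>. 1 + poisson_kernel w \<xi> * 1 \<partial>\<mu>)"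
        unfolding poisson_integral_def
      proof (rule integral_mono_AE)
        show "AE \<xi> in \<mu>. poisson_kernel z \<xi> * 1 \<le> 1 + poisson_kernel w \<xi> * 1"
          using circle_borel_AE[OF \<mu>] by eventually_elim (use close[OF w] in fastforce)
      qed (use integrable_poisson[OF \<mu>, of "\<lambda>_. 1"] nw z in auto)
      also have "\<dots> = (\<integral>\<xi>. 1 \<partial>\<mu>) + poisson_integral \<mu> (\<lambda>_. 1) w"
        unfolding poisson_integral_def
        using integrable_poisson[OF \<mu>, of "\<lambda>_. 1" w] nw by (intro Bochner_Integration.integral_add) auto
      finally show ?thesis by (simp add: circle_borel_space[OF \<mu>])
    qed
    have "norm (f w) \<le> exp (poisson_integral circle_measure h w - poisson_integral \<mu> (\<lambda>_. 1) w)" by (rule le[OF nw])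
    also have "\<dots> \<le> exp ((\<integral>\<zeta>. h \<zeta> \<partial>circle_measure) + measure \<mu> UNIV
        + poisson_integral circle_measure h z - poisson_integral \<mu> (\<lambda>_. 1) z)"
      using 1 2 by simp
    finally show "norm (f w) \<le> exp ((\<integral>\<zeta>. h \<zeta> \<partial>circle_measure) + measure \<mu> UNIV
        + poisson_integral circle_measure h z - poisson_integral \<mu> (\<lambda>_. 1) z)" .
  qed
  also have "\<dots> = fact i * (4 / (1 - norm z)\<^sup>2) ^ i * exp ((\<integral>\<zeta>. h \<zeta> \<partial>circle_measure) + measure \<mu> UNIV
      + poisson_integral circle_measure h z - poisson_integral \<mu> (\<lambda>_. 1) z)"
    by (simp add: \<rho>_def s_def power_divide)
  finally show ?thesis .
qed

section \<open>Weak limits and singular parts\<close>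

text \<open>
  Adding constants to the densities makes their total masses equal; in the parametrization by \<open>[0, 2\<pi>)\<close> they
  then become probability measures on a bounded interval, and Helly's selection theorem applies. The added
  constants only increase the limit, whence an inequality in the conclusion.
\<close>

lemma weak_limit_of_densities:
  fixes w :: "nat \<Rightarrow> complex \<Rightarrow> real"
  assumes w: "\<And>k. w k \<in> borel_measurable borel" "\<And>k \<zeta>. 0 \<le> w k \<zeta>"
    and C: "C \<ge> 0" "\<And>k. (\<integral>\<^sup>+\<zeta>. ennreal (w k \<zeta>) \<partial>circle_measure) \<le> ennreal C"
  obtains \<sigma> s where "sets \<sigma> = sets borel" "finite_measure \<sigma>" "strict_mono (s :: nat \<Rightarrow> nat)"
    "\<And>\<phi> e. continuous_on UNIV \<phi> \<Longrightarrow> (\<And>\<zeta>. 0 \<le> \<phi> \<zeta> \<and> \<phi> \<zeta> \<le> 1) \<Longrightarrow> e > 0 \<Longrightarrow>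
      \<forall>\<^sub>F k in sequentially. (\<integral>\<^sup>+\<zeta>. ennreal (\<phi> \<zeta>) * ennreal (w (s k) \<zeta>) \<partial>circle_measure) \<le> ennreal ((\<integral>\<zeta>. \<phi> \<zeta> \<partial>\<sigma>) + e)"
proof -
  note [measurable] = w(1)
  define D where "D = C + 1"
  have D: "D > 0" using C by (simp add: D_def)
  have intw: "integrable circle_measure (w k)" for k
    using C(2)[of k] by (intro integrableI_nonneg) (auto simp: w le_less_trans[OF _ ennreal_less_top])
  define m where "m k = (\<integral>\<zeta>. w k \<zeta> \<partial>circle_measure)" for k
  have m: "m k \<le> C" for k
  proof -
    have "ennreal (m k) = (\<integral>\<^sup>+\<zeta>. ennreal (w k \<zeta>) \<partial>circle_measure)"
      unfolding m_def using intw w by (intro nn_integral_eq_integral[symmetric]) auto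
    then show ?thesis using C by (metis ennreal_le_iff)
  qed
  define v where "v k \<zeta> = (w k \<zeta> + (D - m k)) / D" for k \<zeta>
  have [measurable]: "v k \<in> borel_measurable borel" for k unfolding v_def by measurable
  have v0: "0 \<le> v k \<zeta>" for k \<zeta> using w(2)[of k \<zeta>] m[of k] D by (simp add: v_def D_def)
  have wv: "w k \<zeta> \<le> D * v k \<zeta>" for k \<zeta> using m[of k] D by (simp add: v_def D_def)
  have intv: "integrable circle_measure (v k)" for k unfolding v_def using intw by auto
  have v1: "(\<integral>\<zeta>. v k \<zeta> \<partial>circle_measure) = 1" for k
    unfolding v_def using intw D by (simp add: m_def)
  define U where "U = uniform_measure lborel {0..<2 * pi :: real}"
  have Us [measurable_cong]: "sets U = sets borel" by (simp add: U_def)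
  have mU: "circle_measure = distr U borel cis" by (simp add: U_def circle_measure_def)
  have cis_m [measurable]: "cis \<in> measurable U borel" by measurable
  define M where "M k = density U (\<lambda>t. ennreal (v k (cis t)))" for k
  have Ms [measurable_cong]: "sets (M k) = sets borel" for k by (simp add: M_def Us)
  have Mint: "(\<integral>t. \<phi> (cis t) \<partial>M k) = (\<integral>\<zeta>. v k \<zeta> * \<phi> \<zeta> \<partial>circle_measure)"
    if [measurable]: "\<phi> \<in> borel_measurable borel" for \<phi> :: "complex \<Rightarrow> real" and k
    unfolding M_def mU by (subst integral_density, measurable, auto simp: v0) (subst integral_distr, auto)
  have Mprob: "emeasure (M k) UNIV = 1" for k
  proof -
    have "emeasure (M k) UNIV = (\<integral>\<^sup>+t. ennreal (v k (cis t)) \<partial>U)"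
      unfolding M_def using sets_eq_imp_space_eq[OF Us] by (subst emeasure_density) auto
    also have "\<dots> = (\<integral>\<^sup>+\<zeta>. ennreal (v k \<zeta>) \<partial>circle_measure)"
      unfolding mU by (rule nn_integral_distr[symmetric]) auto
    also have "\<dots> = 1" using intv v0 by (subst nn_integral_eq_integral) (auto simp: v1)
    finally show ?thesis .
  qed
  have Msp: "space (M k) = UNIV" for k using sets_eq_imp_space_eq[OF Ms] by simp
  have rd: "real_distribution (M k)" for k
    by (intro real_distribution.intro prob_spaceI real_distribution_axioms.intro) (auto simp: Msp Mprob Ms)
  have AEU: "AE t in U. t \<in> {-1<..8}"
  proof -
    have "AE t in U. t \<in> {0..<2 * pi}"
      unfolding U_def by (rule AE_uniform_measureI) auto
    then show ?thesis by eventually_elim (use pi_less_4 in auto)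
  qed
  have "tight M"
    unfolding tight_def
  proof (intro conjI allI impI rd)
    fix \<epsilon> :: real assume \<epsilon>: "\<epsilon> > 0"
    have "measure (M k) {-1<..8} = 1" for k
    proof -
      interpret real_distribution "M k" by (rule rd)
      have "AE t in M k. t \<in> {-1<..8}"
        unfolding M_def by (subst AE_density) (use AEU in auto)
      then show ?thesis by (intro prob_eq_1[THEN iffD2]) auto
    qed
    then show "\<exists>a b. a < b \<and> (\<forall>k. 1 - \<epsilon> < measure (M k) {a<..b})"
      using \<epsilon> by (intro exI[of _ "-1"] exI[of _ 8]) auto
  qed
  then obtain s L where s: "strict_mono s" and L: "real_distribution L" and conv: "weak_conv_m (M \<circ> s) L"
    using tight_imp_convergent_subsubsequence[of M "\<lambda>x. x"] strict_mono_id
    by (auto simp: o_def strict_mono_def)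
  interpret L: real_distribution L by (rule L)
  define \<sigma> where "\<sigma> = density (distr L borel cis) (\<lambda>_. ennreal D)"
  have \<sigma>s: "sets \<sigma> = sets borel" by (simp add: \<sigma>_def)
  interpret Lc: prob_space "distr L borel cis" by (rule L.prob_space_distr) simp
  have \<sigma>fin: "finite_measure \<sigma>"
    by (rule finite_measureI) (use Lc.emeasure_space_1 in \<open>simp add: \<sigma>_def emeasure_density_const\<close>)
  show thesis
  proof (rule that[OF \<sigma>s \<sigma>fin s])
    fix \<phi> :: "complex \<Rightarrow> real" and e :: real
    assume \<phi>c: "continuous_on UNIV \<phi>" and \<phi>b: "\<And>\<zeta>. 0 \<le> \<phi> \<zeta> \<and> \<phi> \<zeta> \<le> 1" and e: "e > 0"
    have \<phi>m [measurable]: "\<phi> \<in> borel_measurable borel" using \<phi>c by (rule borel_measurable_continuous_onI)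
    have "(\<lambda>k. \<integral>t. \<phi> (cis t) \<partial>(M \<circ> s) k) \<longlonglongrightarrow> (\<integral>t. \<phi> (cis t) \<partial>L)"
    proof (rule weak_conv_imp_integral_bdd_continuous_conv[OF _ L conv])
      show "real_distribution ((M \<circ> s) k)" for k using rd by simp
      have "continuous_on UNIV (\<lambda>t. \<phi> (cis t))"
        by (intro continuous_on_compose2[OF \<phi>c] continuous_intros) auto
      then show "isCont (\<lambda>t. \<phi> (cis t)) t" for t
        by (simp add: continuous_on_eq_continuous_at)
      show "norm (\<phi> (cis t)) \<le> 1" for t using \<phi>b[of "cis t"] by simp
    qed
    then have "(\<lambda>k. D * (\<integral>\<zeta>. v (s k) \<zeta> * \<phi> \<zeta> \<partial>circle_measure)) \<longlonglongrightarrow> D * (\<integral>t. \<phi> (cis t) \<partial>L)"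
      by (intro tendsto_mult_left) (simp add: Mint o_def)
    also have "D * (\<integral>t. \<phi> (cis t) \<partial>L) = (\<integral>\<zeta>. \<phi> \<zeta> \<partial>\<sigma>)"
      unfolding \<sigma>_def using D by (subst integral_density) (auto simp: integral_distr)
    finally have "\<forall>\<^sub>F k in sequentially. D * (\<integral>\<zeta>. v (s k) \<zeta> * \<phi> \<zeta> \<partial>circle_measure) < (\<integral>\<zeta>. \<phi> \<zeta> \<partial>\<sigma>) + e"
      using e by (intro order_tendstoD) auto
    then show "\<forall>\<^sub>F k in sequentially. (\<integral>\<^sup>+\<zeta>. ennreal (\<phi> \<zeta>) * ennreal (w (s k) \<zeta>) \<partial>circle_measure) \<le> ennreal ((\<integral>\<zeta>. \<phi> \<zeta> \<partial>\<sigma>) + e)"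
    proof eventually_elim
      case (elim k)
      have iv: "integrable circle_measure (\<lambda>\<zeta>. D * (v (s k) \<zeta> * \<phi> \<zeta>))"
      proof (rule Bochner_Integration.integrable_bound)
        show "integrable circle_measure (\<lambda>\<zeta>. D * v (s k) \<zeta>)" using intv by auto
        show "AE \<zeta> in circle_measure. norm (D * (v (s k) \<zeta> * \<phi> \<zeta>)) \<le> norm (D * v (s k) \<zeta>)"
          using \<phi>b v0 D by (intro AE_I2) (auto simp: abs_mult mult_left_le)
      qed measurable
      have "(\<integral>\<^sup>+\<zeta>. ennreal (\<phi> \<zeta>) * ennreal (w (s k) \<zeta>) \<partial>circle_measure) \<le> (\<integral>\<^sup>+\<zeta>. ennreal (D * (v (s k) \<zeta> * \<phi> \<zeta>)) \<partial>circle_measure)"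
      proof (rule nn_integral_mono)
        fix \<zeta>
        have "\<phi> \<zeta> * w (s k) \<zeta> \<le> \<phi> \<zeta> * (D * v (s k) \<zeta>)"
          using wv \<phi>b by (intro mult_left_mono) auto
        then show "ennreal (\<phi> \<zeta>) * ennreal (w (s k) \<zeta>) \<le> ennreal (D * (v (s k) \<zeta> * \<phi> \<zeta>))"
          using \<phi>b w(2) by (simp add: ennreal_leI mult_ac flip: ennreal_mult)
      qed
      also have "\<dots> = ennreal (D * (\<integral>\<zeta>. v (s k) \<zeta> * \<phi> \<zeta> \<partial>circle_measure))"
        using iv v0 \<phi>b D by (subst nn_integral_eq_integral) auto
      also have "\<dots> \<le> ennreal ((\<integral>\<zeta>. \<phi> \<zeta> \<partial>\<sigma>) + e)" using elim by (intro ennreal_leI) simp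
      finally show ?case .
    qed
  qed
qed

text \<open>
  Restrict \<open>\<sigma>\<close> to a null set \<open>N\<close> of maximal \<open>\<sigma>\<close>-measure. Every further null set is \<open>\<sigma>\<close>-null outside \<open>N\<close>, so
  nothing is lost for measures that are singular themselves.
\<close>

lemma singular_part_dominates:
  assumes \<sigma>: "sets \<sigma> = sets borel" "finite_measure \<sigma>"
  obtains \<sigma>\<^sub>s where "singular_circle_measure \<sigma>\<^sub>s"
    "\<And>\<mu> A. singular_circle_measure \<mu> \<Longrightarrow>
      (\<And>K. compact K \<Longrightarrow> emeasure circle_measure K = 0 \<Longrightarrow> emeasure \<mu> K \<le> emeasure \<sigma> K) \<Longrightarrow>
      A \<in> sets borel \<Longrightarrow> emeasure \<mu> A \<le> emeasure \<sigma>\<^sub>s A"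
proof -
  interpret \<sigma>: finite_measure \<sigma> by fact
  have sp: "space \<sigma> = UNIV" using sets_eq_imp_space_eq[OF \<sigma>(1)] by simp
  define \<N> where "\<N> = {N \<in> sets borel. N \<subseteq> sphere 0 1 \<and> emeasure circle_measure N = 0}"
  define s where "s = (SUP N\<in>\<N>. measure \<sigma> N)"
  have bdd: "bdd_above (measure \<sigma> ` \<N>)"
    by (rule bdd_aboveI2[of _ _ "measure \<sigma> UNIV"]) (use \<sigma>.bounded_measure sp in auto)
  have ne: "{} \<in> \<N>" by (simp add: \<N>_def)
  have "\<exists>N\<in>\<N>. s - 1 / (real i + 1) < measure \<sigma> N" for i :: nat
    using less_cSUP_iff[OF _ bdd, of "s - 1 / (real i + 1)"] ne unfolding s_def[symmetric] by auto
  then obtain P where P: "\<And>i. P i \<in> \<N>" "\<And>i. s - 1 / (real i + 1) < measure \<sigma> (P i)" by metis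
  define N where "N = (\<Union>i. P i)"
  have NN: "N \<in> \<N>"
  proof -
    have "P i \<in> null_sets circle_measure" for i using P(1)[of i] by (auto simp: \<N>_def null_sets_def)
    then have "N \<in> null_sets circle_measure" unfolding N_def by (rule null_sets_UN)
    then show ?thesis using P(1) by (auto simp: \<N>_def N_def null_sets_def)
  qed
  have le_s: "measure \<sigma> N' \<le> s" if "N' \<in> \<N>" for N'
    unfolding s_def using that bdd by (rule cSUP_upper)
  have Ns: "s \<le> measure \<sigma> N"
  proof -
    have "s - 1 / (real i + 1) \<le> measure \<sigma> N" for i
    proof -
      have "measure \<sigma> (P i) \<le> measure \<sigma> N"
        using P(1) NN by (intro \<sigma>.finite_measure_mono) (auto simp: N_def \<N>_def \<sigma>(1))
      then show ?thesis using P(2)[of i] by simp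
    qed
    moreover have "(\<lambda>i. s - 1 / (real i + 1)) \<longlonglongrightarrow> s - 0"
      by (intro tendsto_diff tendsto_const) (use LIMSEQ_inverse_real_of_nat in \<open>simp add: inverse_eq_divide add.commute\<close>)
    ultimately show ?thesis by (intro LIMSEQ_le_const2[of _ s]) auto
  qed
  have Nb: "N \<in> sets borel" "N \<subseteq> sphere 0 1" "emeasure circle_measure N = 0" using NN by (auto simp: \<N>_def)
  define \<sigma>s where "\<sigma>s = density \<sigma> (indicator N)"
  have em: "emeasure \<sigma>s A = emeasure \<sigma> (N \<inter> A)" if "A \<in> sets borel" for A
    unfolding \<sigma>s_def using that Nb(1) \<sigma>(1) by (subst emeasure_density) (auto simp: nn_integral_indicator' indicator_inter_arith[symmetric])
  show thesis
  proof (rule that)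
    show "singular_circle_measure \<sigma>s"
      unfolding singular_circle_measure_def
    proof (intro conjI bexI)
      show "sets \<sigma>s = sets borel" by (simp add: \<sigma>s_def \<sigma>(1))
      show "finite_measure \<sigma>s"
        by (rule finite_measureI) (simp add: \<sigma>s_def[symmetric] em, simp add: \<sigma>s_def sp em[unfolded \<sigma>s_def])
      show "emeasure \<sigma>s (- sphere 0 1) = 0"
      proof -
        have "N \<inter> - sphere 0 1 = {}" using Nb(2) by auto
        then show ?thesis by (subst em) auto
      qed
      show "emeasure \<sigma>s (- N) = 0" using Nb by (subst em) auto
    qed (use Nb in auto)
    fix \<mu> :: "complex measure" and A :: "complex set"
    assume sing: "singular_circle_measure \<mu>"
      and le: "\<And>K. compact K \<Longrightarrow> emeasure circle_measure K = 0 \<Longrightarrow> emeasure \<mu> K \<le> emeasure \<sigma> K"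
      and A: "A \<in> sets borel"
    obtain N' where N': "N' \<in> sets borel" "emeasure circle_measure N' = 0" "emeasure \<mu> (- N') = 0"
      using sing by (auto simp: singular_circle_measure_def)
    have \<mu>s: "sets \<mu> = sets borel" "finite_measure \<mu>" "emeasure \<mu> (- sphere 0 1) = 0"
      using sing by (auto simp: singular_circle_measure_def)
    interpret \<mu>: finite_measure \<mu> by fact
    define A' where "A' = A \<inter> (N' \<inter> sphere 0 1)"
    have A': "A' \<in> sets borel" using A N' by (auto simp: A'_def)
    have "emeasure \<mu> A \<le> emeasure \<mu> (A' \<union> (- N' \<union> - sphere 0 1))"
      using A A' N' by (intro emeasure_mono) (auto simp: A'_def \<mu>s)
    also have "\<dots> \<le> emeasure \<mu> A' + emeasure \<mu> (- N' \<union> - sphere 0 1)"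
      using A' N' by (intro emeasure_subadditive) (auto simp: \<mu>s)
    also have "emeasure \<mu> (- N' \<union> - sphere 0 1) \<le> emeasure \<mu> (- N') + emeasure \<mu> (- sphere 0 1)"
      using N' by (intro emeasure_subadditive) (auto simp: \<mu>s)
    finally have "emeasure \<mu> A \<le> emeasure \<mu> A'" using N' \<mu>s by (simp add: add_left_mono)
    also have "emeasure \<mu> A' = (SUP K\<in>{K. K \<subseteq> A' \<and> compact K}. emeasure \<mu> K)"
      using A' by (intro inner_regular) (auto simp: \<mu>s)
    also have "\<dots> \<le> emeasure \<sigma>s A"
    proof (rule SUP_least)
      fix K assume "K \<in> {K. K \<subseteq> A' \<and> compact K}"
      then have K: "K \<subseteq> A'" "compact K" by auto
      have Kb: "K \<in> sets borel" using K(2) by (simp add: compact_imp_closed borel_closed)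
      have K0: "emeasure circle_measure K = 0"
        using emeasure_mono[of K N' circle_measure] K N' by (auto simp: A'_def)
      have "N \<union> K \<in> null_sets circle_measure"
        using Nb Kb K0 by (intro null_sets.Un) (auto simp: null_sets_def)
      then have "N \<union> K \<in> \<N>" using Nb(2) K by (auto simp: \<N>_def null_sets_def A'_def)
      then have "measure \<sigma> (N \<union> K) \<le> measure \<sigma> N" using le_s Ns order_trans by blast
      moreover have "measure \<sigma> (N \<union> (K - N)) = measure \<sigma> N + measure \<sigma> (K - N)"
        using Nb Kb by (intro \<sigma>.finite_measure_Union) (auto simp: \<sigma>(1))
      ultimately have "measure \<sigma> (K - N) \<le> 0" by simp
      then have "emeasure \<sigma> (K - N) = 0" by (simp add: \<sigma>.emeasure_eq_measure ennreal_neg)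
      have "emeasure \<mu> K \<le> emeasure \<sigma> K" by (rule le[OF K(2) K0])
      also have "\<dots> \<le> emeasure \<sigma> (N \<inter> A \<union> (K - N))"
        using K Nb A Kb by (intro emeasure_mono) (auto simp: A'_def \<sigma>(1))
      also have "\<dots> \<le> emeasure \<sigma> (N \<inter> A) + emeasure \<sigma> (K - N)"
        using Nb A Kb by (intro emeasure_subadditive) (auto simp: \<sigma>(1))
      also have "\<dots> = emeasure \<sigma>s A" using \<open>emeasure \<sigma> (K - N) = 0\<close> by (simp add: em[OF A])
      finally show "emeasure \<mu> K \<le> emeasure \<sigma>s A" .
    qed
    finally show "emeasure \<mu> A \<le> emeasure \<sigma>s A" .
  qed
qed

text \<open>
  By the Radon--Nikodym theorem \<open>\<mu>\<close> has a density \<open>\<rho> \<le> 1\<close> with respect to \<open>\<sigma>\<close>, and the quotient is the inner function of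
  the measure with density \<open>1 - \<rho>\<close>.
\<close>

lemma singular_inner_dvd:
  assumes \<sigma>: "singular_circle_measure \<sigma>" and \<mu>: "singular_circle_measure \<mu>"
    and le: "\<And>A. A \<in> sets borel \<Longrightarrow> emeasure \<mu> A \<le> emeasure \<sigma> A"
    and T: "\<And>z. norm z < 1 \<Longrightarrow> T z = exp (- herglotz_integral \<mu> (\<lambda>_. 1) z)"
    and S: "\<And>z. norm z < 1 \<Longrightarrow> S z = exp (- herglotz_integral \<sigma> (\<lambda>_. 1) z)"
  shows "inner_dvd T S"
proof -
  have \<sigma>c: "circle_borel \<sigma>" and \<mu>c: "circle_borel \<mu>"
    using singular_circle_measure_imp_circle_borel \<sigma> \<mu> by auto
  note \<sigma>s [measurable_cong] = circle_borel_sets[OF \<sigma>c]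
  interpret \<sigma>: finite_measure \<sigma> by (rule circle_borel_finite[OF \<sigma>c])
  interpret \<mu>: finite_measure \<mu> by (rule circle_borel_finite[OF \<mu>c])
  have "absolutely_continuous \<sigma> \<mu>"
    unfolding absolutely_continuous_def
    using le by (auto simp: null_sets_def \<sigma>s circle_borel_sets[OF \<mu>c]) (metis le_zero_eq)
  then obtain f where f [measurable]: "f \<in> borel_measurable \<sigma>" and dens: "density \<sigma> f = \<mu>"
    using \<sigma>.Radon_Nikodym[of \<mu>] \<sigma>s circle_borel_sets[OF \<mu>c] by auto
  have fb [measurable]: "f \<in> borel_measurable borel" using f by simp
  have f1: "AE \<zeta> in \<sigma>. f \<zeta> \<le> 1"
  proof -
    define B where "B = {\<zeta>. 1 < f \<zeta>}"
    have B [measurable]: "B \<in> sets borel" unfolding B_def by measurable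
    have "emeasure \<mu> B = (\<integral>\<^sup>+\<zeta>. f \<zeta> * indicator B \<zeta> \<partial>\<sigma>)"
      unfolding dens[symmetric] using B \<sigma>s by (intro emeasure_density) auto
    then have i1: "(\<integral>\<^sup>+\<zeta>. f \<zeta> * indicator B \<zeta> \<partial>\<sigma>) \<le> (\<integral>\<^sup>+\<zeta>. indicator B \<zeta> \<partial>\<sigma>)"
      using le[OF B] B \<sigma>s by (simp add: nn_integral_indicator)
    have "(\<integral>\<^sup>+\<zeta>. f \<zeta> * indicator B \<zeta> - indicator B \<zeta> \<partial>\<sigma>)
        = (\<integral>\<^sup>+\<zeta>. f \<zeta> * indicator B \<zeta> \<partial>\<sigma>) - (\<integral>\<^sup>+\<zeta>. indicator B \<zeta> \<partial>\<sigma>)"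
    proof (rule nn_integral_diff)
      show "(\<integral>\<^sup>+\<zeta>. indicator B \<zeta> \<partial>\<sigma>) \<noteq> \<infinity>" using B \<sigma>s by (simp add: nn_integral_indicator)
      show "AE \<zeta> in \<sigma>. indicator B \<zeta> \<le> f \<zeta> * indicator B \<zeta>"
        by (intro AE_I2) (auto simp: B_def split: split_indicator)
    qed measurable
    also have "\<dots> = 0"
    proof (rule diff_eq_0_ennreal[OF le_less_trans[OF i1] i1])
      show "(\<integral>\<^sup>+\<zeta>. indicator B \<zeta> \<partial>\<sigma>) < top_class.top" using B \<sigma>s by (simp add: \<sigma>.emeasure_eq_measure)
    qed
    finally have "AE \<zeta> in \<sigma>. f \<zeta> * indicator B \<zeta> - indicator B \<zeta> = 0"
      by (subst (asm) nn_integral_0_iff_AE) auto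
    then show ?thesis
    proof eventually_elim
      case (elim \<zeta>)
      show ?case
      proof (rule ccontr)
        assume "\<not> f \<zeta> \<le> 1"
        then have "1 < f \<zeta>" by simp
        then have "f \<zeta> - 1 = 0" using elim by (simp add: B_def)
        moreover have "0 < f \<zeta> - 1" using \<open>1 < f \<zeta>\<close> by (intro diff_gr0_ennreal) auto
        ultimately show False by simp
      qed
    qed
  qed
  define \<rho> where "\<rho> \<zeta> = enn2real (min 1 (f \<zeta>))" for \<zeta>
  have [measurable]: "\<rho> \<in> borel_measurable borel" unfolding \<rho>_def by measurable
  have \<rho>01: "0 \<le> \<rho> \<zeta>" "\<rho> \<zeta> \<le> 1" for \<zeta>
    unfolding \<rho>_def using enn2real_mono[of "min 1 (f \<zeta>)" 1] by auto
  have \<mu>\<rho>: "\<mu> = density \<sigma> (\<lambda>\<zeta>. ennreal (\<rho> \<zeta>))"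
    unfolding dens[symmetric]
  proof (rule density_cong)
    show "AE \<zeta> in \<sigma>. f \<zeta> = ennreal (\<rho> \<zeta>)"
      using f1 by eventually_elim (auto simp: \<rho>_def min_absorb2 intro!: ennreal_enn2real[symmetric] intro: le_less_trans)
  qed measurable
  define \<nu> where "\<nu> = density \<sigma> (\<lambda>\<zeta>. ennreal (1 - \<rho> \<zeta>))"
  have \<nu>_null: "emeasure \<nu> A = 0" if "A \<in> sets borel" "emeasure \<sigma> A = 0" for A
  proof -
    have "A \<in> null_sets \<sigma>" using that \<sigma>s by (auto simp: null_sets_def)
    moreover have "absolutely_continuous \<sigma> \<nu>" unfolding \<nu>_def by (intro absolutely_continuousI_density) measurable
    ultimately show ?thesis by (auto simp: absolutely_continuous_def null_sets_def)
  qed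
  have \<nu>: "singular_circle_measure \<nu>"
    unfolding singular_circle_measure_def
  proof (intro conjI)
    show "sets \<nu> = sets borel" by (simp add: \<nu>_def \<sigma>s)
    show "finite_measure \<nu>"
    proof (rule finite_measureI)
      have "emeasure \<nu> (space \<nu>) = (\<integral>\<^sup>+\<zeta>. ennreal (1 - \<rho> \<zeta>) \<partial>\<sigma>)"
        by (simp add: \<nu>_def emeasure_density cong: nn_integral_cong)
      also have "\<dots> \<le> (\<integral>\<^sup>+\<zeta>. 1 \<partial>\<sigma>)"
        using \<rho>01 by (intro nn_integral_mono) (auto simp: ennreal_le_1)
      also have "\<dots> < \<infinity>" by (simp add: \<sigma>.emeasure_eq_measure)
      finally show "emeasure \<nu> (space \<nu>) \<noteq> \<infinity>" by simp
    qed
    show "emeasure \<nu> (- sphere 0 1) = 0"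
      using \<sigma> by (intro \<nu>_null) (auto simp: singular_circle_measure_def)
    obtain N where "N \<in> sets borel" "emeasure circle_measure N = 0" "emeasure \<sigma> (- N) = 0"
      using \<sigma> by (auto simp: singular_circle_measure_def)
    then show "\<exists>N\<in>sets borel. emeasure circle_measure N = 0 \<and> emeasure \<nu> (- N) = 0"
      using \<nu>_null by (intro bexI[of _ N]) auto
  qed
  show ?thesis
    unfolding inner_dvd_def
  proof (intro exI conjI ballI)
    show "inner_function (\<lambda>z. exp (- herglotz_integral \<nu> (\<lambda>_. 1) z))"
      by (rule inner_function_singular_measure[OF \<nu>])
    fix z :: complex assume "z \<in> ball 0 1"
    then have z: "norm z < 1" by simp
    have i: "integrable \<sigma> (\<lambda>\<zeta>. \<rho>' \<zeta> *\<^sub>R herglotz_kernel z \<zeta>)"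
      if [measurable]: "\<rho>' \<in> borel_measurable borel" and "\<And>\<zeta>. 0 \<le> \<rho>' \<zeta> \<and> \<rho>' \<zeta> \<le> 1" for \<rho>' :: "complex \<Rightarrow> real"
    proof -
      have "integrable \<sigma> (\<lambda>\<zeta>. herglotz_kernel z \<zeta> * of_real (\<rho>' \<zeta>))"
      proof (rule integrable_herglotz[OF \<sigma>c _ z], rule integrable_of_real)
        show "integrable \<sigma> \<rho>'"
          by (rule \<sigma>.integrable_const_bound[of _ 1]) (use that in \<open>auto intro!: AE_I2\<close>)
      qed
      then show ?thesis by (simp add: scaleR_conv_of_real mult.commute)
    qed
    have "herglotz_integral \<mu> (\<lambda>_. 1) z = (\<integral>\<zeta>. \<rho> \<zeta> *\<^sub>R herglotz_kernel z \<zeta> \<partial>\<sigma>)"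
      unfolding \<mu>\<rho> herglotz_integral_def by (subst integral_density) (auto simp: \<rho>01)
    moreover have "herglotz_integral \<nu> (\<lambda>_. 1) z = (\<integral>\<zeta>. (1 - \<rho> \<zeta>) *\<^sub>R herglotz_kernel z \<zeta> \<partial>\<sigma>)"
      unfolding \<nu>_def herglotz_integral_def by (subst integral_density) (auto simp: \<rho>01)
    moreover have "(\<integral>\<zeta>. \<rho> \<zeta> *\<^sub>R herglotz_kernel z \<zeta> \<partial>\<sigma>) + (\<integral>\<zeta>. (1 - \<rho> \<zeta>) *\<^sub>R herglotz_kernel z \<zeta> \<partial>\<sigma>)
        = (\<integral>\<zeta>. \<rho> \<zeta> *\<^sub>R herglotz_kernel z \<zeta> + (1 - \<rho> \<zeta>) *\<^sub>R herglotz_kernel z \<zeta> \<partial>\<sigma>)"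
      by (intro Bochner_Integration.integral_add[symmetric] i) (auto simp: \<rho>01)
    moreover have "\<dots> = herglotz_integral \<sigma> (\<lambda>_. 1) z"
      unfolding herglotz_integral_def by (intro Bochner_Integration.integral_cong) (simp_all flip: scaleR_left_distrib)
    ultimately have "herglotz_integral \<mu> (\<lambda>_. 1) z + herglotz_integral \<nu> (\<lambda>_. 1) z = herglotz_integral \<sigma> (\<lambda>_. 1) z" by simp
    then show "S z = T z * exp (- herglotz_integral \<nu> (\<lambda>_. 1) z)"
      using T[OF z] S[OF z] by (metis exp_add minus_add_distrib)
  qed
qed

section \<open>Singular factors and the Wronskian\<close>

lemma higher_deriv_linear_combination:
  assumes f: "\<And>j. j \<le> n \<Longrightarrow> f j holomorphic_on ball 0 1" and z: "z \<in> ball 0 1"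
  shows "(deriv ^^ i) (\<lambda>z. \<Sum>j=0..n. l j * f j z) z = (\<Sum>j=0..n. l j * (deriv ^^ i) (f j) z)"
  using z
proof (induction i arbitrary: z)
  case (Suc i)
  have hol: "(\<lambda>z. \<Sum>j=0..n. l j * f j z) holomorphic_on ball 0 1"
    using f by (intro holomorphic_intros) auto
  have "((\<lambda>z. \<Sum>j=0..n. l j * (deriv ^^ i) (f j) z) has_field_derivative (\<Sum>j=0..n. l j * (deriv ^^ Suc i) (f j) z)) (at z)"
    using f Suc.prems by (intro DERIV_sum DERIV_cmult higher_deriv_has_field_derivative) auto
  then have "((deriv ^^ i) (\<lambda>z. \<Sum>j=0..n. l j * f j z) has_field_derivative (\<Sum>j=0..n. l j * (deriv ^^ Suc i) (f j) z)) (at z)"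
    by (rule has_field_derivative_transform_within_open[OF _ open_ball Suc.prems]) (simp add: Suc.IH)
  then show ?case
    using higher_deriv_has_field_derivative[OF hol Suc.prems, of i] DERIV_unique by blast
qed simp

text \<open>
  Downward induction on the order: a derivative whose own derivative has bounded means is bounded.
\<close>

lemma lower_derivs_bounded:
  assumes f: "f holomorphic_on ball 0 1" and top: "mean_bounded ((deriv ^^ n) f)"
  shows "i < n \<Longrightarrow> \<exists>B. \<forall>z. norm z < 1 \<longrightarrow> norm ((deriv ^^ i) f z) \<le> B"
proof (induction "n - i" arbitrary: i rule: less_induct)
  case less
  have hol: "(deriv ^^ i) f holomorphic_on ball 0 1" by (rule holomorphic_higher_deriv[OF f]) auto
  have "mean_bounded (deriv ((deriv ^^ i) f))"
  proof (cases "Suc i = n")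
    case True
    then show ?thesis using top by auto
  next
    case False
    then have "Suc i < n" "n - Suc i < n - i" using less.prems by auto
    then obtain B where "\<forall>z. norm z < 1 \<longrightarrow> norm ((deriv ^^ Suc i) f z) \<le> B"
      using less.hyps[of "Suc i"] by blast
    then show ?thesis using bounded_imp_mean_bounded[of "(deriv ^^ Suc i) f" B] by simp
  qed
  from bounded_if_deriv_mean_bounded[OF hol this] obtain B
    where "\<And>z. norm z < 1 \<Longrightarrow> norm ((deriv ^^ i) f z) \<le> B" by blast
  then show ?case by blast
qed

lemma top_deriv_le:
  assumes f: "f holomorphic_on ball 0 1" and B: "\<And>z. norm z < 1 \<Longrightarrow> norm ((deriv ^^ m) f z) \<le> B" and z: "norm z < 1"
  shows "norm ((deriv ^^ Suc m) f z) \<le> 2 * B / (1 - norm z)"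
proof -
  define \<rho> where "\<rho> = (1 - norm z) / 2"
  have \<rho>: "\<rho> > 0" using z by (simp add: \<rho>_def)
  have sub: "cball z \<rho> \<subseteq> ball 0 1"
  proof
    fix w assume "w \<in> cball z \<rho>"
    then have "norm w \<le> norm z + \<rho>"
      using norm_triangle_ineq2[of w z] by (simp add: dist_norm norm_minus_commute)
    then have "norm w < 1" using \<rho> z unfolding \<rho>_def by argo
    then show "w \<in> ball 0 1" by simp
  qed
  have hol: "(deriv ^^ m) f holomorphic_on ball 0 1" by (rule holomorphic_higher_deriv[OF f]) auto
  have "norm ((deriv ^^ 1) ((deriv ^^ m) f) z) \<le> fact 1 * B / \<rho> ^ 1"
  proof (rule Cauchy_inequality)
    show "(deriv ^^ m) f holomorphic_on ball z \<rho>" using hol sub ball_subset_cball by (metis holomorphic_on_subset subset_trans)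
    show "continuous_on (cball z \<rho>) ((deriv ^^ m) f)" using holomorphic_on_imp_continuous_on[OF hol] sub by (rule continuous_on_subset)
    fix w assume "norm (z - w) = \<rho>"
    then have "w \<in> cball z \<rho>" by (simp add: dist_norm)
    then have "norm w < 1" using sub by auto
    then show "norm ((deriv ^^ m) f w) \<le> B" by (rule B)
  qed (rule \<rho>)
  then show ?thesis by (simp add: \<rho>_def mult.commute)
qed

text \<open>
  Combine Cramer's rule with the bounds for the derivatives of the linear combination. The entries of the
  matrix, and hence the cofactors, grow at most like a power of \<open>1 / (1 - |z|)\<close>.
\<close>

lemma wronskian_le_majorant:
  assumes n: "n > 0" and f: "\<And>j. j \<le> n \<Longrightarrow> f j holomorphic_on ball 0 1"
    and low: "\<And>i j z. i < n \<Longrightarrow> j \<le> n \<Longrightarrow> norm z < 1 \<Longrightarrow> norm ((deriv ^^ i) (f j) z) \<le> B" and B: "1 \<le> B"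
    and k: "k \<le> n" "l k \<noteq> 0" and \<mu>: "circle_borel \<mu>" and h: "integrable circle_measure h" "\<And>\<zeta>. 0 \<le> h \<zeta>"
    and le: "\<And>z. norm z < 1 \<Longrightarrow> norm (\<Sum>j=0..n. l j * f j z)
      \<le> exp (poisson_integral circle_measure h z - poisson_integral \<mu> (\<lambda>_. 1) z)"
  obtains C m where "C > 0" "\<And>z. norm z < 1 \<Longrightarrow> norm (det (wronskian_mat f (Suc n) z))
      \<le> C * (1 / (1 - norm z)) ^ m * exp (poisson_integral circle_measure h z - poisson_integral \<mu> (\<lambda>_. 1) z)"
proof -
  define g where "g z = (\<Sum>j=0..n. l j * f j z)" for z
  have g: "g holomorphic_on ball 0 1" unfolding g_def using f by (intro holomorphic_intros) auto
  define E where "E = exp ((\<integral>\<zeta>. h \<zeta> \<partial>circle_measure) + measure \<mu> UNIV)"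
  define c where "c = fact (Suc n) * (2 * B) ^ Suc n * (\<Sum>i<Suc n. fact i * 4 ^ i * E)"
  define M where "M = Suc n + 2 * n"
  have c0: "c > 0"
    unfolding c_def using B by (intro mult_pos_pos sum_pos) (auto simp: E_def)
  show thesis
  proof (rule that[of "c / norm (l k)" M])
    show "c / norm (l k) > 0" using c0 k by simp
    fix z :: complex assume z: "norm z < 1"
    define s where "s = 1 / (1 - norm z)"
    have s1: "1 \<le> s" using z by (simp add: s_def)
    define X where "X = exp (poisson_integral circle_measure h z - poisson_integral \<mu> (\<lambda>_. 1) z)"
    have entries: "norm (wronskian_mat f (Suc n) z $$ (i, j)) \<le> 2 * B * s" if ij: "i < Suc n" "j < Suc n" for i j
    proof (cases "i < n")
      case True
      have "norm ((deriv ^^ i) (f j) z) \<le> B" using low[OF True _ z] ij by simp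
      also have "\<dots> \<le> 2 * B * s" using B s1 mult_mono[of 1 "2 * B" 1 s] mult_mono[of B "2 * B" 1 s] by simp
      finally show ?thesis using ij by simp
    next
      case False
      then have i: "i = Suc (n - 1)" using ij n by simp
      have "norm ((deriv ^^ Suc (n - 1)) (f j) z) \<le> 2 * B / (1 - norm z)"
        using ij n by (intro top_deriv_le f low z) auto
      then show ?thesis using ij i by (simp add: s_def del: funpow.simps)
    qed
    have Bs: "1 \<le> 2 * B * s" using B s1 mult_mono[of 1 "2 * B" 1 s] by simp
    have dg: "norm ((deriv ^^ i) g z) \<le> fact i * 4 ^ i * E * (s ^ (2 * n) * X)" if i: "i < Suc n" for i
    proof -
      have "norm ((deriv ^^ i) g z) \<le> fact i * (4 / (1 - norm z)\<^sup>2) ^ i *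
        exp ((\<integral>\<zeta>. h \<zeta> \<partial>circle_measure) + measure \<mu> UNIV + poisson_integral circle_measure h z - poisson_integral \<mu> (\<lambda>_. 1) z)"
        by (rule higher_deriv_le_majorant[OF g \<mu> h _ z]) (use le in \<open>simp add: g_def\<close>)
      also have "\<dots> = fact i * 4 ^ i * E * (s ^ (2 * i) * X)"
        by (simp add: E_def X_def s_def power_divide power_mult flip: exp_add)
      also have "\<dots> \<le> fact i * 4 ^ i * E * (s ^ (2 * n) * X)"
        using i s1 by (intro mult_left_mono mult_right_mono power_increasing) (auto simp: E_def X_def)
      finally show ?thesis .
    qed
    have row: "(\<Sum>j<Suc n. wronskian_mat f (Suc n) z $$ (i, j) * l j) = (deriv ^^ i) g z" if i: "i < Suc n" for i
    proof -
      have "(deriv ^^ i) g z = (\<Sum>j=0..n. l j * (deriv ^^ i) (f j) z)"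
        unfolding g_def using z by (intro higher_deriv_linear_combination f) auto
      also have "\<dots> = (\<Sum>j<Suc n. wronskian_mat f (Suc n) z $$ (i, j) * l j)"
        unfolding atLeast0AtMost lessThan_Suc_atMost[symmetric] using i by (intro sum.cong) auto
      finally show ?thesis by simp
    qed
    have "norm (det (wronskian_mat f (Suc n) z)) * norm (l k)
        = norm (\<Sum>i<Suc n. cofactor (wronskian_mat f (Suc n) z) i k * (\<Sum>j<Suc n. wronskian_mat f (Suc n) z $$ (i, j) * l j))"
      unfolding norm_mult[symmetric]
      by (subst det_mult_eq_sum_cofactor[OF wronskian_mat_carrier]) (use k in auto)
    also have "\<dots> \<le> (\<Sum>i<Suc n. norm (cofactor (wronskian_mat f (Suc n) z) i k) * norm ((deriv ^^ i) g z))"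
      by (rule sum_norm_le) (use row in \<open>simp add: norm_mult del: sum.lessThan_Suc\<close>)
    also have "\<dots> \<le> (\<Sum>i<Suc n. (fact (Suc n) * (2 * B * s) ^ Suc n) * (fact i * 4 ^ i * E * (s ^ (2 * n) * X)))"
      using k Bs by (intro sum_mono mult_mono norm_cofactor_le[OF wronskian_mat_carrier] entries dg) auto
    also have "\<dots> = c * s ^ M * X"
      unfolding c_def M_def power_mult_distrib power_add sum_distrib_left sum_distrib_right
      by (intro sum.cong) (auto simp: mult_ac)
    finally show "norm (det (wronskian_mat f (Suc n) z)) \<le> c / norm (l k) * (1 / (1 - norm z)) ^ M
        * exp (poisson_integral circle_measure h z - poisson_integral \<mu> (\<lambda>_. 1) z)"
      using k by (simp add: s_def[symmetric] X_def[symmetric] field_simps)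
  qed
qed

text \<open>
  The negative part of \<open>ln |W|\<close> on the circle of radius \<open>r\<close>. The truncation level \<open>1 / (1 - r)\<^sup>2\<close> keeps it finite at zeros of \<open>W\<close>,
  yet for \<open>r\<close> near \<open>1\<close> it exceeds every value on that circle of the Poisson integral of a given finite measure.
\<close>

definition truncated_log :: "(complex \<Rightarrow> complex) \<Rightarrow> real \<Rightarrow> complex \<Rightarrow> real" where
  "truncated_log W r \<zeta> = max 0 (- ln (max (norm (W (of_real r * \<zeta>))) (exp (- (1 / (1 - r)\<^sup>2)))))"

text \<open>
  Three cases. If \<open>1 - r \<le> d\<^sup>2\<close>, where \<open>d\<close> is the distance of \<open>\<zeta>\<close> from the support, the left-hand side is at
  most eight times the total mass of \<open>\<mu>\<close>. If \<open>W\<close> is below the truncation level, the first term on the right suffices. Otherwise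
  the assumption on \<open>W\<close> gives the bound with \<open>m ln (1 / (1 - r))\<close>, and \<open>max d (1 - r)\<close> is at most the square root of
  \<open>1 - r\<close>.
\<close>

lemma poisson_le_truncated_log:
  assumes \<mu>: "circle_borel \<mu>" and h: "integrable circle_measure h" "\<And>\<zeta>. 0 \<le> h \<zeta>"
    and C: "C > 0" and W: "\<And>z. norm z < 1 \<Longrightarrow> norm (W z)
      \<le> C * (1 / (1 - norm z)) ^ m * exp (poisson_integral circle_measure h z - poisson_integral \<mu> (\<lambda>_. 1) z)"
    and r: "0 \<le> r" "r < 1" "2 * measure \<mu> UNIV * (1 - r) \<le> 1" and \<zeta>: "norm \<zeta> = 1"
  shows "poisson_integral \<mu> (\<lambda>_. 1) (of_real r * \<zeta>) \<le> truncated_log W r \<zeta> +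
    ((8 * measure \<mu> UNIV + max 0 (ln C)) +
     (2 * real m * max 0 (- ln (max (infdist \<zeta> (measure_support \<mu>)) (1 - r))) +
      poisson_integral circle_measure h (of_real r * \<zeta>)))"
proof -
  define z where "z = of_real r * \<zeta>"
  have z: "norm z = r" "norm z < 1" using r \<zeta> by (auto simp: z_def norm_mult)
  define P where "P = poisson_integral \<mu> (\<lambda>_. 1) z"
  define H where "H = poisson_integral circle_measure h z"
  define d where "d = infdist \<zeta> (measure_support \<mu>)"
  define D where "D = max d (1 - r)"
  define t where "t = truncated_log W r \<zeta>"
  have t0: "0 \<le> t" by (simp add: t_def truncated_log_def)
  have H0: "0 \<le> H" unfolding H_def by (intro poisson_integral_nonneg h z)
  have D0: "D > 0" using r by (simp add: D_def less_max_iff_disj)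
  have rest: "0 \<le> 2 * real m * max 0 (- ln D)" by simp
  have "P \<le> t + ((8 * measure \<mu> UNIV + max 0 (ln C)) + (2 * real m * max 0 (- ln D) + H))"
  proof (cases "1 - r \<le> d\<^sup>2")
    case True
    then have "P \<le> 8 * measure \<mu> UNIV"
      unfolding P_def z_def d_def by (intro poisson_integral_le_distance \<mu> \<zeta> r)
    then show ?thesis using t0 H0 rest by linarith
  next
    case False
    show ?thesis
    proof (cases "norm (W z) \<le> exp (- (1 / (1 - r)\<^sup>2))")
      case True
      then have "t = 1 / (1 - r)\<^sup>2" by (simp add: t_def truncated_log_def z_def[symmetric] max_absorb2)
      moreover have "P \<le> 2 / (1 - r) * measure \<mu> UNIV"
        using poisson_integral_le_total[OF \<mu> z(2)] by (simp add: P_def z)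
      moreover have "2 / (1 - r) * measure \<mu> UNIV \<le> 1 / (1 - r)\<^sup>2"
      proof -
        have "2 / (1 - r) * measure \<mu> UNIV = 2 * measure \<mu> UNIV * (1 - r) / (1 - r)\<^sup>2"
          using r by (simp add: power2_eq_square)
        also have "\<dots> \<le> 1 / (1 - r)\<^sup>2" using r by (intro divide_right_mono) auto
        finally show ?thesis .
      qed
      moreover have "0 \<le> measure \<mu> UNIV" by simp
      ultimately show ?thesis using H0 rest by linarith
    next
      case False
      then have Wpos: "norm (W z) > 0" by (meson exp_gt_zero less_trans not_le)
      have t: "- ln (norm (W z)) \<le> t"
        using False by (simp add: t_def truncated_log_def z_def[symmetric] max_absorb1)
      have "norm (W z) \<le> C * (1 / (1 - r)) ^ m * exp (H - P)"
        using W[OF z(2)] by (simp add: z H_def P_def)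
      moreover define a where "a = 1 / (1 - r)"
      moreover have a0: "a > 0" using r by (simp add: a_def)
      ultimately have "norm (W z) \<le> C * a ^ m * exp (H - P)" by simp
      then have "ln (norm (W z)) \<le> ln (C * a ^ m * exp (H - P))"
        using Wpos C a0 by (subst ln_le_cancel_iff) auto
      also have "\<dots> = ln C + real m * ln a + (H - P)"
        using C a0 by (simp add: ln_mult ln_realpow)
      also have "ln a = - ln (1 - r)" using r by (simp add: a_def ln_div)
      finally have 1: "P \<le> t + ln C + real m * (- ln (1 - r)) + H" using t by linarith
      have "D\<^sup>2 \<le> 1 - r"
      proof (cases "d \<le> 1 - r")
        case True
        then show ?thesis using r by (simp add: D_def max_absorb2 power2_eq_square mult_left_le)
      next
        case d: False
        then show ?thesis using \<open>\<not> 1 - r \<le> d\<^sup>2\<close> by (simp add: D_def max_absorb1)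
      qed
      then have "ln (D\<^sup>2) \<le> ln (1 - r)" using D0 r by (subst ln_le_cancel_iff) auto
      then have "- ln (1 - r) \<le> 2 * max 0 (- ln D)" using D0 by (simp add: ln_realpow)
      then have "real m * (- ln (1 - r)) \<le> real m * (2 * max 0 (- ln D))" by (rule mult_left_mono) simp
      then have "real m * (- ln (1 - r)) \<le> 2 * real m * max 0 (- ln D)" by (simp add: mult_ac)
      moreover have "ln C \<le> 8 * measure \<mu> UNIV + max 0 (ln C)" by (simp add: add_increasing)
      ultimately show ?thesis using 1 by linarith
    qed
  qed
  then show ?thesis by (simp add: P_def H_def D_def d_def t_def z_def)
qed

text \<open>
  Let first the radius tend to \<open>1\<close>, then shrink the cutoff function to the indicator of \<open>K\<close>.
\<close>

lemma singular_measure_le_weak_limit: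
  assumes \<mu>: "circle_borel \<mu>" and q: "radially_uniformly_integrable q"
    and dom: "\<And>r \<zeta>. r\<^sub>m \<le> r \<Longrightarrow> r < 1 \<Longrightarrow> norm \<zeta> = 1 \<Longrightarrow>
      poisson_integral \<mu> (\<lambda>_. 1) (of_real r * \<zeta>) \<le> u r \<zeta> + q r \<zeta>"
    and rs: "r\<^sub>m < 1"
    and v: "\<And>k. v k < 1" "v \<longlonglongrightarrow> 1" and um: "\<And>k. u (v k) \<in> borel_measurable borel" "\<And>k \<zeta>. 0 \<le> u (v k) \<zeta>"
    and \<sigma>: "sets \<sigma> = sets borel" "finite_measure \<sigma>"
    and lim: "\<And>\<phi> e. continuous_on UNIV \<phi> \<Longrightarrow> (\<And>\<zeta>. 0 \<le> \<phi> \<zeta> \<and> \<phi> \<zeta> \<le> 1) \<Longrightarrow> e > 0 \<Longrightarrow>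
      \<forall>\<^sub>F k in sequentially. (\<integral>\<^sup>+\<zeta>. ennreal (\<phi> \<zeta>) * ennreal (u (v k) \<zeta>) \<partial>circle_measure) \<le> ennreal ((\<integral>\<zeta>. \<phi> \<zeta> \<partial>\<sigma>) + e)"
    and K: "compact K" "emeasure circle_measure K = 0"
  shows "emeasure \<mu> K \<le> emeasure \<sigma> K"
proof (cases "K = {}")
  case False
  interpret \<mu>: finite_measure \<mu> by (rule circle_borel_finite[OF \<mu>])
  interpret \<sigma>: finite_measure \<sigma> by fact
  have Kc: "closed K" using K by (simp add: compact_imp_closed)
  have approx: "measure \<mu> K \<le> measure \<sigma> K + 2 * e" if e: "e > 0" for e
  proof -
    obtain \<delta>0 where d0: "\<delta>0 > 0" "\<And>\<delta>. 0 < \<delta> \<Longrightarrow> \<delta> \<le> \<delta>0 \<Longrightarrow> \<exists>r\<^sub>0. 0 \<le> r\<^sub>0 \<and> r\<^sub>0 < 1 \<and> (\<forall>r w. r\<^sub>0 \<le> r \<longrightarrow> r < 1 \<longrightarrow> w \<in> borel_measurable borel \<longrightarrow>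
     (\<forall>\<zeta>. norm \<zeta> = 1 \<longrightarrow> \<zeta> \<in> UNIV \<longrightarrow> ennreal (poisson_integral \<mu> (\<lambda>_. 1) (of_real r * \<zeta>)) \<le> w \<zeta> + ennreal (q r \<zeta>)) \<longrightarrow>
     emeasure \<mu> K \<le> (\<integral>\<^sup>+\<zeta>. ennreal (bump K \<delta> \<zeta>) * w \<zeta> \<partial>circle_measure) + ennreal e)"
      using emeasure_null_compact_le[OF \<mu> q K(1) False K(2) subset_UNIV open_UNIV e] by blast
    obtain N :: nat where "inverse (real (Suc N)) < \<delta>0" using reals_Archimedean d0(1) by blast
    then have N: "1 / (real N + 1) < \<delta>0" by (simp add: inverse_eq_divide add.commute)
    have "measure \<mu> K \<le> (\<integral>\<zeta>. bump K (1 / (real j + 1)) \<zeta> \<partial>\<sigma>) + 2 * e" if j: "j \<ge> N" for j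
    proof -
      define \<delta> where "\<delta> = 1 / (real j + 1)"
      have "\<delta> \<le> 1 / (real N + 1)" unfolding \<delta>_def using j by (intro divide_left_mono) auto
      then have \<delta>: "0 < \<delta>" "\<delta> \<le> \<delta>0" using N by (auto simp: \<delta>_def)
      from d0(2)[OF \<delta>] obtain r0 where r0: "0 \<le> r0" "r0 < 1"
        "\<And>r w. r0 \<le> r \<Longrightarrow> r < 1 \<Longrightarrow> w \<in> borel_measurable borel \<Longrightarrow>
         (\<forall>\<zeta>. norm \<zeta> = 1 \<longrightarrow> \<zeta> \<in> UNIV \<longrightarrow> ennreal (poisson_integral \<mu> (\<lambda>_. 1) (of_real r * \<zeta>)) \<le> w \<zeta> + ennreal (q r \<zeta>)) \<Longrightarrow>
         emeasure \<mu> K \<le> (\<integral>\<^sup>+\<zeta>. ennreal (bump K \<delta> \<zeta>) * w \<zeta> \<partial>circle_measure) + ennreal e"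
        by blast
      have "\<forall>\<^sub>F k in sequentially. max r0 r\<^sub>m < v k"
        using v(2) r0(2) rs by (intro order_tendstoD) auto
      moreover have "\<forall>\<^sub>F k in sequentially. (\<integral>\<^sup>+\<zeta>. ennreal (bump K \<delta> \<zeta>) * ennreal (u (v k) \<zeta>) \<partial>circle_measure)
          \<le> ennreal ((\<integral>\<zeta>. bump K \<delta> \<zeta> \<partial>\<sigma>) + e)"
        using \<delta> e by (intro lim bump_continuous) (auto simp: bump_bounds)
      ultimately have "\<forall>\<^sub>F k in sequentially. max r0 r\<^sub>m < v k \<and> (\<integral>\<^sup>+\<zeta>. ennreal (bump K \<delta> \<zeta>) * ennreal (u (v k) \<zeta>) \<partial>circle_measure)
          \<le> ennreal ((\<integral>\<zeta>. bump K \<delta> \<zeta> \<partial>\<sigma>) + e)" by (rule eventually_conj)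
      then obtain k where k: "max r0 r\<^sub>m < v k" "(\<integral>\<^sup>+\<zeta>. ennreal (bump K \<delta> \<zeta>) * ennreal (u (v k) \<zeta>) \<partial>circle_measure)
          \<le> ennreal ((\<integral>\<zeta>. bump K \<delta> \<zeta> \<partial>\<sigma>) + e)"
        using eventually_happens'[OF sequentially_bot] by blast
      have i0: "0 \<le> (\<integral>\<zeta>. bump K \<delta> \<zeta> \<partial>\<sigma>)" using bump_bounds(1)[OF \<delta>(1)] by simp
      have "emeasure \<mu> K \<le> (\<integral>\<^sup>+\<zeta>. ennreal (bump K \<delta> \<zeta>) * ennreal (u (v k) \<zeta>) \<partial>circle_measure) + ennreal e"
      proof (rule r0(3)[of "v k"])
        show "(\<lambda>\<zeta>. ennreal (u (v k) \<zeta>)) \<in> borel_measurable borel" using um(1)[of k] by measurable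
        show "\<forall>\<zeta>. norm \<zeta> = 1 \<longrightarrow> \<zeta> \<in> UNIV \<longrightarrow> ennreal (poisson_integral \<mu> (\<lambda>_. 1) (of_real (v k) * \<zeta>))
            \<le> ennreal (u (v k) \<zeta>) + ennreal (q (v k) \<zeta>)"
        proof (intro allI impI)
          fix \<zeta> :: complex assume "norm \<zeta> = 1"
          then have "poisson_integral \<mu> (\<lambda>_. 1) (of_real (v k) * \<zeta>) \<le> u (v k) \<zeta> + q (v k) \<zeta>"
            using k v by (intro dom) auto
          then have "ennreal (poisson_integral \<mu> (\<lambda>_. 1) (of_real (v k) * \<zeta>)) \<le> ennreal (u (v k) \<zeta> + q (v k) \<zeta>)"
            by (rule ennreal_leI)
          also have "\<dots> \<le> ennreal (u (v k) \<zeta>) + ennreal (q (v k) \<zeta>)"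
            by (rule ennreal_add_le)
          finally show "ennreal (poisson_integral \<mu> (\<lambda>_. 1) (of_real (v k) * \<zeta>))
            \<le> ennreal (u (v k) \<zeta>) + ennreal (q (v k) \<zeta>)" .
        qed
      qed (use k v in auto)
      also have "\<dots> \<le> ennreal ((\<integral>\<zeta>. bump K \<delta> \<zeta> \<partial>\<sigma>) + e) + ennreal e" by (intro add_right_mono k)
      also have "\<dots> = ennreal ((\<integral>\<zeta>. bump K \<delta> \<zeta> \<partial>\<sigma>) + 2 * e)" using i0 e by (simp flip: ennreal_plus)
      finally have "ennreal (measure \<mu> K) \<le> ennreal ((\<integral>\<zeta>. bump K \<delta> \<zeta> \<partial>\<sigma>) + 2 * e)"
        by (simp only: \<mu>.emeasure_eq_measure)
      moreover have "0 \<le> (\<integral>\<zeta>. bump K \<delta> \<zeta> \<partial>\<sigma>) + 2 * e" using i0 e by simp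
      ultimately show ?thesis unfolding \<delta>_def by (simp only: ennreal_le_iff)
    qed
    moreover have "(\<lambda>j. (\<integral>\<zeta>. bump K (1 / (real j + 1)) \<zeta> \<partial>\<sigma>) + 2 * e) \<longlonglongrightarrow> measure \<sigma> K + 2 * e"
      by (intro tendsto_intros integral_bump_tendsto \<sigma> Kc False)
    ultimately show ?thesis by (intro LIMSEQ_le_const[of _ _ "measure \<mu> K"]) auto
  qed
  have "measure \<mu> K \<le> measure \<sigma> K"
  proof (rule field_le_epsilon)
    fix e :: real assume "e > 0"
    then show "measure \<mu> K \<le> measure \<sigma> K + e" using approx[of "e / 2"] by simp
  qed
  then show ?thesis by (simp add: \<mu>.emeasure_eq_measure \<sigma>.emeasure_eq_measure ennreal_leI)
qed simp

theorem theorem4p2: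
  fixes n :: nat and f :: "nat \<Rightarrow> complex \<Rightarrow> complex"
  assumes "n > 0"
    and "\<And>j. j \<le> n \<Longrightarrow> hardy1_deriv n (f j)"
    and "lin_indep_on_disk n f"
  shows "\<exists>S. singular_inner S \<and>
           (\<forall>l :: nat \<Rightarrow> complex. (\<Sum>j=0..n. norm (l j)) > 0 \<longrightarrow>
              (\<forall>T. is_singular_factor T (\<lambda>z. \<Sum>j=0..n. l j * f j z) \<longrightarrow> inner_dvd T S))"
proof -
  have f: "f j holomorphic_on ball 0 1" if "j \<le> n" for j
    using assms(2)[OF that] by (simp add: hardy1_deriv_def)
  have top: "mean_bounded ((deriv ^^ n) (f j))" if "j \<le> n" for j
    using assms(2)[OF that] by (auto simp: hardy1_deriv_def intro: hardy1_imp_mean_bounded)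
  have "\<forall>i j. \<exists>B. i < n \<longrightarrow> j \<le> n \<longrightarrow> (\<forall>z. norm z < 1 \<longrightarrow> norm ((deriv ^^ i) (f j) z) \<le> B)"
    using lower_derivs_bounded[OF f top] by blast
  then obtain b where b: "\<And>i j z. i < n \<Longrightarrow> j \<le> n \<Longrightarrow> norm z < 1 \<Longrightarrow> norm ((deriv ^^ i) (f j) z) \<le> b i j"
    by metis
  define B where "B = 1 + (\<Sum>i<n. \<Sum>j\<le>n. \<bar>b i j\<bar>)"
  have B: "1 \<le> B" unfolding B_def by (simp add: sum_nonneg)
  have low: "norm ((deriv ^^ i) (f j) z) \<le> B" if "i < n" "j \<le> n" "norm z < 1" for i j z
  proof -
    have "norm ((deriv ^^ i) (f j) z) \<le> \<bar>b i j\<bar>" using b[OF that] by simp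
    also have "\<dots> \<le> (\<Sum>j\<le>n. \<bar>b i j\<bar>)" using that by (intro member_le_sum) auto
    also have "\<dots> \<le> (\<Sum>i<n. \<Sum>j\<le>n. \<bar>b i j\<bar>)" using that by (intro member_le_sum) (auto intro: sum_nonneg)
    finally show ?thesis by (simp add: B_def)
  qed
  have mb: "mean_bounded ((deriv ^^ i) (f j))" if "i \<le> n" "j \<le> n" for i j
    using that top low bounded_imp_mean_bounded[of "(deriv ^^ i) (f j)" B] by (cases "i = n") auto
  define W where "W z = det (wronskian_mat f (Suc n) z)" for z
  have Whol: "W holomorphic_on ball 0 1"
    unfolding W_def using f by (intro holomorphic_wronskian) auto
  have Wmb: "mean_bounded W"
    unfolding W_def by (rule mean_bounded_wronskian[OF f low B top])
  obtain z0 where z0: "norm z0 < 1" "W z0 \<noteq> 0"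
    using wronskian_nonzero[OF f assms(3)] by (auto simp: W_def)
  obtain C r1 where C: "C \<ge> 0" and r1: "0 \<le> r1" "r1 < 1"
    and logW: "\<And>r \<delta>. r1 \<le> r \<Longrightarrow> r < 1 \<Longrightarrow> 0 < \<delta> \<Longrightarrow> \<delta> \<le> 1 \<Longrightarrow>
       (\<integral>\<^sup>+\<zeta>. ennreal (- ln (max (norm (W (of_real r * \<zeta>))) \<delta>)) \<partial>circle_measure) \<le> ennreal C"
    by (rule log_integral_bounded_near_boundary[OF Whol Wmb z0]; (assumption | (rule that; blast)))
  define W' where "W' z = (if norm z < 1 then W z else 0)" for z
  have W'm [measurable]: "W' \<in> borel_measurable borel"
    using measurable_on_disk[OF Whol] by (simp add: W'_def[abs_def])
  define u where "u = truncated_log W'"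
  define \<rho> where "\<rho> k = 1 - (1 - r1) / (real k + 2)" for k :: nat
  have \<rho>: "r1 \<le> \<rho> k" "\<rho> k < 1" for k
  proof -
    have "(1 - r1) / (real k + 2) \<le> (1 - r1) / 1" using r1 by (intro divide_left_mono) auto
    then show "r1 \<le> \<rho> k" by (simp add: \<rho>_def)
    show "\<rho> k < 1" using r1 by (simp add: \<rho>_def)
  qed
  have \<rho>lim: "\<rho> \<longlonglongrightarrow> 1"
  proof -
    have "(\<lambda>k. 1 - (1 - r1) * inverse (real (Suc (k + 1)))) \<longlonglongrightarrow> 1 - (1 - r1) * 0"
      by (intro tendsto_intros LIMSEQ_ignore_initial_segment[OF LIMSEQ_inverse_real_of_nat])
    then show ?thesis by (simp add: \<rho>_def[abs_def] inverse_eq_divide add.commute)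
  qed
  have um [measurable]: "u r \<in> borel_measurable borel" for r unfolding u_def truncated_log_def by measurable
  have u0: "0 \<le> u r \<zeta>" for r \<zeta> by (simp add: u_def truncated_log_def)
  have uC: "(\<integral>\<^sup>+\<zeta>. ennreal (u (\<rho> k) \<zeta>) \<partial>circle_measure) \<le> ennreal C" for k
  proof -
    have "(\<integral>\<^sup>+\<zeta>. ennreal (u (\<rho> k) \<zeta>) \<partial>circle_measure)
        = (\<integral>\<^sup>+\<zeta>. ennreal (- ln (max (norm (W (of_real (\<rho> k) * \<zeta>))) (exp (- (1 / (1 - \<rho> k)\<^sup>2))))) \<partial>circle_measure)"
    proof (rule nn_integral_cong_AE, rule eventually_mono[OF AE_circle_measure])
      fix \<zeta> :: complex assume "norm \<zeta> = 1"
      then have "norm (of_real (\<rho> k) * \<zeta>) < 1" using \<rho>[of k] r1 by (simp add: norm_mult)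
      then show "ennreal (u (\<rho> k) \<zeta>) = ennreal (- ln (max (norm (W (of_real (\<rho> k) * \<zeta>))) (exp (- (1 / (1 - \<rho> k)\<^sup>2)))))"
        by (auto simp: u_def truncated_log_def W'_def max_def ennreal_neg)
    qed
    also have "\<dots> \<le> ennreal C" by (intro logW \<rho>) auto
    finally show ?thesis .
  qed
  obtain \<sigma> s where \<sigma>: "sets \<sigma> = sets borel" "finite_measure \<sigma>" and s: "strict_mono s"
    and lim: "\<And>\<phi> e. continuous_on UNIV \<phi> \<Longrightarrow> (\<And>\<zeta>. 0 \<le> \<phi> \<zeta> \<and> \<phi> \<zeta> \<le> 1) \<Longrightarrow> e > 0 \<Longrightarrow>
      \<forall>\<^sub>F k in sequentially. (\<integral>\<^sup>+\<zeta>. ennreal (\<phi> \<zeta>) * ennreal (u (\<rho> (s k)) \<zeta>) \<partial>circle_measure) \<le> ennreal ((\<integral>\<zeta>. \<phi> \<zeta> \<partial>\<sigma>) + e)"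
  proof (rule weak_limit_of_densities[of "\<lambda>k. u (\<rho> k)" C, OF um u0 C uC], goal_cases)
    case (1 \<sigma> s)
    show thesis by (rule that[OF 1(2-4)]) (rule 1(5); blast)
  qed
  obtain \<sigma>s where sing: "singular_circle_measure \<sigma>s"
    and dom: "\<And>\<mu> A. singular_circle_measure \<mu> \<Longrightarrow>
      (\<And>K. compact K \<Longrightarrow> emeasure circle_measure K = 0 \<Longrightarrow> emeasure \<mu> K \<le> emeasure \<sigma> K) \<Longrightarrow>
      A \<in> sets borel \<Longrightarrow> emeasure \<mu> A \<le> emeasure \<sigma>s A"
    by (rule singular_part_dominates[OF \<sigma>]; (assumption | (rule that; blast)))
  define S where "S z = exp (- herglotz_integral \<sigma>s (\<lambda>_. 1) z)" for z
  have main: "inner_dvd T S"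
    if l: "(\<Sum>j=0..n. norm (l j)) > 0" and T: "is_singular_factor T (\<lambda>z. \<Sum>j=0..n. l j * f j z)" for l T
  proof -
    define g where "g z = (\<Sum>j=0..n. l j * f j z)" for z
    have "\<exists>k\<le>n. l k \<noteq> 0"
    proof (rule ccontr)
      assume "\<not> ?thesis"
      then have "(\<Sum>j=0..n. norm (l j)) = 0" by (intro sum.neutral) auto
      then show False using l by simp
    qed
    then obtain k where k: "k \<le> n" "l k \<noteq> 0" by blast
    have ghol: "g holomorphic_on ball 0 1" unfolding g_def using f by (intro holomorphic_intros) auto
    have "\<not> (\<forall>z\<in>ball 0 1. g z = 0)"
    proof
      assume "\<forall>z\<in>ball 0 1. g z = 0"
      then have "\<forall>j\<le>n. l j = 0" using assms(3) unfolding lin_indep_on_disk_def g_def by blast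
      then show False using k by blast
    qed
    then obtain w0 where w0: "norm w0 < 1" "g w0 \<noteq> 0" by auto
    have gmb: "mean_bounded ((deriv ^^ i) g)" if i: "i \<le> n" for i
    proof (rule mean_bounded_dominated[where g = "\<lambda>j. (deriv ^^ i) (f j)" and N = "Suc n" and c = "\<Sum>j=0..n. norm (l j)"])
      fix z :: complex assume z: "norm z < 1"
      have "norm ((deriv ^^ i) g z) = norm (\<Sum>j=0..n. l j * (deriv ^^ i) (f j) z)"
        unfolding g_def using z f by (subst higher_deriv_linear_combination) auto
      also have "\<dots> \<le> (\<Sum>j=0..n. norm (l j) * norm ((deriv ^^ i) (f j) z))"
        by (rule sum_norm_le) (simp add: norm_mult)
      also have "\<dots> \<le> (\<Sum>j=0..n. norm (l j) * (\<Sum>j<Suc n. norm ((deriv ^^ i) (f j) z)))"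
        by (intro sum_mono mult_left_mono member_le_sum) auto
      finally show "norm ((deriv ^^ i) g z) \<le> (\<Sum>j=0..n. norm (l j)) * (\<Sum>j<Suc n. norm ((deriv ^^ i) (f j) z))"
        by (simp add: sum_distrib_right)
    qed (use f mb i in \<open>auto intro!: holomorphic_higher_deriv sum_nonneg\<close>)
    obtain \<mu> h where \<mu>: "singular_circle_measure \<mu>" and T\<mu>: "\<And>z. norm z < 1 \<Longrightarrow> T z = exp (- herglotz_integral \<mu> (\<lambda>_. 1) z)"
      and h: "integrable circle_measure h" "\<And>\<zeta>. 0 \<le> h \<zeta>"
      and maj': "\<And>z. norm z < 1 \<Longrightarrow> norm (\<Sum>j=0..n. l j * f j z)
        \<le> exp (poisson_integral circle_measure h z - poisson_integral \<mu> (\<lambda>_. 1) z)"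
      by (rule singular_factor_majorant[OF T]; (assumption | (rule that; blast)))
    have maj: "norm (g z) \<le> exp (poisson_integral circle_measure h z - poisson_integral \<mu> (\<lambda>_. 1) z)" if "norm z < 1" for z
      using maj'[OF that] by (simp add: g_def)
    have \<mu>c: "circle_borel \<mu>" by (rule singular_circle_measure_imp_circle_borel[OF \<mu>])
    have leK: "emeasure \<mu> K \<le> emeasure \<sigma> K" if K: "compact K" "emeasure circle_measure K = 0" for K
    proof (cases "emeasure \<mu> UNIV > 0")
      case False
      then have "emeasure \<mu> K = 0"
        using emeasure_mono[of K UNIV \<mu>] by (simp add: circle_borel_sets[OF \<mu>c])
      then show ?thesis by simp
    next
      case True
      have d1: "mean_bounded (deriv g)" using gmb[of 1] assms(1) by simp
      have d0: "mean_bounded g" using gmb[of 0] by simp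
      obtain G where G: "integrable circle_measure G"
        "AE \<zeta> in circle_measure. \<forall>\<delta>. 0 < \<delta> \<longrightarrow> \<delta> \<le> 1 \<longrightarrow> - ln (max (infdist \<zeta> (measure_support \<mu>)) \<delta>) \<le> G \<zeta>"
        by (rule log_distance_to_support_integrable[OF ghol d0 d1 w0 \<mu> True h maj]; (assumption | (rule that; blast)))
      have "\<exists>c m. c > 0 \<and> (\<forall>z. norm z < 1 \<longrightarrow> norm (W z)
          \<le> c * (1 / (1 - norm z)) ^ m * exp (poisson_integral circle_measure h z - poisson_integral \<mu> (\<lambda>_. 1) z))"
      proof (rule wronskian_le_majorant[where n = n and f = f and l = l and k = k and B = B and \<mu> = \<mu> and h = h])
        show "f j holomorphic_on ball 0 1" if "j \<le> n" for j by (rule f[OF that])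
        show "norm ((deriv ^^ i) (f j) z) \<le> B" if "i < n" "j \<le> n" "norm z < 1" for i j z by (rule low[OF that])
        show "norm (\<Sum>j=0..n. l j * f j z) \<le> exp (poisson_integral circle_measure h z - poisson_integral \<mu> (\<lambda>_. 1) z)"
          if "norm z < 1" for z by (rule maj'[OF that])
        fix c m assume c: "c > 0"
          and bound: "\<And>z. norm z < 1 \<Longrightarrow> norm (det (wronskian_mat f (Suc n) z))
            \<le> c * (1 / (1 - norm z)) ^ m * exp (poisson_integral circle_measure h z - poisson_integral \<mu> (\<lambda>_. 1) z)"
        show ?thesis
          by (intro exI[of _ c] exI[of _ m] conjI allI impI c) (simp only: W_def bound)
      qed (fact assms(1) B k \<mu>c h)+
      then obtain c m where c: "c > 0" "\<And>z. norm z < 1 \<Longrightarrow> norm (W z)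
          \<le> c * (1 / (1 - norm z)) ^ m * exp (poisson_integral circle_measure h z - poisson_integral \<mu> (\<lambda>_. 1) z)"
        by blast
      have W'c: "norm (W' z) \<le> c * (1 / (1 - norm z)) ^ m * exp (poisson_integral circle_measure h z - poisson_integral \<mu> (\<lambda>_. 1) z)"
        if "norm z < 1" for z using c(2)[OF that] that by (simp add: W'_def)
      define q where "q r \<zeta> = (8 * measure \<mu> UNIV + max 0 (ln c)) +
         (2 * real m * max 0 (- ln (max (infdist \<zeta> (measure_support \<mu>)) (1 - r))) +
          poisson_integral circle_measure h (of_real r * \<zeta>))" for r \<zeta>
      have q: "radially_uniformly_integrable q"
        unfolding q_def
      proof (intro radially_uniformly_integrable_add radially_uniformly_integrable_const radially_uniformly_integrable_poisson h)
        show "radially_uniformly_integrable (\<lambda>r \<zeta>. 2 * real m * max 0 (- ln (max (infdist \<zeta> (measure_support \<mu>)) (1 - r))))"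
        proof (rule radially_uniformly_integrable_dominated)
          have [measurable]: "(\<lambda>\<zeta>. infdist \<zeta> (measure_support \<mu>)) \<in> borel_measurable borel"
            by (intro borel_measurable_continuous_onI continuous_intros)
          show "(\<lambda>\<zeta>. 2 * real m * max 0 (- ln (max (infdist \<zeta> (measure_support \<mu>)) (1 - r)))) \<in> borel_measurable borel" for r
            by measurable
          show "integrable circle_measure (\<lambda>\<zeta>. 2 * real m * \<bar>G \<zeta>\<bar>)" using G by auto
          fix r :: real assume r: "r \<in> {0..<1}"
          show "AE \<zeta> in circle_measure. 2 * real m * max 0 (- ln (max (infdist \<zeta> (measure_support \<mu>)) (1 - r)))
              \<le> 2 * real m * \<bar>G \<zeta>\<bar>"
            using G(2)
          proof eventually_elim
            case (elim \<zeta>)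
            then have "- ln (max (infdist \<zeta> (measure_support \<mu>)) (1 - r)) \<le> G \<zeta>" using r by auto
            then show ?case by (intro mult_left_mono) auto
          qed
        qed
      qed
      \<comment> \<open>From this radius on, the truncation level exceeds the Poisson integral of \<open>\<mu>\<close>.\<close>
      define rs where "rs = max 0 (1 - 1 / (2 * measure \<mu> UNIV + 1))"
      have mp: "2 * measure \<mu> UNIV + 1 > 0" by (simp add: add_nonneg_pos)
      have rs1: "rs < 1" using mp by (simp add: rs_def)
      show ?thesis
      proof (rule singular_measure_le_weak_limit[OF \<mu>c q _ rs1, where u = u and v = "\<lambda>k. \<rho> (s k)"])
        fix r \<zeta> assume r: "rs \<le> r" "r < 1" and \<zeta>: "norm (\<zeta> :: complex) = 1"
        have "2 * measure \<mu> UNIV * (1 - r) \<le> (2 * measure \<mu> UNIV + 1) * (1 - r)"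
          using r by (intro mult_right_mono) auto
        also have "\<dots> \<le> (2 * measure \<mu> UNIV + 1) * (1 / (2 * measure \<mu> UNIV + 1))"
          using mp r by (intro mult_left_mono) (auto simp: rs_def)
        also have "\<dots> = 1" using mp by simp
        finally have r2: "2 * measure \<mu> UNIV * (1 - r) \<le> 1" .
        have r0: "0 \<le> r" using r by (simp add: rs_def)
        show "poisson_integral \<mu> (\<lambda>_. 1) (of_real r * \<zeta>) \<le> u r \<zeta> + q r \<zeta>"
          unfolding u_def q_def by (rule poisson_le_truncated_log[OF \<mu>c h c(1) W'c r0 r(2) r2 \<zeta>])
      next
        show "(\<lambda>k. \<rho> (s k)) \<longlonglongrightarrow> 1" using LIMSEQ_subseq_LIMSEQ[OF \<rho>lim s] by (simp add: o_def)
      qed (use \<rho> um u0 \<sigma> lim K in auto)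
    qed
    have "emeasure \<mu> A \<le> emeasure \<sigma>s A" if "A \<in> sets borel" for A
      using dom[OF \<mu> leK that] by blast
    then show ?thesis
      by (intro singular_inner_dvd[OF sing \<mu> _ T\<mu>]) (auto simp: S_def)
  qed
  moreover have "singular_inner S"
    unfolding singular_inner_def using sing
    by (intro exI[of _ \<sigma>s]) (auto simp: S_def herglotz_integral_def herglotz_kernel_def)
  ultimately show ?thesis by blast
qed

end
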